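(* Let $d\ge1$, let $\Omega\subset\mathbb{R}^d$ be a bounded convex polyhedral domain, and let $\mathcal{T}_1,\dots,\mathcal{T}_J=\mathcal{T}_h$ ($J\ge 1$) be triangulations of $\Omega$ such that $\mathcal{T}_l$ is a refinement of $\mathcal{T}_{l-1}$ for $2\le l\le J$ and the mesh sizes $h_l$ of $\mathcal{T}_l$ satisfy $c_1\gamma^{2l}\le h_l\le c_2\gamma^{2l}$, $1\le l\le J$, for some $\gamma\in(0,1)$ and constants $0<c_1\le c_2$. Suppose that $\mathcal{T}_h$ satisfies condition $\mathrm{(T)}$ of the context for some parameters $\rho,\sigma,C_0>0$. Define, for $v\in V_{h,0}$, $$B_{\mathrm{Jac}}v=\sum_{l=1}^Jh_l^2\sum_{i=1}^{N_l}Q_i^lv,\qquad B_{\mathrm{Ric}}v=\sum_{l=1}^Jh_l^{2-d}\sum_{i=1}^{N_l}(v,\phi_i^l)_{L^2(\Omega)}\phi_i^l,$$ where $N_l$ is the number of interior vertices of $\mathcal{T}_l$, $\{\phi_i^l\}_{i=1}^{N_l}$ is the nodal basis of $V_l$, and $Q_i^l$ is the $L^2(\Omega)$-orthogonal projection onto $\operatorname{span}\{\phi_i^l\}$. Let $\omega_i^l$ be the vertex patch in $\mathcal{T}_l$ of the vertex associated with $\phi_i^l$, and set $$\eta_i^l=\frac{2|\omega_i^l|}{(d+1)(d+2)h_l^d},\qquad \eta_-=\min_{1\le l\le J,\,1\le i\le N_l}\eta_i^l,\qquad \eta_+=\max_{1\le l\le J,\,1\le i\le N_l}\eta_i^l .$$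 Then $$\eta_-(B_{\mathrm{Jac}}v,v)_{L^2(\Omega)}\le(B_{\mathrm{Ric}}v,v)_{L^2(\Omega)}\le\eta_+(B_{\mathrm{Jac}}v,v)_{L^2(\Omega)},\qquad v\in V_{h,0}.$$ In particular, if $\eta_i^l$ is independent of $i$ and $l$, then $B_{\mathrm{Ric}}$ is a scalar multiple of $B_{\mathrm{Jac}}$, and $$\kappa(B_{\mathrm{Ric}}A)=\kappa(B_{\mathrm{Jac}}A)\le(d+2)\,\kappa(BA),$$ where $B=\sum_{l=1}^Jh_l^2Q_l$, $Q_l$ is the $L^2(\Omega)$-orthogonal projection of $V_{h,0}$ onto $V_l$, and $A\colon V_{h,0}\to V_{h,0}$ is defined by $(Av,w)_{L^2(\Omega)}=\int_\Omega\nabla v\cdot\nabla w\,dx$.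
   Context: Simplices are open sets. For a $d$-simplex $\tau$: $h_\tau$ is its diameter, $r_\tau$ its inradius, $\mathcal{V}(\tau)$ its vertices, $\mathcal{F}(\tau)$ its $(d-1)$-faces. A triangulation $\mathcal{T}$ of $\Omega$ is a finite conforming collection of pairwise disjoint $d$-simplices whose closures have union $\overline\Omega$; its mesh size is $\max_{\tau}h_\tau$. $\mathcal{T}'$ is a refinement of $\mathcal{T}$ if every element of $\mathcal{T}'$ is contained in an element of $\mathcal{T}$. The vertex patch $\omega_a$ of a vertex $a$ is the open set (interior of the closure) with $\overline{\omega}_a=\bigcup\{\overline\tau:\tau\in\mathcal{T},\ a\in\mathcal{V}(\tau)\}$. Condition (T) for a triangulation $\mathcal{T}$ of mesh size $h$, with parameters $\rho,\sigma,C_0$: (a) $h_\tau\le\rho r_\tau$ and $\sigma h\le h_\tau\le h$ for all $\tau\in\mathcal{T}$, and every vertex patch is convex; (b) for each vertex $a\in\partial\Omega$, with $\mathcal{K}_a$ the set of $(d-1)$-faces $K\subset\partial\Omega$ of $\mathcal{T}$ having $a$ as a vertex, $\tau_K$ the unique element with $K\in\mathcal{F}(\tau_K)$, and $\mu_{a,K}=|K|/\#(\mathcal{K}_a\cap\mathcal{F}(\tau_K))$, one has $|\omega_a|\le C_0h\sum_{K\in\mathcal{K}_a}\mu_{a,K}$. $V_l=\{v\in H_0^1(\Omega):v|_\tau\in\mathbb{P}_1(\tau)\ \forall\tau\in\mathcal{T}_l\}$ ($\mathbb{P}_1$ = affine functions), $V_{h,0}=V_J$. The nodal basis function $\phi_i^l\in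 V_l$ equals $1$ at the $i$-th interior vertex of $\mathcal{T}_l$ and $0$ at all other vertices. For a symmetric positive definite operator $M$ on $V_{h,0}$ (with respect to the $L^2(\Omega)$ inner product), $\kappa(MA)$ is the ratio of the supremum to the infimum of $(Av,v)_{L^2(\Omega)}/(M^{-1}v,v)_{L^2(\Omega)}$ over $v\in V_{h,0}\setminus\{0\}$ (for $V_{h,0}\neq\{0\}$). *)

theory Defs
  imports "HOL-Analysis.Analysis"
begin

definition open_simplex :: "'a::euclidean_space set \<Rightarrow> bool" where
  "open_simplex \<tau> \<longleftrightarrow> (\<exists>S. int DIM('a) simplex S \<and> \<tau> = interior S)"

definition vertices :: "'a::euclidean_space set \<Rightarrow> 'a set" where
  "vertices \<tau> = {a. a extreme_point_of closure \<tau>}"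

text \<open>Faces are taken closed. Passing to relatively open faces changes neither their
  measure, nor their vertices, nor whether they lie in the boundary of the domain.\<close>

definition facets :: "'a::euclidean_space set \<Rightarrow> 'a set set" where
  "facets \<tau> = {K. K facet_of closure \<tau>}"

definition inradius :: "'a::euclidean_space set \<Rightarrow> real" where
  "inradius \<tau> = Sup {r. r > 0 \<and> (\<exists>x. ball x r \<subseteq> \<tau>)}"

definition polyhedral_convex_domain :: "'a::euclidean_space set \<Rightarrow> bool" where
  "polyhedral_convex_domain \<Omega> \<longleftrightarrow>
     open \<Omega> \<and> \<Omega> \<noteq> {} \<and> bounded \<Omega> \<and> convex \<Omega> \<and> polyhedron (closure \<Omega>)"

text \<open>That the mesh is conforming is expressed by the library notion \<open>triangulation\<close> for the
  closed simplices: any two of them meet in a common, possibly empty, face.\<close>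

definition triangulation_of :: "'a::euclidean_space set \<Rightarrow> 'a set set \<Rightarrow> bool" where
  "triangulation_of \<Omega> \<T> \<longleftrightarrow>
     finite \<T> \<and> (\<forall>\<tau>\<in>\<T>. open_simplex \<tau>) \<and> pairwise disjnt \<T> \<and>
     triangulation (closure ` \<T>) \<and>
     (\<Union>\<tau>\<in>\<T>. closure \<tau>) = closure \<Omega>"

definition mesh_size :: "'a::euclidean_space set set \<Rightarrow> real" where
  "mesh_size \<T> = Max (diameter ` \<T>)"

definition refinement_of :: "'a set set \<Rightarrow> 'a set set \<Rightarrow> bool" where
  "refinement_of \<T>' \<T> \<longleftrightarrow> (\<forall>\<tau>'\<in>\<T>'. \<exists>\<tau>\<in>\<T>. \<tau>' \<subseteq> \<tau>)"

definition mesh_vertices :: "'a::euclidean_space set set \<Rightarrow> 'a set" where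
  "mesh_vertices \<T> = (\<Union>\<tau>\<in>\<T>. vertices \<tau>)"

definition interior_vertices :: "'a::euclidean_space set \<Rightarrow> 'a set set \<Rightarrow> 'a set" where
  "interior_vertices \<Omega> \<T> = mesh_vertices \<T> \<inter> \<Omega>"

definition vertex_patch :: "'a::euclidean_space set set \<Rightarrow> 'a \<Rightarrow> 'a set" where
  "vertex_patch \<T> a = interior (\<Union>\<tau>\<in>{\<tau>\<in>\<T>. a \<in> vertices \<tau>}. closure \<tau>)"

text \<open>The Lebesgue measure of a set in its affine hull, computed in Cartesian coordinates with
  respect to an origin \<open>p\<close> and an orthonormal basis \<open>E\<close> of the direction space; the result does
  not depend on these choices. For a single point, \<open>E\<close> is empty and the measure is 1.\<close>

definition affine_measure :: "'a::euclidean_space set \<Rightarrow> real" where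
  "affine_measure K =
     (let p = (SOME p. p \<in> K);
          E = (SOME E. pairwise orthogonal E \<and> (\<forall>e\<in>E. norm e = 1) \<and>
                       span E = span {x - y | x y. x \<in> K \<and> y \<in> K});
          M = (\<Pi>\<^sub>M e\<in>E. lborel)
      in measure M {c \<in> space M. p + (\<Sum>e\<in>E. c e *\<^sub>R e) \<in> K})"

definition boundary_facets :: "'a::euclidean_space set \<Rightarrow> 'a set set \<Rightarrow> 'a \<Rightarrow> 'a set set" where
  "boundary_facets \<Omega> \<T> a =
     {K. (\<exists>\<tau>\<in>\<T>. K \<in> facets \<tau>) \<and> K \<subseteq> frontier \<Omega> \<and> a extreme_point_of K}"

definition facet_weight :: "'a::euclidean_space set \<Rightarrow> 'a set set \<Rightarrow> 'a \<Rightarrow> 'a set \<Rightarrow> real" where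
  "facet_weight \<Omega> \<T> a K =
     (let \<tau>\<^sub>K = (THE \<tau>. \<tau> \<in> \<T> \<and> K \<in> facets \<tau>)
      in affine_measure K / real (card (boundary_facets \<Omega> \<T> a \<inter> facets \<tau>\<^sub>K)))"

definition condition_T ::
    "'a::euclidean_space set \<Rightarrow> 'a set set \<Rightarrow> real \<Rightarrow> real \<Rightarrow> real \<Rightarrow> bool" where
  "condition_T \<Omega> \<T> \<rho> \<sigma> C0 \<longleftrightarrow>
     (\<forall>\<tau>\<in>\<T>. diameter \<tau> \<le> \<rho> * inradius \<tau> \<and>
            \<sigma> * mesh_size \<T> \<le> diameter \<tau> \<and> diameter \<tau> \<le> mesh_size \<T>) \<and>
     (\<forall>a\<in>mesh_vertices \<T>. convex (vertex_patch \<T> a)) \<and>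
     (\<forall>a\<in>mesh_vertices \<T> \<inter> frontier \<Omega>.
        measure lebesgue (vertex_patch \<T> a)
          \<le> C0 * mesh_size \<T> * (\<Sum>K\<in>boundary_facets \<Omega> \<T> a. facet_weight \<Omega> \<T> a K))"

text \<open>Elements of function spaces are represented by functions on the whole space, of which only
  the values almost everywhere in \<open>\<Omega>\<close> matter. The Sobolev and finite element spaces are closed under changing
  a function on a null set.\<close>

definition eq_ae :: "'a::euclidean_space set \<Rightarrow> ('a \<Rightarrow> real) \<Rightarrow> ('a \<Rightarrow> real) \<Rightarrow> bool" where
  "eq_ae \<Omega> u v \<longleftrightarrow> (AE x in lebesgue_on \<Omega>. u x = v x)"

definition square_integrable ::
    "'a::euclidean_space set \<Rightarrow> ('a \<Rightarrow> 'b::euclidean_space) \<Rightarrow> bool" where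
  "square_integrable \<Omega> f \<longleftrightarrow>
     f \<in> borel_measurable (lebesgue_on \<Omega>) \<and> integrable (lebesgue_on \<Omega>) (\<lambda>x. (norm (f x))\<^sup>2)"

definition L2_inner ::
    "'a::euclidean_space set \<Rightarrow> ('a \<Rightarrow> 'b::euclidean_space) \<Rightarrow> ('a \<Rightarrow> 'b) \<Rightarrow> real" where
  "L2_inner \<Omega> u v = (LINT x|lebesgue_on \<Omega>. u x \<bullet> v x)"

primrec C_diff :: "nat \<Rightarrow> ('a::euclidean_space \<Rightarrow> real) \<Rightarrow> bool" where
  "C_diff 0 f \<longleftrightarrow> continuous_on UNIV f"
| "C_diff (Suc k) f \<longleftrightarrow>
     (\<forall>x. f differentiable (at x)) \<and>
     (\<forall>b\<in>Basis. C_diff k (\<lambda>x. frechet_derivative f (at x) b))"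

definition test_functions :: "'a::euclidean_space set \<Rightarrow> ('a \<Rightarrow> real) set" where
  "test_functions \<Omega> =
     {\<psi>. (\<forall>k. C_diff k \<psi>) \<and> compact (closure {x. \<psi> x \<noteq> 0}) \<and> closure {x. \<psi> x \<noteq> 0} \<subseteq> \<Omega>}"

definition has_L2_gradient ::
    "'a::euclidean_space set \<Rightarrow> ('a \<Rightarrow> real) \<Rightarrow> ('a \<Rightarrow> 'a) \<Rightarrow> bool" where
  "has_L2_gradient \<Omega> v g \<longleftrightarrow>
     square_integrable \<Omega> g \<and>
     (\<forall>\<psi>\<in>test_functions \<Omega>. \<forall>b\<in>Basis.
        (LINT x|lebesgue_on \<Omega>. v x * frechet_derivative \<psi> (at x) b)
          = - (LINT x|lebesgue_on \<Omega>. (g x \<bullet> b) * \<psi> x))"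

definition weak_grad :: "'a::euclidean_space set \<Rightarrow> ('a \<Rightarrow> real) \<Rightarrow> 'a \<Rightarrow> 'a" where
  "weak_grad \<Omega> v = (SOME g. has_L2_gradient \<Omega> v g)"

definition H1 :: "'a::euclidean_space set \<Rightarrow> ('a \<Rightarrow> real) set" where
  "H1 \<Omega> = {v. square_integrable \<Omega> v \<and> (\<exists>g. has_L2_gradient \<Omega> v g)}"

definition H1_norm :: "'a::euclidean_space set \<Rightarrow> ('a \<Rightarrow> real) \<Rightarrow> real" where
  "H1_norm \<Omega> v = sqrt (L2_inner \<Omega> v v + L2_inner \<Omega> (weak_grad \<Omega> v) (weak_grad \<Omega> v))"

definition H1_0 :: "'a::euclidean_space set \<Rightarrow> ('a \<Rightarrow> real) set" where
  "H1_0 \<Omega> = {v \<in> H1 \<Omega>. \<forall>\<epsilon>>0. \<exists>\<psi>\<in>test_functions \<Omega>. H1_norm \<Omega> (\<lambda>x. v x - \<psi> x) < \<epsilon>}"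

definition fe_space :: "'a::euclidean_space set \<Rightarrow> 'a set set \<Rightarrow> ('a \<Rightarrow> real) set" where
  "fe_space \<Omega> \<T> =
     {v \<in> H1_0 \<Omega>. \<forall>\<tau>\<in>\<T>. \<exists>g c. eq_ae \<tau> v (\<lambda>x. g \<bullet> x + c)}"

text \<open>Nodal values are those of the continuous representative, which is unique on the closure
  of \<open>\<Omega>\<close>; the values outside it are irrelevant.\<close>

definition nodal_basis_fun :: "'a::euclidean_space set \<Rightarrow> 'a set set \<Rightarrow> 'a \<Rightarrow> 'a \<Rightarrow> real" where
  "nodal_basis_fun \<Omega> \<T> a =
     (SOME \<phi>. \<phi> \<in> fe_space \<Omega> \<T> \<and> continuous_on (closure \<Omega>) \<phi> \<and>
              \<phi> a = 1 \<and> (\<forall>b\<in>mesh_vertices \<T> - {a}. \<phi> b = 0))"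

definition L2_proj ::
    "'a::euclidean_space set \<Rightarrow> ('a \<Rightarrow> real) set \<Rightarrow> ('a \<Rightarrow> real) \<Rightarrow> 'a \<Rightarrow> real" where
  "L2_proj \<Omega> S v = (SOME u. u \<in> S \<and> (\<forall>w\<in>S. L2_inner \<Omega> (\<lambda>x. v x - u x) w = 0))"

definition nodal_proj ::
    "'a::euclidean_space set \<Rightarrow> 'a set set \<Rightarrow> 'a \<Rightarrow> ('a \<Rightarrow> real) \<Rightarrow> 'a \<Rightarrow> real" where
  "nodal_proj \<Omega> \<T> a = L2_proj \<Omega> (range (\<lambda>c x. c * nodal_basis_fun \<Omega> \<T> a x))"

definition B_op ::
    "'a::euclidean_space set \<Rightarrow> (nat \<Rightarrow> 'a set set) \<Rightarrow> nat \<Rightarrow> ('a \<Rightarrow> real) \<Rightarrow> 'a \<Rightarrow> real" where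
  "B_op \<Omega> \<T> J v =
     (\<lambda>x. \<Sum>l=1..J. (mesh_size (\<T> l))\<^sup>2 * L2_proj \<Omega> (fe_space \<Omega> (\<T> l)) v x)"

definition B_Jac ::
    "'a::euclidean_space set \<Rightarrow> (nat \<Rightarrow> 'a set set) \<Rightarrow> nat \<Rightarrow> ('a \<Rightarrow> real) \<Rightarrow> 'a \<Rightarrow> real" where
  "B_Jac \<Omega> \<T> J v =
     (\<lambda>x. \<Sum>l=1..J. (mesh_size (\<T> l))\<^sup>2 *
        (\<Sum>a\<in>interior_vertices \<Omega> (\<T> l). nodal_proj \<Omega> (\<T> l) a v x))"

definition B_Ric ::
    "'a::euclidean_space set \<Rightarrow> (nat \<Rightarrow> 'a set set) \<Rightarrow> nat \<Rightarrow> ('a \<Rightarrow> real) \<Rightarrow> 'a \<Rightarrow> real" where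
  "B_Ric \<Omega> \<T> J v =
     (\<lambda>x. \<Sum>l=1..J. mesh_size (\<T> l) powi (2 - int DIM('a)) *
        (\<Sum>a\<in>interior_vertices \<Omega> (\<T> l).
           L2_inner \<Omega> v (nodal_basis_fun \<Omega> (\<T> l) a) * nodal_basis_fun \<Omega> (\<T> l) a x))"

definition eta :: "'a::euclidean_space set set \<Rightarrow> 'a \<Rightarrow> real" where
  "eta \<T> a = 2 * measure lebesgue (vertex_patch \<T> a) /
     ((real DIM('a) + 1) * (real DIM('a) + 2) * mesh_size \<T> ^ DIM('a))"

definition eta_values ::
    "'a::euclidean_space set \<Rightarrow> (nat \<Rightarrow> 'a set set) \<Rightarrow> nat \<Rightarrow> real set" where
  "eta_values \<Omega> \<T> J = {eta (\<T> l) a | l a. l \<in> {1..J} \<and> a \<in> interior_vertices \<Omega> (\<T> l)}"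

text \<open>The stiffness operator and the inverse of an operator, both on a subspace \<open>V\<close> of
  \<open>L\<^sup>2(\<Omega>)\<close>; their values are determined up to equality almost everywhere.\<close>

definition stiffness_op ::
    "'a::euclidean_space set \<Rightarrow> ('a \<Rightarrow> real) set \<Rightarrow> ('a \<Rightarrow> real) \<Rightarrow> 'a \<Rightarrow> real" where
  "stiffness_op \<Omega> V v =
     (SOME u. u \<in> V \<and> (\<forall>w\<in>V. L2_inner \<Omega> u w = L2_inner \<Omega> (weak_grad \<Omega> v) (weak_grad \<Omega> w)))"

definition inverse_op ::
    "'a::euclidean_space set \<Rightarrow> ('a \<Rightarrow> real) set \<Rightarrow> (('a \<Rightarrow> real) \<Rightarrow> 'a \<Rightarrow> real) \<Rightarrow>
     ('a \<Rightarrow> real) \<Rightarrow> 'a \<Rightarrow> real" where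
  "inverse_op \<Omega> V M v = (SOME u. u \<in> V \<and> eq_ae \<Omega> (M u) v)"

definition nonzero_elements ::
    "'a::euclidean_space set \<Rightarrow> ('a \<Rightarrow> real) set \<Rightarrow> ('a \<Rightarrow> real) set" where
  "nonzero_elements \<Omega> V = {v \<in> V. \<not> eq_ae \<Omega> v (\<lambda>x. 0)}"

text \<open>\<open>cond_number \<Omega> V A M\<close> is \<open>\<kappa>(MA)\<close>, the ratio of the extreme values of \<open>(Av,v)/(M\<^sup>-\<^sup>1v,v)\<close>;
  it is meaningful for \<open>M\<close> symmetric positive definite on \<open>V\<close>.\<close>

definition cond_number ::
    "'a::euclidean_space set \<Rightarrow> ('a \<Rightarrow> real) set \<Rightarrow> (('a \<Rightarrow> real) \<Rightarrow> 'a \<Rightarrow> real) \<Rightarrow>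
     (('a \<Rightarrow> real) \<Rightarrow> 'a \<Rightarrow> real) \<Rightarrow> real" where
  "cond_number \<Omega> V A M =
     (SUP v\<in>nonzero_elements \<Omega> V. L2_inner \<Omega> (A v) v / L2_inner \<Omega> (inverse_op \<Omega> V M v) v) /
     (INF v\<in>nonzero_elements \<Omega> V. L2_inner \<Omega> (A v) v / L2_inner \<Omega> (inverse_op \<Omega> V M v) v)"

end

theory Submission
  imports Defs
begin

text \<open>A function in a finite element space agrees almost everywhere with a continuous piecewise affine
  function vanishing outside the domain. One direction is the observation that a piecewise affine
  function with zero boundary values in the Sobolev sense has a bounded weak gradient after extension
  by zero, hence is Lipschitz; for the converse, a piecewise affine function is approximated by
  dilating it about an interior point of the convex domain and mollifying. So the hat functions span
  the space. The products of barycentric coordinates have integral \<open>|\<tau>|/((d+1)(d+2))\<close>, doubled for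
  squares, which gives both \<open>\<parallel>\<phi>\<^sub>a\<parallel>\<^sup>2 = \<eta>\<^sub>a h\<^sup>d\<close>, that is, the comparison of the two preconditioners,
  and the spectral bounds \<open>1/2\<close> and \<open>(d+2)/2\<close> of the mass matrix relative to its diagonal. By duality
  the latter compare the additive Jacobi smoother on each level with the \<open>L\<^sup>2\<close> projection, and the
  ratio of the bounds is the factor \<open>d+2\<close> in the estimate of the condition numbers.\<close>

subsection \<open>Smooth functions\<close>

text \<open>Once the hat functions are known to be a basis, the conclusion is finite-dimensional
  linear algebra; the difficulty lies before that. \<open>fe_space\<close> is defined through
  \<open>H1_0\<close>, a closure of test functions in a norm built on weak gradients, while
  \<open>nodal_basis_fun\<close>, \<open>L2_proj\<close> and \<open>inverse_op\<close> are choices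
  whose existence, and uniqueness as far as it holds, must be shown. Zero boundary values are never
  expressed by a trace: they are used as integration by parts without boundary term against test
  functions that need not vanish on the boundary. Conformity enters through common faces, and
  convexity of the domain through the dilation and through segments that start at an interior
  vertex. In the mass matrix bounds, \<open>1/2\<close> arises by dropping the square of a sum of
  nodal values, and \<open>(d + 2)/2\<close> from the Cauchy-Schwarz inequality over the
  \<open>d + 1\<close> vertices of a simplex. Since \<open>cond_number\<close> involves inverses, an
  ordering of two preconditioners as quadratic forms must first be reversed for their inverses; only
  then are suprema and infima compared.\<close>

lemma C_diff_SucI:
  assumes "\<And>x. (f has_derivative f' x) (at x)"
    and "\<And>b. b \<in> Basis \<Longrightarrow> C_diff k (\<lambda>x. f' x b)"
  shows "C_diff (Suc k) f"
proof -
  have "frechet_derivative f (at x) = f' x" for x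
    using frechet_derivative_at[OF assms(1)] by simp
  then show ?thesis
    using assms by (auto simp: differentiable_def)
qed

lemma C_diff_Suc_has_derivative:
  assumes "C_diff (Suc k) f"
  shows "(f has_derivative frechet_derivative f (at x)) (at x)"
  using assms frechet_derivative_works by auto

lemma C_diff_partial:
  "C_diff (Suc k) f \<Longrightarrow> b \<in> Basis \<Longrightarrow> C_diff k (\<lambda>x. frechet_derivative f (at x) b)"
  by simp

lemma C_diff_continuous: "C_diff k f \<Longrightarrow> continuous_on UNIV f"
  by (cases k) (auto intro!: differentiable_imp_continuous_on simp: differentiable_on_def)

lemma C_diff_SucD: "C_diff (Suc k) f \<Longrightarrow> C_diff k f"
proof (induction k arbitrary: f)
  case 0
  then show ?case using C_diff_continuous[OF 0] by (simp del: C_diff.simps(2))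
next
  case (Suc k)
  then show ?case by simp
qed

declare C_diff.simps(2) [simp del]

lemma C_diff_const: "C_diff k (\<lambda>x. c)"
proof (induction k arbitrary: c)
  case (Suc k)
  show ?case by (rule C_diff_SucI[where f' = "\<lambda>x h. 0"]) (auto intro: Suc)
qed auto

lemma C_diff_add: "C_diff k f \<Longrightarrow> C_diff k g \<Longrightarrow> C_diff k (\<lambda>x. f x + g x)"
proof (induction k arbitrary: f g)
  case (Suc k)
  show ?case
    by (rule C_diff_SucI, rule has_derivative_add[OF C_diff_Suc_has_derivative[OF Suc.prems(1)]
          C_diff_Suc_has_derivative[OF Suc.prems(2)]])
       (intro Suc.IH C_diff_partial Suc.prems)
qed (auto intro: continuous_intros)

text \<open>The product rule leaves one factor undifferentiated, for which the induction hypothesis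
  asks only \<open>k\<close> derivatives; \<open>C_diff_SucD\<close> provides them.\<close>

lemma C_diff_mult: "C_diff k f \<Longrightarrow> C_diff k g \<Longrightarrow> C_diff k (\<lambda>x. f x * g x)"
proof (induction k arbitrary: f g)
  case (Suc k)
  show ?case
    by (rule C_diff_SucI, rule has_derivative_mult[OF C_diff_Suc_has_derivative[OF Suc.prems(1)]
          C_diff_Suc_has_derivative[OF Suc.prems(2)]])
       (intro C_diff_add Suc.IH C_diff_partial Suc.prems C_diff_SucD[OF Suc.prems(1)]
          C_diff_SucD[OF Suc.prems(2)])
qed (auto intro: continuous_intros)

lemma C_diff_inner: "C_diff k (\<lambda>x. x \<bullet> b)"
  by (cases k) (auto intro!: C_diff_SucI has_derivative_inner_left has_derivative_ident
      C_diff_const continuous_intros)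

lemma C_diff_translate: "C_diff k f \<Longrightarrow> C_diff k (\<lambda>x. f (x - a))"
proof (induction k arbitrary: f)
  case 0
  then show ?case by (auto intro!: continuous_on_compose2[of UNIV f] continuous_intros)
next
  case (Suc k)
  have "((\<lambda>x. f (x - a)) has_derivative frechet_derivative f (at (x - a))) (at x)" for x
    by (rule has_derivative_compose[OF _ C_diff_Suc_has_derivative[OF Suc.prems],
        of "\<lambda>x. x - a" "\<lambda>h. h"]) (auto intro!: derivative_eq_intros)
  then show ?case
  proof (rule C_diff_SucI)
    fix b :: 'a
    assume "b \<in> Basis"
    then show "C_diff k (\<lambda>x. frechet_derivative f (at (x - a)) b)"
      using Suc.IH[OF C_diff_partial[OF Suc.prems]] by blast
  qed
qed

text \<open>The classical flat function \<open>exp (- 1 / t)\<close>, with powers of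
  \<open>1 / t\<close> in front so that the family is closed under differentiation. One induction
  then gives smoothness for all \<open>k\<close> at once.\<close>

definition exp_flat :: "nat \<Rightarrow> real \<Rightarrow> real" where
  "exp_flat k t = (if t > 0 then (1 / t) ^ k * exp (- (1 / t)) else 0)"

lemma exp_flat_tendsto_0: "(exp_flat k \<longlongrightarrow> 0) (at 0)"
proof -
  have "((\<lambda>t. inverse t ^ k / exp (inverse t)) \<longlongrightarrow> 0) (at_right (0::real))"
    using filterlim_compose[OF tendsto_power_div_exp_0 filterlim_inverse_at_top_right] .
  then have "(exp_flat k \<longlongrightarrow> 0) (at_right 0)"
    by (rule Lim_transform_eventually)
       (auto simp: eventually_at_right_less exp_flat_def exp_minus field_simps
         intro!: eventually_at_rightI[of 0 1])
  moreover have "(exp_flat k \<longlongrightarrow> 0) (at_left 0)"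
    by (rule Lim_transform_eventually[OF tendsto_const])
       (auto simp: exp_flat_def intro!: eventually_at_leftI[of "-1" 0])
  ultimately show ?thesis
    by (simp add: filterlim_split_at)
qed

text \<open>At zero the difference quotient of \<open>exp_flat k\<close> is
  \<open>exp_flat (Suc k)\<close>, so the derivative there is the limit already computed. Elsewhere
  the formula is the product rule.\<close>

lemma exp_flat_deriv:
  "(exp_flat k has_field_derivative exp_flat (k + 2) t - k * exp_flat (k + 1) t) (at t)"
proof (cases t "0 :: real" rule: linorder_cases)
  case less
  have "((\<lambda>t. 0) has_field_derivative exp_flat (k + 2) t - k * exp_flat (k + 1) t) (at t)"
    using less by (auto simp: exp_flat_def)
  then show ?thesis
    by (rule has_field_derivative_transform_within_open[where S="{..<0}"])
       (use less in \<open>auto simp: exp_flat_def\<close>)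
next
  case equal
  have "((\<lambda>h. (exp_flat k (0 + h) - exp_flat k 0) / h) \<longlongrightarrow> 0) (at 0)"
    by (rule Lim_transform_eventually[OF exp_flat_tendsto_0[of "Suc k"]])
       (auto simp: exp_flat_def eventually_at field_simps intro!: exI[of _ 1])
  then show ?thesis
    using equal by (simp add: DERIV_def exp_flat_def)
next
  case greater
  have "((\<lambda>t. (1 / t) ^ k * exp (- (1 / t))) has_field_derivative
      (real k * (1 / t) ^ (k - 1) * (- 1 / (t * t))) * exp (- (1 / t))
        + exp (- (1 / t)) * (1 / (t * t)) * (1 / t) ^ k) (at t)"
    using greater by (auto intro!: derivative_eq_intros)
  \<comment> \<open>For \<open>k = 0\<close> the truncated exponent \<open>k - 1\<close> is
    harmless, since its term carries the factor \<open>k\<close>.\<close>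
  moreover have "(real k * (1 / t) ^ (k - 1) * (- 1 / (t * t))) * exp (- (1 / t))
        + exp (- (1 / t)) * (1 / (t * t)) * (1 / t) ^ k = exp_flat (k + 2) t - k * exp_flat (k + 1) t"
    using greater by (cases k) (simp_all add: exp_flat_def mult_ac)
  ultimately have "((\<lambda>t. (1 / t) ^ k * exp (- (1 / t))) has_field_derivative
      exp_flat (k + 2) t - k * exp_flat (k + 1) t) (at t)"
    by simp
  then show ?thesis
    by (rule has_field_derivative_transform_within_open[where S="{0<..}"])
       (use greater in \<open>auto simp: exp_flat_def\<close>)
qed

text \<open>The difference from \<open>exp_flat_deriv\<close> is written as a sum with
  \<open>- real m\<close>, the form to which \<open>C_diff_add\<close> and
  \<open>C_diff_mult\<close> apply.\<close>

lemma exp_flat_has_derivative: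
  "((\<lambda>x. exp_flat m (r - x \<bullet> x)) has_derivative
     (\<lambda>h. (exp_flat (m + 2) (r - x \<bullet> x) + - real m * exp_flat (m + 1) (r - x \<bullet> x)) * (- 2 * (x \<bullet> h)))) (at x)"
proof -
  have "((\<lambda>x. r - x \<bullet> x) has_derivative (\<lambda>h. - 2 * (x \<bullet> h))) (at x)"
    by (auto intro!: derivative_eq_intros simp: inner_commute)
  from has_derivative_compose[OF this exp_flat_deriv[unfolded has_field_derivative_def]]
  show ?thesis by (simp add: algebra_simps)
qed

lemma C_diff_exp_flat: "C_diff k (\<lambda>x. exp_flat m (r - x \<bullet> x))"
proof (induction k arbitrary: m)
  case 0
  show ?case
    by (simp add: continuous_at_imp_continuous_on has_derivative_continuous[OF exp_flat_has_derivative])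
next
  case (Suc k)
  show ?case
  proof (rule C_diff_SucI[OF exp_flat_has_derivative])
    fix b :: 'a
    show "C_diff k (\<lambda>x. (exp_flat (m + 2) (r - x \<bullet> x) + - real m * exp_flat (m + 1) (r - x \<bullet> x)) * (- 2 * (x \<bullet> b)))"
      by (intro C_diff_mult C_diff_add Suc C_diff_const C_diff_inner)
  qed
qed

section \<open>Test functions and their uniform bounds\<close>

lemma test_functions_UNIV_iff:
  "\<psi> \<in> test_functions UNIV \<longleftrightarrow> (\<forall>k. C_diff k \<psi>) \<and> bounded {x. \<psi> x \<noteq> 0}"
  by (auto simp: test_functions_def compact_closure)

lemma test_functions_UNIV: "\<psi> \<in> test_functions \<Omega> \<Longrightarrow> \<psi> \<in> test_functions UNIV"
  by (auto simp: test_functions_def)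

lemma test_function_has_derivative:
  "\<psi> \<in> test_functions \<Omega> \<Longrightarrow> (\<psi> has_derivative frechet_derivative \<psi> (at x)) (at x)"
  unfolding test_functions_def using C_diff_Suc_has_derivative by blast

lemma test_function_continuous: "\<psi> \<in> test_functions \<Omega> \<Longrightarrow> continuous_on UNIV \<psi>"
  using C_diff_continuous by (auto simp: test_functions_def)

text \<open>The complement of the closed support is open and the function is zero there, hence so is
  its derivative.\<close>

lemma test_function_support_partial:
  assumes "\<psi> \<in> test_functions \<Omega>"
  shows "{x. frechet_derivative \<psi> (at x) b \<noteq> 0} \<subseteq> closure {x. \<psi> x \<noteq> 0}"
proof
  fix x assume x: "x \<in> {x. frechet_derivative \<psi> (at x) b \<noteq> 0}"
  show "x \<in> closure {x. \<psi> x \<noteq> 0}"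
  proof (rule ccontr)
    assume n: "x \<notin> closure {x. \<psi> x \<noteq> 0}"
    have "(\<psi> has_derivative (\<lambda>h. 0)) (at x)"
      by (rule has_derivative_transform_within_open[where f = "\<lambda>x. 0" and s = "- closure {x. \<psi> x \<noteq> 0}"])
         (use n closure_subset[of "{x. \<psi> x \<noteq> 0}"] in \<open>auto simp: subset_iff\<close>)
    then show False
      using frechet_derivative_at[of \<psi> "\<lambda>h. 0" x] x by (auto dest: fun_cong[where x = b])
  qed
qed

lemma test_function_partial:
  assumes "\<psi> \<in> test_functions \<Omega>" "b \<in> Basis"
  shows "(\<lambda>x. frechet_derivative \<psi> (at x) b) \<in> test_functions \<Omega>"
proof -
  have sub: "closure {x. frechet_derivative \<psi> (at x) b \<noteq> 0} \<subseteq> closure {x. \<psi> x \<noteq> 0}"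
    using test_function_support_partial[OF assms(1)] by (simp add: closure_minimal)
  have "compact (closure {x. frechet_derivative \<psi> (at x) b \<noteq> 0})"
    using sub assms(1) by (auto simp: test_functions_def compact_eq_bounded_closed intro: bounded_subset)
  then show ?thesis
    using assms sub C_diff_partial unfolding test_functions_def by blast
qed

lemma test_function_bounded:
  assumes "\<psi> \<in> test_functions \<Omega>"
  obtains B where "B > 0" "\<And>x. \<bar>\<psi> x\<bar> \<le> B"
proof -
  have "compact (\<psi> ` closure {x. \<psi> x \<noteq> 0})"
    using assms test_function_continuous[OF assms]
    by (auto simp: test_functions_def intro!: compact_continuous_image intro: continuous_on_subset)
  then obtain B where B: "B > 0" "\<And>x. x \<in> closure {x. \<psi> x \<noteq> 0} \<Longrightarrow> norm (\<psi> x) \<le> B"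
    by (metis bounded_pos compact_imp_bounded imageI)
  have "\<bar>\<psi> x\<bar> \<le> B" for x
    using B closure_subset[of "{x. \<psi> x \<noteq> 0}"] by (cases "\<psi> x = 0") (auto simp: subset_iff)
  then show ?thesis using B that by blast
qed

text \<open>The partial derivatives are test functions, hence bounded. Their bounds add up to
  \<open>L\<close>, and the mean value inequality on the convex set \<open>UNIV\<close> makes this a
  global Lipschitz constant.\<close>

lemma test_function_derivative_bounded:
  assumes "\<psi> \<in> test_functions \<Omega>"
  obtains L where "L > 0" "\<And>x h. \<bar>frechet_derivative \<psi> (at x) h\<bar> \<le> L * norm h"
    "\<And>x y. \<bar>\<psi> x - \<psi> y\<bar> \<le> L * norm (x - y)"
proof -
  have "\<forall>b\<in>Basis. \<exists>B>0. \<forall>x. \<bar>frechet_derivative \<psi> (at x) b\<bar> \<le> B"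
    using test_function_bounded[OF test_function_partial[OF assms]] by metis
  then obtain B where B: "\<And>b. b \<in> Basis \<Longrightarrow> B b > 0"
    "\<And>b x. b \<in> Basis \<Longrightarrow> \<bar>frechet_derivative \<psi> (at x) b\<bar> \<le> B b"
    by metis
  define L where "L = sum B Basis"
  have L: "L > 0" unfolding L_def using B by (intro sum_pos) auto
  have D: "\<bar>frechet_derivative \<psi> (at x) h\<bar> \<le> L * norm h" for x h
  proof -
    have lin: "linear (frechet_derivative \<psi> (at x))"
      using test_function_has_derivative[OF assms] has_derivative_linear by blast
    have "frechet_derivative \<psi> (at x) h = frechet_derivative \<psi> (at x) (\<Sum>b\<in>Basis. (h \<bullet> b) *\<^sub>R b)"
      by (simp add: euclidean_representation)
    also have "\<dots> = (\<Sum>b\<in>Basis. (h \<bullet> b) * frechet_derivative \<psi> (at x) b)"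
      by (simp add: linear_sum[OF lin] linear_cmul[OF lin])
    also have "\<bar>\<dots>\<bar> \<le> (\<Sum>b\<in>Basis. norm h * B b)"
      by (intro order_trans[OF sum_abs] sum_mono)
         (auto simp: abs_mult Basis_le_norm intro!: mult_mono B)
    finally show ?thesis by (simp add: L_def sum_distrib_left mult.commute)
  qed
  have "norm (\<psi> x - \<psi> y) \<le> L * norm (x - y)" for x y
    by (rule differentiable_bound[of UNIV \<psi> "\<lambda>x. frechet_derivative \<psi> (at x)"])
       (auto intro!: test_function_has_derivative[OF assms] onorm_bound simp: D L less_imp_le)
  with L D that show ?thesis by auto
qed

lemma continuous_imp_measurable_lebesgue:
  fixes f :: "'a::euclidean_space \<Rightarrow> 'b::euclidean_space"
  assumes "continuous_on UNIV f"
  shows "f \<in> borel_measurable lebesgue"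
  using borel_measurable_continuous_onI[OF assms] by (simp add: measurable_completion)

lemma continuous_compact_support_integrable:
  fixes f :: "'a::euclidean_space \<Rightarrow> real"
  assumes "continuous_on UNIV f" "bounded {x. f x \<noteq> 0}"
  shows "integrable lebesgue f"
proof -
  have "integrable lborel (\<lambda>x. indicator (closure {x. f x \<noteq> 0}) x *\<^sub>R f x)"
    using assms by (intro borel_integrable_compact) (auto simp: compact_closure intro: continuous_on_subset)
  moreover have "(\<lambda>x. indicator (closure {x. f x \<noteq> 0}) x *\<^sub>R f x) = f"
    using closure_subset[of "{x. f x \<noteq> 0}"] by (auto simp: indicator_def fun_eq_iff)
  ultimately have "integrable lborel f" by simp
  then show ?thesis
    using assms by (simp add: integrable_completion borel_measurable_continuous_onI)
qed

lemma test_function_integrable: "\<psi> \<in> test_functions \<Omega> \<Longrightarrow> integrable lebesgue \<psi>"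
  by (rule continuous_compact_support_integrable)
     (auto simp: test_function_continuous dest: test_functions_UNIV simp: test_functions_UNIV_iff)

text \<open>Continuity gives Borel measurability, so the invariance of \<open>lborel\<close>
  applies; \<open>integral_completion\<close> passes to \<open>lebesgue\<close>.\<close>

lemma integral_translate:
  fixes f :: "'a::euclidean_space \<Rightarrow> real"
  assumes "continuous_on UNIV f"
  shows "(LINT x|lebesgue. f (x + a)) = (LINT x|lebesgue. f x)"
proof -
  have f [measurable]: "f \<in> borel_measurable borel" using assms by (rule borel_measurable_continuous_onI)
  have "(LINT x|lborel. f (x + a)) = (LINT x|distr lborel borel ((+) a). f x)"
    by (subst integral_distr) (auto simp: add.commute)
  then show ?thesis
    by (simp add: lborel_distr_plus integral_completion)
qed

lemma integral_reflect:
  fixes f :: "'a::euclidean_space \<Rightarrow> real"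
  assumes "continuous_on UNIV f"
  shows "(LINT x|lebesgue. f (- x)) = (LINT x|lebesgue. f x)"
proof -
  have f [measurable]: "f \<in> borel_measurable borel" using assms by (rule borel_measurable_continuous_onI)
  have "distr lborel borel (\<lambda>x::'a. - x) = lborel"
    using lborel_affine[of "-1" "0::'a"] by (simp add: density_1)
  then have "(LINT x|lborel. f x) = (LINT x|distr lborel borel (\<lambda>x. - x). f x)"
    by simp
  also have "\<dots> = (LINT x|lborel. f (- x))"
    by (subst integral_distr) auto
  finally show ?thesis
    by (simp add: integral_completion)
qed

lemma integrable_mult_bounded:
  fixes f g :: "'a \<Rightarrow> real"
  assumes "integrable M f" "g \<in> borel_measurable M" "\<And>x. \<bar>g x\<bar> \<le> B"
  shows "integrable M (\<lambda>x. f x * g x)"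
proof (rule Bochner_Integration.integrable_bound[of M "\<lambda>x. B * f x"])
  show "AE x in M. norm (f x * g x) \<le> norm (B * f x)"
  proof (rule AE_I2)
    fix x
    have "\<bar>g x\<bar> \<le> \<bar>B\<bar>" using assms(3)[of x] by linarith
    then show "norm (f x * g x) \<le> norm (B * f x)"
      using mult_left_mono[of "\<bar>g x\<bar>" "\<bar>B\<bar>" "\<bar>f x\<bar>"] by (simp add: abs_mult mult.commute)
  qed
qed (use assms in auto)

subsection \<open>Mollification\<close>

lemma convolution_integrable:
  assumes "integrable lebesgue f" "\<psi> \<in> test_functions \<Omega>"
  shows "integrable lebesgue (\<lambda>y. f y * \<psi> (x - y))"
proof -
  obtain B where "\<And>x. \<bar>\<psi> x\<bar> \<le> B" using test_function_bounded[OF assms(2)] by blast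
  then show ?thesis
    using assms test_function_continuous[OF assms(2)]
    by (intro integrable_mult_bounded[of _ _ _ B] continuous_imp_measurable_lebesgue)
       (auto intro!: continuous_on_compose2[of UNIV \<psi>] continuous_intros)
qed

text \<open>As \<open>f\<close> is merely integrable, every derivative must fall on the kernel.
  Limit and integral are interchanged by dominated convergence with majorant
  \<open>2 * L * \<bar>f y\<bar>\<close>.\<close>

lemma convolution_has_derivative:
  assumes f: "integrable lebesgue f" and \<psi>: "\<psi> \<in> test_functions \<Omega>"
  shows "((\<lambda>x. LINT y|lebesgue. f y * \<psi> (x - y)) has_derivative
    (\<lambda>h. LINT y|lebesgue. f y * frechet_derivative \<psi> (at (x - y)) h)) (at x)"
proof -
  define D where "D = (\<lambda>z. frechet_derivative \<psi> (at z))"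
  obtain L where L: "L > 0" "\<And>z h. \<bar>D z h\<bar> \<le> L * norm h" "\<And>x y. \<bar>\<psi> x - \<psi> y\<bar> \<le> L * norm (x - y)"
    using test_function_derivative_bounded[OF \<psi>] unfolding D_def by blast
  have lin: "linear (D z)" for z
    using test_function_has_derivative[OF \<psi>] has_derivative_linear unfolding D_def by blast
  have Dsum: "D z h = (\<Sum>b\<in>Basis. (h \<bullet> b) * D z b)" for z h
  proof -
    have "D z h = D z (\<Sum>b\<in>Basis. (h \<bullet> b) *\<^sub>R b)" by (simp add: euclidean_representation)
    then show ?thesis by (simp add: linear_sum[OF lin] linear_cmul[OF lin])
  qed
  have contb: "continuous_on UNIV (\<lambda>y. D (x - y) b)" if "b \<in> Basis" for b
  proof (rule continuous_on_compose2[of UNIV "\<lambda>z. D z b"])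
    show "continuous_on UNIV (\<lambda>z. D z b)"
      using test_function_continuous[OF test_function_partial[OF \<psi> that]] by (simp add: D_def)
  qed (auto intro!: continuous_intros)
  have cont: "continuous_on UNIV (\<lambda>y. D (x - y) h)" for h
    by (subst Dsum) (intro continuous_on_sum continuous_on_mult continuous_on_const contb)
  have int: "integrable lebesgue (\<lambda>y. f y * D (x - y) h)" for h
    using L(2) by (intro integrable_mult_bounded[OF f, of _ "L * norm h"] continuous_imp_measurable_lebesgue cont)
  have int0: "integrable lebesgue (\<lambda>y. f y * \<psi> (x - y))" for x
    by (rule convolution_integrable[OF f \<psi>])
  have "bounded_linear (\<lambda>h. LINT y|lebesgue. f y * D (x - y) h)"
    using int by (intro linear_conv_bounded_linear[THEN iffD1] linearI)
      (simp_all add: linear_add[OF lin] linear_cmul[OF lin] distrib_left mult.left_commute)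
  moreover have "((\<lambda>z. ((LINT y|lebesgue. f y * \<psi> (z - y)) - (LINT y|lebesgue. f y * \<psi> (x - y))
      - (LINT y|lebesgue. f y * D (x - y) (z - x))) /\<^sub>R norm (z - x)) \<longlongrightarrow> 0) (at x)"
    unfolding tendsto_at_iff_sequentially
  proof (intro allI impI)
    fix X :: "nat \<Rightarrow> 'a"
    assume X: "\<forall>i. X i \<in> UNIV - {x}" "X \<longlonglongrightarrow> x"
    \<comment> \<open>The Taylor remainder of the kernel divided by the increment. It tends to zero
      for each \<open>y\<close> and is at most \<open>2 * L\<close>: one \<open>L\<close> from the
      Lipschitz bound, one from the derivative.\<close>
    define r where "r = (\<lambda>n y. (\<psi> (X n - y) - \<psi> (x - y) - D (x - y) (X n - x)) / norm (X n - x))"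
    have "(\<lambda>n. LINT y|lebesgue. f y * r n y) \<longlonglongrightarrow> (LINT y|(lebesgue::'a measure). f y * 0)"
    proof (rule integral_dominated_convergence[where w = "\<lambda>y. \<bar>f y\<bar> * (2 * L)"])
      show "AE y in lebesgue. (\<lambda>n. f y * r n y) \<longlonglongrightarrow> f y * 0"
      proof (intro AE_I2 tendsto_intros)
        fix y
        have "((\<lambda>z. \<psi> (z - y)) has_derivative D (x - y)) (at x)"
          unfolding D_def by (rule has_derivative_compose[OF _ test_function_has_derivative[OF \<psi>],
              of "\<lambda>z. z - y" "\<lambda>h. h"]) (auto intro!: derivative_eq_intros)
        then have "((\<lambda>z. (\<psi> (z - y) - \<psi> (x - y) - D (x - y) (z - x)) /\<^sub>R norm (z - x)) \<longlongrightarrow> 0) (at x)"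
          by (simp add: has_derivative_def Lim_ident_at)
        then have "((\<lambda>z. (\<psi> (z - y) - \<psi> (x - y) - D (x - y) (z - x)) /\<^sub>R norm (z - x)) \<circ> X) \<longlonglongrightarrow> 0"
          using X unfolding tendsto_at_iff_sequentially by blast
        then show "(\<lambda>n. r n y) \<longlonglongrightarrow> 0"
          by (simp add: r_def o_def field_simps)
      qed
      show "AE y in lebesgue. norm (f y * r n y) \<le> \<bar>f y\<bar> * (2 * L)" for n
      proof (rule AE_I2)
        fix y
        have "\<bar>\<psi> (X n - y) - \<psi> (x - y) - D (x - y) (X n - x)\<bar> \<le> 2 * L * norm (X n - x)"
          using L(2)[of "x - y" "X n - x"] L(3)[of "X n - y" "x - y"] by simp
        then have "\<bar>r n y\<bar> \<le> 2 * L"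
          using X by (auto simp: r_def divide_le_eq)
        then show "norm (f y * r n y) \<le> \<bar>f y\<bar> * (2 * L)"
          by (simp add: abs_mult mult_left_mono)
      qed
      show "(\<lambda>y. f y * r n y) \<in> borel_measurable lebesgue" for n
        unfolding r_def using X
        by (intro borel_measurable_times borel_measurable_integrable[OF f] continuous_imp_measurable_lebesgue
              continuous_on_divide continuous_on_diff cont continuous_on_const
              continuous_on_compose2[OF test_function_continuous[OF \<psi>]] continuous_on_id) auto
    qed (use f in auto)
    moreover have "(LINT y|lebesgue. f y * r n y) = ((LINT y|lebesgue. f y * \<psi> (X n - y)) - (LINT y|lebesgue. f y * \<psi> (x - y))
      - (LINT y|lebesgue. f y * D (x - y) (X n - x))) / norm (X n - x)" for n
      using int[of "X n - x"] int0 unfolding r_def by (simp add: right_diff_distrib)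
    ultimately show "((\<lambda>z. ((LINT y|lebesgue. f y * \<psi> (z - y)) - (LINT y|lebesgue. f y * \<psi> (x - y))
      - (LINT y|lebesgue. f y * D (x - y) (z - x))) /\<^sub>R norm (z - x)) \<circ> X) \<longlonglongrightarrow> 0"
      by (simp add: o_def field_simps)
  qed
  ultimately show ?thesis
    unfolding D_def has_derivative_def by (simp add: Lim_ident_at)
qed

text \<open>A derivative of the convolution is again a convolution, with a partial derivative of the
  kernel, which is a test function too; hence the induction generalises over
  \<open>\<psi>\<close>.\<close>

lemma convolution_C_diff:
  assumes f: "integrable lebesgue f"
  shows "\<psi> \<in> test_functions \<Omega> \<Longrightarrow> C_diff k (\<lambda>x. LINT y|lebesgue. f y * \<psi> (x - y))"
proof (induction k arbitrary: \<psi>)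
  case 0
  show ?case
    by (simp add: continuous_at_imp_continuous_on has_derivative_continuous[OF convolution_has_derivative[OF f 0]])
next
  case (Suc k)
  show ?case
  proof (rule C_diff_SucI[OF convolution_has_derivative[OF f Suc.prems]])
    fix b :: 'a
    assume "b \<in> Basis"
    then show "C_diff k (\<lambda>x. LINT y|lebesgue. f y * frechet_derivative \<psi> (at (x - y)) b)"
      using Suc.IH[OF test_function_partial[OF Suc.prems]] by blast
  qed
qed

text \<open>The usual bump \<open>exp (- 1 / (\<delta>^2 - |x|^2))\<close> on the ball of radius
  \<open>\<delta>\<close>. The inner product is used since, unlike the norm, it is smooth at the
  origin.\<close>

definition bump :: "real \<Rightarrow> 'a::euclidean_space \<Rightarrow> real" where
  "bump \<delta> x = exp_flat 0 (\<delta>\<^sup>2 - x \<bullet> x)"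

definition mollifier :: "real \<Rightarrow> 'a::euclidean_space \<Rightarrow> real" where
  "mollifier \<delta> x = bump \<delta> x / (LINT y|lebesgue. bump \<delta> (y::'a))"

lemma bump_nonneg: "0 \<le> bump \<delta> x"
  by (simp add: bump_def exp_flat_def)

lemma bump_pos_iff:
  assumes "\<delta> > 0"
  shows "0 < bump \<delta> x \<longleftrightarrow> norm x < \<delta>"
proof -
  have "norm x < \<delta> \<longleftrightarrow> (norm x)\<^sup>2 < \<delta>\<^sup>2"
    using assms by (metis less_imp_le norm_ge_zero power_less_imp_less_base power_strict_mono pos2)
  then show ?thesis
    by (simp add: bump_def exp_flat_def power2_norm_eq_inner)
qed

lemma bump_test_function: "\<delta> > 0 \<Longrightarrow> bump \<delta> \<in> test_functions UNIV"
proof -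
  assume \<delta>: "\<delta> > 0"
  have "C_diff k (bump \<delta>)" for k
    using C_diff_exp_flat[of k 0 "\<delta>\<^sup>2"] by (simp add: bump_def[abs_def])
  moreover have "bounded {x. bump \<delta> x \<noteq> 0}"
    by (rule bounded_subset[of "ball 0 \<delta>"])
       (use bump_pos_iff[OF \<delta>] bump_nonneg[of \<delta>] in \<open>force simp: less_le\<close>)+
  ultimately show ?thesis by (auto simp: test_functions_UNIV_iff)
qed

text \<open>Otherwise the nonnegative bump would vanish almost everywhere, and the open ball on
  which it is positive would be null.\<close>

lemma bump_integral_pos:
  assumes \<delta>: "\<delta> > 0"
  shows "(LINT y|lebesgue. bump \<delta> (y::'a::euclidean_space)) > 0"
proof -
  have "(LINT y|lebesgue. bump \<delta> (y::'a)) \<noteq> 0"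
  proof
    assume "(LINT y|lebesgue. bump \<delta> (y::'a)) = 0"
    then have "AE y in lebesgue. bump \<delta> (y::'a) = 0"
      using test_function_integrable[OF bump_test_function[OF \<delta>]] bump_nonneg
      by (subst (asm) integral_nonneg_eq_0_iff_AE) auto
    then have "AE y in lebesgue. y \<notin> ball (0::'a) \<delta>"
      by eventually_elim (use bump_pos_iff[OF \<delta>] in \<open>force simp: less_le\<close>)
    then have "negligible (ball (0::'a) \<delta>)"
      by (simp add: AE_iff_null_sets negligible_iff_null_sets)
    then show False
      using open_not_negligible[of "ball (0::'a) \<delta>"] \<delta> by auto
  qed
  then show ?thesis
    by (simp add: less_le integral_nonneg_AE bump_nonneg)
qed

lemma mollifier_nonneg: "0 \<le> mollifier \<delta> x"
  by (simp add: mollifier_def bump_nonneg integral_nonneg_AE)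

lemma mollifier_eq_0: "\<delta> > 0 \<Longrightarrow> norm x \<ge> \<delta> \<Longrightarrow> mollifier \<delta> x = 0"
  using bump_pos_iff[of \<delta> x] bump_nonneg[of \<delta> x] by (simp add: mollifier_def)

text \<open>Evenness makes the first moments of the kernel vanish, which is why mollification
  reproduces affine functions in \<open>mollify_affine\<close>.\<close>

lemma mollifier_minus: "mollifier \<delta> (- x) = mollifier \<delta> x"
  by (simp add: mollifier_def bump_def)

lemma mollifier_diff_commute: "mollifier \<delta> (x - y) = mollifier \<delta> (y - x)"
  using mollifier_minus[of \<delta> "x - y"] by simp

lemma mollifier_test_function: "\<delta> > 0 \<Longrightarrow> mollifier \<delta> \<in> test_functions UNIV"
proof -
  assume \<delta>: "\<delta> > 0"
  have "C_diff k (mollifier \<delta>)" for k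
    unfolding mollifier_def[abs_def] divide_inverse using bump_test_function[OF \<delta>]
    by (intro C_diff_mult C_diff_const) (auto simp: test_functions_UNIV_iff)
  moreover have "bounded {x. mollifier \<delta> x \<noteq> 0}"
    by (rule bounded_subset[of "{x. bump \<delta> x \<noteq> 0}"])
       (use bump_test_function[OF \<delta>] in \<open>auto simp: test_functions_UNIV_iff mollifier_def\<close>)
  ultimately show ?thesis by (auto simp: test_functions_UNIV_iff)
qed

lemma mollifier_integral: "\<delta> > 0 \<Longrightarrow> (LINT y|lebesgue. mollifier \<delta> (y::'a::euclidean_space)) = 1"
  using bump_integral_pos[of \<delta>, where 'a='a] by (simp add: mollifier_def)

lemma mollifier_continuous: "\<delta> > 0 \<Longrightarrow> continuous_on UNIV (mollifier \<delta>)"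
  by (rule test_function_continuous[OF mollifier_test_function])

lemma mollifier_integrable: "\<delta> > 0 \<Longrightarrow> integrable lebesgue (mollifier \<delta>)"
  by (rule test_function_integrable[OF mollifier_test_function])

lemma mollifier_translate:
  assumes "\<delta> > 0"
  shows "(LINT y|lebesgue. mollifier \<delta> (x - y)) = 1" "integrable lebesgue (\<lambda>y. mollifier \<delta> (x - y))"
proof -
  show "(LINT y|lebesgue. mollifier \<delta> (x - y)) = 1"
    using integral_translate[OF mollifier_continuous[OF assms], of "- x"] mollifier_integral[OF assms, where 'a='a]
    by (simp add: mollifier_diff_commute[of \<delta> x])
  show "integrable lebesgue (\<lambda>y. mollifier \<delta> (x - y))"
  proof (rule continuous_compact_support_integrable)
    show "continuous_on UNIV (\<lambda>y. mollifier \<delta> (x - y))"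
      by (rule continuous_on_compose2[OF mollifier_continuous[OF assms]]) (auto intro!: continuous_intros)
    show "bounded {y. mollifier \<delta> (x - y) \<noteq> 0}"
      by (rule bounded_subset[of "ball x \<delta>"]) (use mollifier_eq_0[OF assms] not_less in \<open>auto simp: dist_norm, blast\<close>)
  qed
qed

definition mollify :: "real \<Rightarrow> ('a::euclidean_space \<Rightarrow> real) \<Rightarrow> 'a \<Rightarrow> real" where
  "mollify \<delta> f x = (LINT y|lebesgue. f y * mollifier \<delta> (x - y))"

lemma mollify_C_diff: "\<delta> > 0 \<Longrightarrow> integrable lebesgue f \<Longrightarrow> C_diff k (mollify \<delta> f)"
  using convolution_C_diff[OF _ mollifier_test_function] by (simp add: mollify_def[abs_def])

text \<open>The kernel is a probability density on a ball of radius \<open>\<delta>\<close>, so the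
  mollification is an average of nearby values. This one estimate gives the sup bound (with
  \<open>c = 0\<close>), pointwise convergence, and the rate used for dilated functions.\<close>

lemma mollify_near:
  assumes \<delta>: "\<delta> > 0" and f: "integrable lebesgue f"
    and near: "\<And>y. norm (y - x) < \<delta> \<Longrightarrow> \<bar>f y - c\<bar> \<le> e"
  shows "\<bar>mollify \<delta> f x - c\<bar> \<le> e"
proof -
  note i = convolution_integrable[OF f mollifier_test_function[OF \<delta>], of x]
  note k = mollifier_translate[OF \<delta>, of x]
  have "\<bar>mollify \<delta> f x - c\<bar> = \<bar>LINT y|lebesgue. (f y - c) * mollifier \<delta> (x - y)\<bar>"
    using i k by (simp add: mollify_def left_diff_distrib)
  also have "\<dots> \<le> (LINT y|lebesgue. \<bar>(f y - c) * mollifier \<delta> (x - y)\<bar>)"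
    by (rule integral_abs_bound)
  also have "\<dots> \<le> (LINT y|lebesgue. e * mollifier \<delta> (x - y))"
  proof (rule integral_mono)
    show "\<bar>(f y - c) * mollifier \<delta> (x - y)\<bar> \<le> e * mollifier \<delta> (x - y)" for y
      using near[of y] mollifier_nonneg[of \<delta> "x - y"] mollifier_eq_0[OF \<delta>, of "x - y"]
      by (cases "norm (y - x) < \<delta>") (auto simp: abs_mult norm_minus_commute intro: mult_right_mono)
  qed (use i k in \<open>auto simp: left_diff_distrib\<close>)
  also have "\<dots> = e" using k by simp
  finally show ?thesis .
qed

lemma mollify_bound:
  assumes "\<delta> > 0" "integrable lebesgue f" "\<And>y. \<bar>f y\<bar> \<le> B"
  shows "\<bar>mollify \<delta> f x\<bar> \<le> B"
  using mollify_near[of \<delta> f x 0 B] assms by simp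

lemma mollify_tendsto:
  assumes \<delta>: "\<And>n. \<delta> n > 0" "\<delta> \<longlonglongrightarrow> 0" and f: "integrable lebesgue f" "isCont f x"
  shows "(\<lambda>n. mollify (\<delta> n) f x) \<longlonglongrightarrow> f x"
proof (rule LIMSEQ_I)
  fix r :: real assume r: "r > 0"
  obtain d where d: "d > 0" "\<And>y. norm (y - x) < d \<Longrightarrow> norm (f y - f x) < r / 2"
    using f(2) r unfolding isCont_def LIM_eq by (metis half_gt_zero norm_zero right_minus_eq)
  have "eventually (\<lambda>n. \<delta> n < d) sequentially"
    using \<delta>(2) d(1) by (rule order_tendstoD)
  then obtain N where N: "\<And>n. n \<ge> N \<Longrightarrow> \<delta> n < d" by (auto simp: eventually_sequentially)
  have "norm (mollify (\<delta> n) f x - f x) < r" if "n \<ge> N" for n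
    using mollify_near[OF \<delta>(1) f(1), of x n "f x" "r / 2"] d(2) N[OF that] r
    by (smt (verit) field_sum_of_halves real_norm_def)
  then show "\<exists>N. \<forall>n\<ge>N. norm (mollify (\<delta> n) f x - f x) < r" by blast
qed

text \<open>The support lies in the Minkowski sum of \<open>C\<close> and a closed ball of radius
  \<open>\<delta>\<close>, which is compact; the last hypothesis places it inside
  \<open>\<Omega>\<close>.\<close>

lemma mollify_test_function:
  assumes \<delta>: "\<delta> > 0" and f: "integrable lebesgue f" "\<And>x. x \<notin> C \<Longrightarrow> f x = 0"
    and C: "compact C" "\<And>x y. x \<in> C \<Longrightarrow> norm y \<le> \<delta> \<Longrightarrow> x + y \<in> \<Omega>"
  shows "mollify \<delta> f \<in> test_functions \<Omega>"
proof -
  define S where "S = {x + y | x y. x \<in> C \<and> y \<in> cball 0 \<delta>}"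
  have S: "compact S" unfolding S_def by (rule compact_sums[OF C(1) compact_cball])
  have "mollify \<delta> f x = 0" if "x \<notin> S" for x
  proof -
    have "f y * mollifier \<delta> (x - y) = 0" for y
    proof (cases "y \<in> C")
      case True
      have "x \<in> S" if "norm (x - y) \<le> \<delta>"
        unfolding S_def using that True by (intro CollectI exI[of _ y] exI[of _ "x - y"]) auto
      then have "norm (x - y) > \<delta>" using \<open>x \<notin> S\<close> by force
      then show ?thesis using mollifier_eq_0[OF \<delta>, of "x - y"] by simp
    qed (use f in auto)
    then show ?thesis unfolding mollify_def by (simp only:) simp
  qed
  then have sub: "closure {x. mollify \<delta> f x \<noteq> 0} \<subseteq> S"
    using S by (intro closure_minimal) (auto simp: compact_imp_closed)
  then have "compact (closure {x. mollify \<delta> f x \<noteq> 0})"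
    using S by (meson bounded_subset closed_closure compact_eq_bounded_closed)
  moreover have "S \<subseteq> \<Omega>" using C(2) by (auto simp: S_def)
  ultimately show ?thesis
    using sub mollify_C_diff[OF \<delta> f(1)] by (auto simp: test_functions_def)
qed

subsection \<open>Square integrable functions\<close>

lemma lebesgue_on_integrable_iff:
  fixes f :: "'a::euclidean_space \<Rightarrow> real"
  assumes "\<Omega> \<in> sets lebesgue"
  shows "integrable (lebesgue_on \<Omega>) f \<longleftrightarrow> integrable lebesgue (\<lambda>x. indicator \<Omega> x * f x)"
  using integrable_restrict_space[of \<Omega> lebesgue f] assms by simp

lemma lebesgue_on_integral_eq:
  fixes f :: "'a::euclidean_space \<Rightarrow> real"
  assumes "\<Omega> \<in> sets lebesgue"
  shows "(LINT x|lebesgue_on \<Omega>. f x) = (LINT x|lebesgue. indicator \<Omega> x * f x)"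
  using integral_restrict_space[of \<Omega> lebesgue f] assms by simp

lemma AE_lebesgue_on_iff:
  assumes "\<Omega> \<in> sets lebesgue"
  shows "(AE x in lebesgue_on \<Omega>. P x) \<longleftrightarrow> (AE x in lebesgue. x \<in> \<Omega> \<longrightarrow> P x)"
  using AE_restrict_space_iff[of \<Omega> lebesgue P] assms by simp

lemma measurable_lebesgue_on:
  "f \<in> borel_measurable lebesgue \<Longrightarrow> f \<in> borel_measurable (lebesgue_on \<Omega>)"
  by (rule measurable_restrict_space1)

lemma square_integrable_inner:
  fixes u v :: "'a::euclidean_space \<Rightarrow> 'b::euclidean_space"
  assumes "square_integrable \<Omega> u" "square_integrable \<Omega> v"
  shows "integrable (lebesgue_on \<Omega>) (\<lambda>x. u x \<bullet> v x)"
proof (rule Bochner_Integration.integrable_bound[of _ "\<lambda>x. (norm (u x))\<^sup>2 + (norm (v x))\<^sup>2"])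
  show "AE x in lebesgue_on \<Omega>. norm (u x \<bullet> v x) \<le> norm ((norm (u x))\<^sup>2 + (norm (v x))\<^sup>2)"
  proof (rule AE_I2)
    fix x
    have "\<bar>u x \<bullet> v x\<bar> \<le> norm (u x) * norm (v x)" by (rule Cauchy_Schwarz_ineq2)
    also have "\<dots> \<le> (norm (u x))\<^sup>2 + (norm (v x))\<^sup>2"
      using sum_squares_bound[of "norm (u x)" "norm (v x)"]
        mult_nonneg_nonneg[OF norm_ge_zero norm_ge_zero, of "u x" "v x"] by linarith
    finally show "norm (u x \<bullet> v x) \<le> norm ((norm (u x))\<^sup>2 + (norm (v x))\<^sup>2)" by simp
  qed
qed (use assms in \<open>auto simp: square_integrable_def\<close>)

lemma square_integrable_add:
  fixes u v :: "'a::euclidean_space \<Rightarrow> 'b::euclidean_space"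
  assumes "square_integrable \<Omega> u" "square_integrable \<Omega> v"
  shows "square_integrable \<Omega> (\<lambda>x. u x + v x)"
proof -
  have "(norm (u x + v x))\<^sup>2 = (norm (u x))\<^sup>2 + 2 * (u x \<bullet> v x) + (norm (v x))\<^sup>2" for x
    by (simp add: power2_norm_eq_inner inner_add_left inner_add_right inner_commute)
  then show ?thesis
    using assms square_integrable_inner[OF assms] by (auto simp: square_integrable_def)
qed

lemma square_integrable_scaleR:
  fixes u :: "'a::euclidean_space \<Rightarrow> 'b::euclidean_space"
  shows "square_integrable \<Omega> u \<Longrightarrow> square_integrable \<Omega> (\<lambda>x. c *\<^sub>R u x)"
  by (auto simp: square_integrable_def power_mult_distrib)

lemma square_integrable_mult:
  fixes u :: "'a::euclidean_space \<Rightarrow> real"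
  shows "square_integrable \<Omega> u \<Longrightarrow> square_integrable \<Omega> (\<lambda>x. c * u x)"
  using square_integrable_scaleR[of \<Omega> u c] by simp

lemma square_integrable_diff:
  fixes u v :: "'a::euclidean_space \<Rightarrow> 'b::euclidean_space"
  assumes "square_integrable \<Omega> u" "square_integrable \<Omega> v"
  shows "square_integrable \<Omega> (\<lambda>x. u x - v x)"
  using square_integrable_add[OF assms(1) square_integrable_scaleR[OF assms(2), of "-1"]] by simp

lemma square_integrable_zero: "square_integrable \<Omega> (\<lambda>x. 0)"
  by (simp add: square_integrable_def)

lemma square_integrable_sum:
  fixes u :: "'i \<Rightarrow> 'a::euclidean_space \<Rightarrow> 'b::euclidean_space"
  shows "(\<And>i. i \<in> I \<Longrightarrow> square_integrable \<Omega> (u i)) \<Longrightarrow> square_integrable \<Omega> (\<lambda>x. \<Sum>i\<in>I. u i x)"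
  by (induction I rule: infinite_finite_induct) (auto intro: square_integrable_zero square_integrable_add)

lemma integrable_const_lebesgue_on:
  "\<Omega> \<in> lmeasurable \<Longrightarrow> integrable (lebesgue_on \<Omega>) (\<lambda>x. c :: real)"
  using finite_measure.integrable_const[OF finite_measure_lebesgue_on] by blast

lemma square_integrable_integrable:
  fixes u :: "'a::euclidean_space \<Rightarrow> real"
  assumes "square_integrable \<Omega> u" "\<Omega> \<in> lmeasurable"
  shows "integrable (lebesgue_on \<Omega>) u"
proof -
  have "square_integrable \<Omega> (\<lambda>x. 1 :: real)"
    using assms(2) by (auto simp: square_integrable_def intro: integrable_const_lebesgue_on)
  from square_integrable_inner[OF assms(1) this] show ?thesis by simp
qed

lemma bounded_square_integrable:
  fixes u :: "'a::euclidean_space \<Rightarrow> 'b::euclidean_space"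
  assumes "u \<in> borel_measurable (lebesgue_on \<Omega>)" "\<And>x. x \<in> \<Omega> \<Longrightarrow> norm (u x) \<le> B" "\<Omega> \<in> lmeasurable"
  shows "square_integrable \<Omega> u"
proof -
  have "integrable (lebesgue_on \<Omega>) (\<lambda>x. (norm (u x))\<^sup>2)"
  proof (rule Bochner_Integration.integrable_bound[of _ "\<lambda>x. B\<^sup>2"])
    show "integrable (lebesgue_on \<Omega>) (\<lambda>x. B\<^sup>2)"
      by (rule integrable_const_lebesgue_on[OF assms(3)])
    show "AE x in lebesgue_on \<Omega>. norm ((norm (u x))\<^sup>2) \<le> norm (B\<^sup>2)"
      by (rule AE_I2) (use assms(2) in \<open>auto simp: space_restrict_space intro: power_mono\<close>)
  qed (use assms(1) in auto)
  with assms(1) show ?thesis by (simp add: square_integrable_def)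
qed

lemma L2_inner_commute: "L2_inner \<Omega> u v = L2_inner \<Omega> v u"
  by (simp add: L2_inner_def inner_commute)

lemma L2_inner_diff_left:
  "square_integrable \<Omega> u \<Longrightarrow> square_integrable \<Omega> v \<Longrightarrow> square_integrable \<Omega> w \<Longrightarrow>
    L2_inner \<Omega> (\<lambda>x. u x - v x) w = L2_inner \<Omega> u w - L2_inner \<Omega> v w"
  by (simp add: L2_inner_def inner_diff_left square_integrable_inner)

lemma L2_inner_mult_left: "L2_inner \<Omega> (\<lambda>x. c * u x) w = c * L2_inner \<Omega> u w"
  by (simp add: L2_inner_def mult.assoc)

lemma L2_inner_mult_right: "L2_inner \<Omega> w (\<lambda>x. c * u x) = c * L2_inner \<Omega> w u"
  by (simp add: L2_inner_def mult.left_commute)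

lemma L2_inner_sum_left:
  assumes "\<And>i. i \<in> I \<Longrightarrow> square_integrable \<Omega> (u i)" "square_integrable \<Omega> w"
  shows "L2_inner \<Omega> (\<lambda>x. \<Sum>i\<in>I. u i x) w = (\<Sum>i\<in>I. L2_inner \<Omega> (u i) w)"
  using assms by (simp add: L2_inner_def inner_sum_left square_integrable_inner)

lemma L2_inner_sum_right:
  assumes "\<And>i. i \<in> I \<Longrightarrow> square_integrable \<Omega> (u i)" "square_integrable \<Omega> w"
  shows "L2_inner \<Omega> w (\<lambda>x. \<Sum>i\<in>I. u i x) = (\<Sum>i\<in>I. L2_inner \<Omega> w (u i))"
  using L2_inner_sum_left[OF assms] by (simp add: L2_inner_commute)

lemma L2_inner_nonneg: "0 \<le> L2_inner \<Omega> u u"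
  by (simp add: L2_inner_def integral_nonneg_AE)

lemma L2_inner_cong_AE:
  assumes "square_integrable \<Omega> u" "square_integrable \<Omega> u'" "square_integrable \<Omega> v" "square_integrable \<Omega> v'"
    and "AE x in lebesgue_on \<Omega>. u x = u' x" "AE x in lebesgue_on \<Omega>. v x = v' x"
  shows "L2_inner \<Omega> u v = L2_inner \<Omega> u' v'"
  unfolding L2_inner_def
proof (rule integral_cong_AE)
  show "AE x in lebesgue_on \<Omega>. u x \<bullet> v x = u' x \<bullet> v' x"
    using assms(5,6) by eventually_elim simp
qed (use assms in \<open>auto simp: square_integrable_def\<close>)

lemma L2_inner_eq_0_iff:
  assumes "square_integrable \<Omega> u"
  shows "L2_inner \<Omega> u u = 0 \<longleftrightarrow> (AE x in lebesgue_on \<Omega>. u x = 0)"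
  using square_integrable_inner[OF assms assms] unfolding L2_inner_def
  by (subst integral_nonneg_eq_0_iff_AE) auto

text \<open>A crude form of the Cauchy-Schwarz inequality, from
  \<open>\<bar>u\<bar> \<le> u^2 / e + e\<close>. The constant does not matter because
  \<open>e\<close> will be arbitrarily small.\<close>

lemma integral_abs_le_L2:
  fixes u :: "'a::euclidean_space \<Rightarrow> real"
  assumes "square_integrable \<Omega> u" "\<Omega> \<in> lmeasurable" "L2_inner \<Omega> u u \<le> e\<^sup>2" "e > 0"
  shows "(LINT x|lebesgue_on \<Omega>. \<bar>u x\<bar>) \<le> e * (1 + measure lebesgue \<Omega>)"
proof -
  have u: "integrable (lebesgue_on \<Omega>) u" using assms square_integrable_integrable by blast
  have c: "integrable (lebesgue_on \<Omega>) (\<lambda>x. c)" for c :: real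
    by (rule integrable_const_lebesgue_on[OF assms(2)])
  have u2: "integrable (lebesgue_on \<Omega>) (\<lambda>x. (u x)\<^sup>2)"
    using square_integrable_inner[OF assms(1,1)] by (simp add: power2_eq_square)
  have "(LINT x|lebesgue_on \<Omega>. \<bar>u x\<bar>) \<le> (LINT x|lebesgue_on \<Omega>. (u x)\<^sup>2 / e + e)"
  proof (rule integral_mono)
    show "\<bar>u x\<bar> \<le> (u x)\<^sup>2 / e + e" for x
    proof -
      have "\<bar>u x\<bar> * e \<le> \<bar>u x\<bar>\<^sup>2 + e\<^sup>2"
        using sum_squares_bound[of "\<bar>u x\<bar>" e] mult_nonneg_nonneg[OF abs_ge_zero, of e "u x"] \<open>e > 0\<close>
        by linarith
      then show ?thesis using \<open>e > 0\<close> by (simp add: field_simps power2_eq_square)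
    qed
  qed (use u u2 c in auto)
  also have "\<dots> = L2_inner \<Omega> u u / e + e * measure lebesgue \<Omega>"
    using u2 c fmeasurableD[OF assms(2)] by (simp add: L2_inner_def power2_eq_square measure_restrict_space)
  also have "L2_inner \<Omega> u u / e \<le> e"
    using assms(3,4) by (simp add: field_simps power2_eq_square)
  finally show ?thesis by (simp add: distrib_left)
qed

subsection \<open>Weak derivatives\<close>

lemma has_derivative_directional_quotient:
  fixes f :: "'a::real_normed_vector \<Rightarrow> real"
  assumes "(f has_derivative D) (at x)"
  shows "((\<lambda>t. (f (x + t *\<^sub>R b) - f x) / t) \<longlongrightarrow> D b) (at 0)"
proof -
  have "((\<lambda>s. x + s *\<^sub>R b) has_derivative (\<lambda>s. s *\<^sub>R b)) (at 0)"
    by (auto intro!: derivative_eq_intros)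
  then have "((\<lambda>s. f (x + s *\<^sub>R b)) has_derivative (\<lambda>s. D (s *\<^sub>R b))) (at 0)"
    by (rule has_derivative_compose) (simp add: assms)
  moreover have "(\<lambda>s. D (s *\<^sub>R b)) = (*) (D b)"
    using linear_cmul[OF has_derivative_linear[OF assms]] by (auto simp: mult.commute)
  ultimately have "((\<lambda>s. f (x + s *\<^sub>R b)) has_field_derivative D b) (at 0)"
    by (simp add: has_field_derivative_def)
  then show ?thesis
    by (simp add: DERIV_def)
qed

text \<open>A translation moves the difference quotient from the test function to \<open>u\<close>; both sides then
  converge by dominated convergence.\<close>

lemma Lipschitz_integration_by_parts:
  fixes u :: "'a::euclidean_space \<Rightarrow> real"
  assumes L: "L \<ge> 0" "\<And>x y. \<bar>u x - u y\<bar> \<le> L * norm (x - y)" and \<psi>: "\<psi> \<in> test_functions UNIV"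
    and b: "b \<in> Basis" and g: "g \<in> borel_measurable lebesgue"
    and lim: "AE x in lebesgue. ((\<lambda>t. (u (x + t *\<^sub>R b) - u x) / t) \<longlongrightarrow> g x) (at 0)"
  shows "(LINT x|lebesgue. u x * frechet_derivative \<psi> (at x) b) = - (LINT x|lebesgue. g x * \<psi> x)"
proof -
  define D where "D = (\<lambda>x. frechet_derivative \<psi> (at x) b)"
  define t where "t = (\<lambda>n. inverse (real (Suc n)))"
  have t: "t n > 0" "t n \<le> 1" for n by (auto simp: t_def field_simps)
  have t0: "t \<longlonglongrightarrow> 0" unfolding t_def by (rule LIMSEQ_inverse_real_of_nat)
  have contu: "continuous_on UNIV u"
    using L lipschitz_on_continuous_on[of L UNIV u] by (auto simp: lipschitz_on_def dist_norm)
  note cont\<psi> = test_function_continuous[OF \<psi>]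
  obtain M where M: "M > 0" "\<And>x h. \<bar>frechet_derivative \<psi> (at x) h\<bar> \<le> M * norm h"
    "\<And>x y. \<bar>\<psi> x - \<psi> y\<bar> \<le> M * norm (x - y)"
    using test_function_derivative_bounded[OF \<psi>] by blast
  obtain R where R: "\<And>x. norm x > R \<Longrightarrow> \<psi> x = 0"
    using \<psi> by (auto simp: test_functions_UNIV_iff bounded_iff not_le) (meson not_le)
  \<comment> \<open>The translations have length at most one, so all supports stay in the ball of
    radius \<open>R + 1\<close>, and \<open>u\<close> has to be bounded only there.\<close>
  have "compact (u ` cball 0 (R + 1))"
    using contu continuous_on_subset by (intro compact_continuous_image) auto
  then obtain B where B: "\<And>x. x \<in> cball 0 (R + 1) \<Longrightarrow> \<bar>u x\<bar> \<le> B" 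
    using compact_imp_bounded[of "u ` cball 0 (R + 1)"] unfolding bounded_iff image_iff Ball_def real_norm_def
    by blast
  have shift: "\<psi> (x + t n *\<^sub>R b) = 0" if "norm x > R + 1" for x n
  proof (rule R)
    have "norm x \<le> norm (x + t n *\<^sub>R b) + norm (t n *\<^sub>R b)" by (metis add_diff_cancel norm_triangle_ineq4)
    then show "norm (x + t n *\<^sub>R b) > R" using that t[of n] b by simp
  qed
  have eq: "(LINT x|lebesgue. u x * ((\<psi> (x + t n *\<^sub>R b) - \<psi> x) / t n)) =
     (LINT x|lebesgue. (u (x + (- t n) *\<^sub>R b) - u x) / t n * \<psi> x)" for n
  proof -
    have c1: "continuous_on UNIV (\<lambda>x. u (x - t n *\<^sub>R b) * \<psi> x)"
      and c2: "continuous_on UNIV (\<lambda>x. u x * \<psi> (x + t n *\<^sub>R b))"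
      and c3: "continuous_on UNIV (\<lambda>x. u x * \<psi> x)"
      by (intro continuous_on_mult continuous_on_compose2[OF contu] continuous_on_compose2[OF cont\<psi>]
          continuous_on_diff continuous_on_add continuous_on_const continuous_on_id contu cont\<psi> subset_UNIV)+
    have i1: "integrable lebesgue (\<lambda>x. u (x - t n *\<^sub>R b) * \<psi> x)"
      by (rule continuous_compact_support_integrable[OF c1], rule bounded_subset[of "cball 0 R"])
         (use R in \<open>force simp: not_le[symmetric]\<close>)+
    have i2: "integrable lebesgue (\<lambda>x. u x * \<psi> (x + t n *\<^sub>R b))"
      by (rule continuous_compact_support_integrable[OF c2], rule bounded_subset[of "cball 0 (R + 1)"])
         (use shift in \<open>force simp: not_le[symmetric]\<close>)+
    have i3: "integrable lebesgue (\<lambda>x. u x * \<psi> x)"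
      by (rule continuous_compact_support_integrable[OF c3], rule bounded_subset[of "cball 0 R"])
         (use R in \<open>force simp: not_le[symmetric]\<close>)+
    have "(LINT x|lebesgue. u x * \<psi> (x + t n *\<^sub>R b)) = (LINT x|lebesgue. u (x - t n *\<^sub>R b) * \<psi> x)"
      using integral_translate[OF c1, of "t n *\<^sub>R b"] by simp
    then show ?thesis
      using i1 i2 i3 by (simp add: right_diff_distrib left_diff_distrib diff_divide_distrib)
  qed
  have measu: "u \<in> borel_measurable lebesgue" by (rule continuous_imp_measurable_lebesgue[OF contu])
  have 1: "(\<lambda>n. LINT x|lebesgue. u x * ((\<psi> (x + t n *\<^sub>R b) - \<psi> x) / t n)) \<longlonglongrightarrow> (LINT x|lebesgue. u x * D x)"
  proof (rule integral_dominated_convergence[where w = "\<lambda>x. indicator (cball 0 (R + 1)) x * (B * M)"])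
    show "integrable lebesgue (\<lambda>x::'a. indicator (cball 0 (R + 1)) x * (B * M))"
      using emeasure_bounded_finite[OF bounded_cball, of "0::'a" "R + 1"]
      by (intro integrable_mult_left impI integrable_real_indicator) auto
    show "(\<lambda>x. u x * D x) \<in> borel_measurable lebesgue"
      unfolding D_def
      by (intro borel_measurable_times measu continuous_imp_measurable_lebesgue
          test_function_continuous[OF test_function_partial[OF \<psi> b]])
    show "(\<lambda>x. u x * ((\<psi> (x + t n *\<^sub>R b) - \<psi> x) / t n)) \<in> borel_measurable lebesgue" for n
      using t[of n] by (intro borel_measurable_times measu continuous_imp_measurable_lebesgue continuous_on_divide
          continuous_on_diff continuous_on_compose2[OF cont\<psi>] cont\<psi> continuous_intros) auto
    show "AE x in lebesgue. norm (u x * ((\<psi> (x + t n *\<^sub>R b) - \<psi> x) / t n))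
        \<le> indicator (cball 0 (R + 1)) x * (B * M)" for n
    proof (rule AE_I2)
      fix x
      show "norm (u x * ((\<psi> (x + t n *\<^sub>R b) - \<psi> x) / t n)) \<le> indicator (cball 0 (R + 1)) x * (B * M)"
      proof (cases "norm x \<le> R + 1")
        case True
        have "\<bar>(\<psi> (x + t n *\<^sub>R b) - \<psi> x) / t n\<bar> \<le> M"
          using M(3)[of "x + t n *\<^sub>R b" x] t[of n] b by (simp add: divide_le_eq)
        moreover have "\<bar>u x\<bar> \<le> B" using B True by simp
        ultimately have "\<bar>u x\<bar> * \<bar>(\<psi> (x + t n *\<^sub>R b) - \<psi> x) / t n\<bar> \<le> B * M"
          by (intro mult_mono) auto
        then show ?thesis using True by (simp add: abs_mult)
      next
        case False
        then show ?thesis using shift[of x n] R[of x] by simp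
      qed
    qed
    show "AE x in lebesgue. (\<lambda>n. u x * ((\<psi> (x + t n *\<^sub>R b) - \<psi> x) / t n)) \<longlonglongrightarrow> u x * D x"
    proof (intro AE_I2 tendsto_intros)
      fix x
      have "((\<lambda>s. (\<psi> (x + s *\<^sub>R b) - \<psi> x) / s) \<longlongrightarrow> D x) (at 0)"
        unfolding D_def by (rule has_derivative_directional_quotient[OF test_function_has_derivative[OF \<psi>]])
      then show "(\<lambda>n. (\<psi> (x + t n *\<^sub>R b) - \<psi> x) / t n) \<longlonglongrightarrow> D x"
        by (rule filterlim_compose) (use t0 in \<open>simp add: filterlim_at t_def\<close>)
    qed
  qed
  \<comment> \<open>The Lipschitz constant bounds the quotients of \<open>u\<close>, so a multiple
    of \<open>\<bar>\<psi>\<bar>\<close> is a majorant. The steps are backward but divided by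
    \<open>+ t n\<close>, whence the minus sign in the limit.\<close>
  have 2: "(\<lambda>n. LINT x|lebesgue. (u (x + (- t n) *\<^sub>R b) - u x) / t n * \<psi> x) \<longlonglongrightarrow> (LINT x|lebesgue. - g x * \<psi> x)"
  proof (rule integral_dominated_convergence[where w = "\<lambda>x. L * \<bar>\<psi> x\<bar>"])
    show "integrable lebesgue (\<lambda>x. L * \<bar>\<psi> x\<bar>)"
      using test_function_integrable[OF \<psi>] by simp
    show "(\<lambda>x. - g x * \<psi> x) \<in> borel_measurable lebesgue"
      by (intro borel_measurable_times borel_measurable_uminus g continuous_imp_measurable_lebesgue cont\<psi>)
    show "(\<lambda>x. (u (x + (- t n) *\<^sub>R b) - u x) / t n * \<psi> x) \<in> borel_measurable lebesgue" for n
      using t[of n] by (intro continuous_imp_measurable_lebesgue continuous_on_divide continuous_on_mult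
          continuous_on_diff continuous_on_compose2[OF contu] contu cont\<psi> continuous_intros) auto
    show "AE x in lebesgue. norm ((u (x + (- t n) *\<^sub>R b) - u x) / t n * \<psi> x) \<le> L * \<bar>\<psi> x\<bar>" for n
    proof (rule AE_I2)
      fix x
      have "\<bar>(u (x + (- t n) *\<^sub>R b) - u x) / t n\<bar> \<le> L"
        using L(2)[of "x + (- t n) *\<^sub>R b" x] t[of n] b by (simp add: divide_le_eq)
      then show "norm ((u (x + (- t n) *\<^sub>R b) - u x) / t n * \<psi> x) \<le> L * \<bar>\<psi> x\<bar>"
        by (simp only: real_norm_def abs_mult) (intro mult_right_mono, auto)
    qed
    show "AE x in lebesgue. (\<lambda>n. (u (x + (- t n) *\<^sub>R b) - u x) / t n * \<psi> x) \<longlonglongrightarrow> - g x * \<psi> x"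
      using lim
    proof eventually_elim
      fix x assume "((\<lambda>t. (u (x + t *\<^sub>R b) - u x) / t) \<longlongrightarrow> g x) (at 0)"
      then have "(\<lambda>n. (u (x + (- t n) *\<^sub>R b) - u x) / (- t n)) \<longlonglongrightarrow> g x"
        by (rule filterlim_compose) (use tendsto_minus[OF t0] in \<open>simp add: filterlim_at t_def\<close>)
      then have "(\<lambda>n. - ((u (x + (- t n) *\<^sub>R b) - u x) / (- t n)) * \<psi> x) \<longlonglongrightarrow> - g x * \<psi> x"
        by (intro tendsto_intros)
      then show "(\<lambda>n. (u (x + (- t n) *\<^sub>R b) - u x) / t n * \<psi> x) \<longlonglongrightarrow> - g x * \<psi> x"
        by simp
    qed
  qed
  show ?thesis
    using LIMSEQ_unique[OF 1 2[folded eq]] by (simp add: D_def)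
qed

text \<open>Mollifications of \<open>h\<close> with radius below the distance from \<open>C\<close>
  to the complement of \<open>\<Omega>\<close> are test functions. They converge to \<open>h\<close>
  pointwise under a common bound, so dominated convergence applies against the integrable
  \<open>F\<close>.\<close>

lemma orthogonal_test_imp_orthogonal_continuous:
  fixes h :: "'a::euclidean_space \<Rightarrow> real"
  assumes F: "integrable lebesgue F" and zero: "\<And>\<psi>. \<psi> \<in> test_functions \<Omega> \<Longrightarrow> (LINT x|lebesgue. F x * \<psi> x) = 0"
    and \<Omega>: "open \<Omega>" and h: "continuous_on UNIV h" "compact C" "C \<subseteq> \<Omega>" "\<And>x. x \<notin> C \<Longrightarrow> h x = 0"
  shows "(LINT x|lebesgue. F x * h x) = 0"
proof -
  obtain \<epsilon> where \<epsilon>: "\<epsilon> > 0" "(\<Union>x\<in>C. cball x \<epsilon>) \<subseteq> \<Omega>"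
    using compact_subset_open_imp_cball_epsilon_subset[OF h(2) \<Omega> h(3)] by blast
  define d where "d = (\<lambda>n. \<epsilon> * inverse (real (Suc n)))"
  have d: "d n > 0" "d n \<le> \<epsilon>" for n using \<epsilon>(1) by (auto simp: d_def field_simps)
  have d0: "d \<longlonglongrightarrow> 0"
    unfolding d_def using tendsto_mult_right_zero[OF LIMSEQ_inverse_real_of_nat] by blast
  have "compact (h ` C)" using h by (auto intro: compact_continuous_image continuous_on_subset)
  then obtain B where "\<forall>y\<in>h ` C. norm y \<le> B"
    using compact_imp_bounded[of "h ` C"] unfolding bounded_iff by blast
  then have B: "\<bar>h x\<bar> \<le> max 0 B" for x using h(4)[of x] by (cases "x \<in> C") auto
  have inth: "integrable lebesgue h"
    by (rule continuous_compact_support_integrable[OF h(1)], rule bounded_subset[OF compact_imp_bounded[OF h(2)]])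
       (use h(4) in auto)
  have test: "mollify (d n) h \<in> test_functions \<Omega>" for n
  proof (rule mollify_test_function[OF d(1) inth h(4) h(2)])
    fix x y :: 'a assume "x \<in> C" "norm y \<le> d n"
    then have "x + y \<in> cball x \<epsilon>" using d(2)[of n] by (simp add: dist_norm)
    then show "x + y \<in> \<Omega>" using \<epsilon>(2) \<open>x \<in> C\<close> by blast
  qed
  have "(\<lambda>n. LINT x|lebesgue. F x * mollify (d n) h x) \<longlonglongrightarrow> (LINT x|lebesgue. F x * h x)"
  proof (rule integral_dominated_convergence[where w = "\<lambda>x. \<bar>F x\<bar> * max 0 B"])
    show "(\<lambda>x. F x * h x) \<in> borel_measurable lebesgue"
      using F inth by auto
    show "(\<lambda>x. F x * mollify (d n) h x) \<in> borel_measurable lebesgue" for n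
      using F test_function_integrable[OF test[of n]] by auto
    show "AE x in lebesgue. (\<lambda>n. F x * mollify (d n) h x) \<longlonglongrightarrow> F x * h x"
      using h(1) by (intro AE_I2 tendsto_intros mollify_tendsto d d0 inth)
        (auto simp: continuous_on_eq_continuous_at)
    show "AE x in lebesgue. norm (F x * mollify (d n) h x) \<le> \<bar>F x\<bar> * max 0 B" for n
      using mollify_bound[OF d(1) inth B] by (intro AE_I2) (simp add: abs_mult mult_left_mono)
  qed (use F in auto)
  moreover have "(LINT x|lebesgue. F x * mollify (d n) h x) = 0" for n
    using zero[OF test] .
  ultimately show ?thesis using LIMSEQ_unique[OF _ tendsto_const] by simp
qed

text \<open>The function is tested against continuous approximations of its sign that are supported
  in \<open>\<Omega>\<close>.\<close>

lemma fundamental_lemma: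
  fixes f :: "'a::euclidean_space \<Rightarrow> real"
  assumes \<Omega>: "open \<Omega>" "bounded \<Omega>" and f: "integrable (lebesgue_on \<Omega>) f"
    and zero: "\<And>\<psi>. \<psi> \<in> test_functions \<Omega> \<Longrightarrow> (LINT x|lebesgue_on \<Omega>. f x * \<psi> x) = 0"
  shows "AE x in lebesgue_on \<Omega>. f x = 0"
proof -
  have s\<Omega>: "\<Omega> \<in> sets lebesgue" using \<Omega> by (simp add: bounded_set_imp_lmeasurable)
  define F where "F = (\<lambda>x. indicator \<Omega> x * f x)"
  have F: "integrable lebesgue F"
    using f s\<Omega> by (simp add: F_def lebesgue_on_integrable_iff)
  have Fz: "(LINT x|lebesgue. F x * \<psi> x) = 0" if "\<psi> \<in> test_functions \<Omega>" for \<psi>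
    using zero[OF that] s\<Omega> by (simp add: F_def lebesgue_on_integral_eq mult.assoc)
  \<comment> \<open>The cut-off below uses the distance to the complement, which
    \<open>infdist\<close> reports as zero if that set is empty.\<close>
  have ne: "- \<Omega> \<noteq> {}" using \<Omega>(2) not_bounded_UNIV by (metis Compl_empty_eq double_complement)
  define s where "s = (\<lambda>x. sgn (F x))"
  have "s \<in> borel_measurable lebesgue" using F by (auto simp: s_def)
  \<comment> \<open>Measurability in this sense provides continuous functions that converge to the
    sign of \<open>F\<close> off a null set.\<close>
  then have "s measurable_on UNIV" by (rule lebesgue_measurable_imp_measurable_on) auto
  then obtain N g where N: "negligible N" and g: "\<And>n::nat. continuous_on UNIV (g n)"
    and gs: "\<And>x. x \<notin> N \<Longrightarrow> (\<lambda>n. g n x) \<longlonglongrightarrow> s x"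
    unfolding measurable_on_def by auto
  \<comment> \<open>A continuous cut-off: zero at distance at most \<open>1 / n\<close> from the
    complement, one at distance at least \<open>2 / n\<close>. Clipping \<open>g n\<close> to
    \<open>[-1, 1]\<close> below gives the majorant and does not disturb the limit, as signs lie in
    that interval.\<close>
  define \<zeta> where "\<zeta> = (\<lambda>(n::nat) x. max 0 (min 1 (real n * infdist x (- \<Omega>) - 1)))"
  define h where "h = (\<lambda>n x. \<zeta> n x * max (-1) (min 1 (g n x)))"
  have \<zeta>: "0 \<le> \<zeta> n x" "\<zeta> n x \<le> 1" for n x by (auto simp: \<zeta>_def)
  have hb: "\<bar>h n x\<bar> \<le> 1" for n x
    using \<zeta>[of n x] mult_mono[of "\<zeta> n x" 1 "\<bar>max (-1) (min 1 (g n x))\<bar>" 1] by (simp add: h_def abs_mult)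
  have hcont: "continuous_on UNIV (h n)" for n
    unfolding h_def \<zeta>_def by (intro continuous_intros g)
  have hz: "(LINT x|lebesgue. F x * h n x) = 0" for n
  proof (rule orthogonal_test_imp_orthogonal_continuous[OF F Fz \<Omega>(1) hcont])
    define C where "C = {x. 1 \<le> real n * infdist x (- \<Omega>)}"
    have "closed C" unfolding C_def by (intro closed_Collect_le continuous_intros)
    moreover show "C \<subseteq> \<Omega>"
    proof
      fix x assume "x \<in> C"
      then have "infdist x (- \<Omega>) \<noteq> 0" by (auto simp: C_def)
      then show "x \<in> \<Omega>" by (metis ComplI infdist_zero)
    qed
    ultimately show "compact C" using \<Omega>(2) bounded_subset compact_eq_bounded_closed by blast
    show "h n x = 0" if "x \<notin> C" for x using that by (simp add: C_def h_def \<zeta>_def)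
  qed auto
  have "(\<lambda>n. LINT x|lebesgue. F x * h n x) \<longlonglongrightarrow> (LINT x|lebesgue. \<bar>F x\<bar>)"
  proof (rule integral_dominated_convergence[where w = "\<lambda>x. \<bar>F x\<bar>"])
    show "(\<lambda>x. F x * h n x) \<in> borel_measurable lebesgue" for n
      by (rule borel_measurable_times[OF borel_measurable_integrable[OF F] continuous_imp_measurable_lebesgue[OF hcont]])
    show "AE x in lebesgue. norm (F x * h n x) \<le> \<bar>F x\<bar>" for n
      by (rule AE_I2) (use hb[of n] mult_left_mono[of "\<bar>h n x\<bar>" 1 "\<bar>F x\<bar>" for x] in \<open>auto simp: abs_mult\<close>)
    have "AE x in lebesgue. x \<notin> N"
      using N by (simp add: AE_not_in negligible_iff_null_sets)
    then show "AE x in lebesgue. (\<lambda>n. F x * h n x) \<longlonglongrightarrow> \<bar>F x\<bar>"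
    proof eventually_elim
      fix x assume x: "x \<notin> N"
      show "(\<lambda>n. F x * h n x) \<longlonglongrightarrow> \<bar>F x\<bar>"
      proof (cases "x \<in> \<Omega>")
        case False
        then show ?thesis by (simp add: F_def)
      next
        case True
        have "infdist x (- \<Omega>) > 0"
          using True \<Omega>(1) ne by (intro infdist_pos_not_in_closed) auto
        then obtain m :: nat where m: "2 < real m * infdist x (- \<Omega>)" using ex_less_of_nat_mult by blast
        have "\<zeta> n x = 1" if "n \<ge> m" for n
        proof -
          have "real m * infdist x (- \<Omega>) \<le> real n * infdist x (- \<Omega>)"
            using that by (intro mult_right_mono) (auto simp: infdist_nonneg)
          then show ?thesis using m by (simp add: \<zeta>_def)
        qed
        then have "eventually (\<lambda>n. 1 = \<zeta> n x) sequentially" by (auto simp: eventually_sequentially)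
        then have "(\<lambda>n. \<zeta> n x) \<longlonglongrightarrow> 1" by (rule Lim_transform_eventually[OF tendsto_const])
        then have "(\<lambda>n. F x * h n x) \<longlonglongrightarrow> F x * (1 * max (-1) (min 1 (s x)))"
          unfolding h_def by (intro tendsto_intros gs x)
        moreover have "max (-1) (min 1 (s x)) = s x" by (simp add: s_def sgn_if)
        ultimately show ?thesis by (simp add: s_def abs_sgn)
      qed
    qed
  qed (use F in auto)
  then have "(LINT x|lebesgue. \<bar>F x\<bar>) = 0"
    using LIMSEQ_unique[OF _ tendsto_const] by (simp add: hz)
  then have "AE x in lebesgue. \<bar>F x\<bar> = 0"
    using F by (subst (asm) integral_nonneg_eq_0_iff_AE) auto
  then have "AE x in lebesgue. x \<in> \<Omega> \<longrightarrow> f x = 0"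
    by eventually_elim (auto simp: F_def)
  then show ?thesis using s\<Omega> by (simp add: AE_lebesgue_on_iff)
qed

lemma test_function_square_integrable:
  assumes "\<psi> \<in> test_functions \<Omega>'" "\<Omega> \<in> lmeasurable"
  shows "square_integrable \<Omega> \<psi>"
proof -
  obtain B where "\<And>x. \<bar>\<psi> x\<bar> \<le> B" using test_function_bounded[OF assms(1)] by blast
  then show ?thesis
    using test_function_continuous[OF assms(1)] assms(2)
    by (intro bounded_square_integrable[of _ _ B] measurable_lebesgue_on continuous_imp_measurable_lebesgue) auto
qed

lemma square_integrable_component:
  fixes g :: "'a::euclidean_space \<Rightarrow> 'b::euclidean_space"
  assumes "square_integrable \<Omega> g"
  shows "square_integrable \<Omega> (\<lambda>x. g x \<bullet> b)"
  unfolding square_integrable_def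
proof
  show "(\<lambda>x. g x \<bullet> b) \<in> borel_measurable (lebesgue_on \<Omega>)"
    using assms by (auto simp: square_integrable_def)
  show "integrable (lebesgue_on \<Omega>) (\<lambda>x. (norm (g x \<bullet> b))\<^sup>2)"
  proof (rule Bochner_Integration.integrable_bound[of _ "\<lambda>x. (norm b)\<^sup>2 * (norm (g x))\<^sup>2"])
    show "AE x in lebesgue_on \<Omega>. norm ((norm (g x \<bullet> b))\<^sup>2) \<le> norm ((norm b)\<^sup>2 * (norm (g x))\<^sup>2)"
    proof (rule AE_I2)
      fix x
      have "(norm (g x \<bullet> b))\<^sup>2 \<le> (norm (g x) * norm b)\<^sup>2"
        using Cauchy_Schwarz_ineq2[of "g x" b] by (intro power_mono) auto
      then show "norm ((norm (g x \<bullet> b))\<^sup>2) \<le> norm ((norm b)\<^sup>2 * (norm (g x))\<^sup>2)"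
        by (simp add: power_mult_distrib mult.commute)
    qed
  qed (use assms in \<open>auto simp: square_integrable_def\<close>)
qed

text \<open>Each component of the difference is orthogonal to all test functions.\<close>

lemma has_L2_gradient_unique:
  fixes \<Omega> :: "'a::euclidean_space set"
  assumes \<Omega>: "open \<Omega>" "bounded \<Omega>" and g: "has_L2_gradient \<Omega> v g" "has_L2_gradient \<Omega> v g'"
  shows "AE x in lebesgue_on \<Omega>. g x = g' x"
proof -
  have l\<Omega>: "\<Omega> \<in> lmeasurable" using \<Omega> by (simp add: bounded_set_imp_lmeasurable)
  have "AE x in lebesgue_on \<Omega>. g x \<bullet> b - g' x \<bullet> b = 0" if b: "b \<in> Basis" for b
  proof (rule fundamental_lemma[OF \<Omega>])
    have s: "square_integrable \<Omega> (\<lambda>x. g x \<bullet> b)" "square_integrable \<Omega> (\<lambda>x. g' x \<bullet> b)"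
      using g square_integrable_component by (auto simp: has_L2_gradient_def)
    then show "integrable (lebesgue_on \<Omega>) (\<lambda>x. g x \<bullet> b - g' x \<bullet> b)"
      by (intro Bochner_Integration.integrable_diff square_integrable_integrable[OF _ l\<Omega>])
    fix \<psi> assume \<psi>: "\<psi> \<in> test_functions \<Omega>"
    have "(LINT x|lebesgue_on \<Omega>. v x * frechet_derivative \<psi> (at x) b) = - (LINT x|lebesgue_on \<Omega>. (g x \<bullet> b) * \<psi> x)"
      "(LINT x|lebesgue_on \<Omega>. v x * frechet_derivative \<psi> (at x) b) = - (LINT x|lebesgue_on \<Omega>. (g' x \<bullet> b) * \<psi> x)"
      using g \<psi> b unfolding has_L2_gradient_def by blast+
    then show "(LINT x|lebesgue_on \<Omega>. (g x \<bullet> b - g' x \<bullet> b) * \<psi> x) = 0"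
      using square_integrable_inner[OF s(1) test_function_square_integrable[OF \<psi> l\<Omega>]]
        square_integrable_inner[OF s(2) test_function_square_integrable[OF \<psi> l\<Omega>]]
      by (simp add: left_diff_distrib)
  qed
  then have "AE x in lebesgue_on \<Omega>. \<forall>b\<in>Basis. g x \<bullet> b - g' x \<bullet> b = 0"
    by (intro AE_finite_allI) auto
  then show ?thesis
    by eventually_elim (auto intro: euclidean_eqI)
qed

lemma has_L2_gradient_add:
  assumes l\<Omega>: "\<Omega> \<in> lmeasurable" and v: "square_integrable \<Omega> v" "square_integrable \<Omega> w"
    and g: "has_L2_gradient \<Omega> v g" "has_L2_gradient \<Omega> w k"
  shows "has_L2_gradient \<Omega> (\<lambda>x. v x + w x) (\<lambda>x. g x + k x)"
  unfolding has_L2_gradient_def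
proof (intro conjI ballI)
  show "square_integrable \<Omega> (\<lambda>x. g x + k x)"
    using g by (auto simp: has_L2_gradient_def intro: square_integrable_add)
  fix \<psi> and b :: 'a assume \<psi>: "\<psi> \<in> test_functions \<Omega>" and b: "b \<in> Basis"
  note t = test_function_square_integrable[OF test_function_partial[OF \<psi> b] l\<Omega>]
    test_function_square_integrable[OF \<psi> l\<Omega>]
  have "square_integrable \<Omega> (\<lambda>x. g x \<bullet> b)" "square_integrable \<Omega> (\<lambda>x. k x \<bullet> b)"
    using g square_integrable_component by (auto simp: has_L2_gradient_def)
  from square_integrable_inner[OF this(1) t(2)] square_integrable_inner[OF this(2) t(2)]
    square_integrable_inner[OF v(1) t(1)] square_integrable_inner[OF v(2) t(1)]
  show "(LINT x|lebesgue_on \<Omega>. (v x + w x) * frechet_derivative \<psi> (at x) b) =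
      - (LINT x|lebesgue_on \<Omega>. ((g x + k x) \<bullet> b) * \<psi> x)"
    using g \<psi> b by (simp add: has_L2_gradient_def distrib_right inner_add_left)
qed

lemma has_L2_gradient_mult:
  assumes "has_L2_gradient \<Omega> v g"
  shows "has_L2_gradient \<Omega> (\<lambda>x. c * v x) (\<lambda>x. c *\<^sub>R g x)"
  using assms by (auto simp: has_L2_gradient_def mult.assoc intro: square_integrable_scaleR)

lemma has_L2_gradient_cong_AE:
  assumes "has_L2_gradient \<Omega> v g" "square_integrable \<Omega> v" "square_integrable \<Omega> w"
    "AE x in lebesgue_on \<Omega>. v x = w x" "\<Omega> \<in> lmeasurable"
  shows "has_L2_gradient \<Omega> w g"
proof -
  have "(LINT x|lebesgue_on \<Omega>. w x * frechet_derivative \<psi> (at x) b) = (LINT x|lebesgue_on \<Omega>. v x * frechet_derivative \<psi> (at x) b)"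
    if "\<psi> \<in> test_functions \<Omega>" "b \<in> Basis" for \<psi> b
    using L2_inner_cong_AE[of \<Omega> w v "\<lambda>x. frechet_derivative \<psi> (at x) b" "\<lambda>x. frechet_derivative \<psi> (at x) b"]
      test_function_square_integrable[OF test_function_partial[OF that] assms(5)] assms
    by (simp add: L2_inner_def eq_commute)
  then show ?thesis using assms(1) by (simp add: has_L2_gradient_def)
qed

definition grad :: "('a::euclidean_space \<Rightarrow> real) \<Rightarrow> 'a \<Rightarrow> 'a" where
  "grad \<psi> x = (\<Sum>b\<in>Basis. frechet_derivative \<psi> (at x) b *\<^sub>R b)"

lemma grad_inner_Basis: "b \<in> Basis \<Longrightarrow> grad \<psi> x \<bullet> b = frechet_derivative \<psi> (at x) b"
  by (simp add: grad_def inner_sum_left_Basis)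

lemma test_function_integration_by_parts:
  fixes \<psi> :: "'a::euclidean_space \<Rightarrow> real"
  assumes \<psi>: "\<psi> \<in> test_functions UNIV" and \<xi>: "\<xi> \<in> test_functions UNIV" and b: "b \<in> Basis"
  shows "(LINT x|lebesgue. \<psi> x * frechet_derivative \<xi> (at x) b) = - (LINT x|lebesgue. frechet_derivative \<psi> (at x) b * \<xi> x)"
proof -
  obtain L where L: "L > 0" "\<And>x h. \<bar>frechet_derivative \<psi> (at x) h\<bar> \<le> L * norm h"
    "\<And>x y. \<bar>\<psi> x - \<psi> y\<bar> \<le> L * norm (x - y)"
    using test_function_derivative_bounded[OF \<psi>] by blast
  show ?thesis
  proof (rule Lipschitz_integration_by_parts[OF _ L(3) \<xi> b])
    show "(\<lambda>x. frechet_derivative \<psi> (at x) b) \<in> borel_measurable lebesgue"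
      by (rule continuous_imp_measurable_lebesgue[OF test_function_continuous[OF test_function_partial[OF \<psi> b]]])
    show "AE x in lebesgue. ((\<lambda>t. (\<psi> (x + t *\<^sub>R b) - \<psi> x) / t) \<longlongrightarrow> frechet_derivative \<psi> (at x) b) (at 0)"
      by (rule AE_I2) (rule has_derivative_directional_quotient[OF test_function_has_derivative[OF \<psi>]])
  qed (use L in auto)
qed

lemma lebesgue_on_integral_support:
  fixes f :: "'a::euclidean_space \<Rightarrow> real"
  assumes "\<Omega> \<in> sets lebesgue" "\<And>x. x \<notin> \<Omega> \<Longrightarrow> f x = 0"
  shows "(LINT x|lebesgue_on \<Omega>. f x) = (LINT x|lebesgue. f x)"
proof -
  have "(\<lambda>x. indicator \<Omega> x * f x) = f" using assms(2) by (auto simp: indicator_def fun_eq_iff)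
  then show ?thesis by (simp add: lebesgue_on_integral_eq[OF assms(1)])
qed

lemma test_function_eq_0: "\<psi> \<in> test_functions \<Omega> \<Longrightarrow> x \<notin> \<Omega> \<Longrightarrow> \<psi> x = 0"
  using closure_subset[of "{x. \<psi> x \<noteq> 0}"] by (auto simp: test_functions_def)

text \<open>Only \<open>\<psi>\<close> is supported in \<open>\<Omega>\<close>, while
  \<open>\<xi>\<close> may reach across the boundary. This asymmetry is what survives the passage to
  the limit in \<open>H1_0\<close>.\<close>

lemma test_function_integration_by_parts_on:
  fixes \<psi> :: "'a::euclidean_space \<Rightarrow> real"
  assumes \<psi>: "\<psi> \<in> test_functions \<Omega>" and \<xi>: "\<xi> \<in> test_functions UNIV" and b: "b \<in> Basis"
    and \<Omega>: "\<Omega> \<in> sets lebesgue"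
  shows "(LINT x|lebesgue_on \<Omega>. \<psi> x * frechet_derivative \<xi> (at x) b) =
    - (LINT x|lebesgue_on \<Omega>. (grad \<psi> x \<bullet> b) * \<xi> x)"
proof -
  have "\<psi> x * frechet_derivative \<xi> (at x) b = 0" "(grad \<psi> x \<bullet> b) * \<xi> x = 0" if "x \<notin> \<Omega>" for x
    using test_function_eq_0[OF \<psi> that] test_function_eq_0[OF test_function_partial[OF \<psi> b] that] b
    by (simp_all add: grad_inner_Basis)
  then show ?thesis
    using test_function_integration_by_parts[OF test_functions_UNIV[OF \<psi>] \<xi> b] b
    by (simp add: lebesgue_on_integral_support[OF \<Omega>] grad_inner_Basis)
qed

lemma square_integrable_scaleR_const:
  fixes u :: "'a::euclidean_space \<Rightarrow> real" and b :: "'b::euclidean_space"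
  shows "square_integrable \<Omega> u \<Longrightarrow> square_integrable \<Omega> (\<lambda>x. u x *\<^sub>R b)"
  by (auto simp: square_integrable_def power_mult_distrib)

lemma grad_square_integrable:
  assumes "\<psi> \<in> test_functions \<Omega>'" "\<Omega> \<in> lmeasurable"
  shows "square_integrable \<Omega> (grad \<psi>)"
  unfolding grad_def[abs_def]
  by (intro square_integrable_sum square_integrable_scaleR_const
      test_function_square_integrable[OF test_function_partial[OF assms(1)] assms(2)])

lemma test_function_has_L2_gradient:
  fixes \<psi> :: "'a::euclidean_space \<Rightarrow> real"
  assumes \<psi>: "\<psi> \<in> test_functions \<Omega>" and l\<Omega>: "\<Omega> \<in> lmeasurable"
  shows "has_L2_gradient \<Omega> \<psi> (grad \<psi>)"
  using grad_square_integrable[OF assms]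
    test_function_integration_by_parts_on[OF \<psi> test_functions_UNIV _ fmeasurableD[OF l\<Omega>]]
  by (auto simp: has_L2_gradient_def)

lemma weak_grad_has_L2_gradient: "has_L2_gradient \<Omega> v g \<Longrightarrow> has_L2_gradient \<Omega> v (weak_grad \<Omega> v)"
  using someI[of "has_L2_gradient \<Omega> v" g] by (simp add: weak_grad_def)

lemma weak_grad_AE:
  assumes "open \<Omega>" "bounded \<Omega>" "has_L2_gradient \<Omega> v g"
  shows "AE x in lebesgue_on \<Omega>. weak_grad \<Omega> v x = g x"
  by (rule has_L2_gradient_unique[OF assms(1,2) weak_grad_has_L2_gradient assms(3)]) (rule assms(3))

text \<open>\<open>H1_norm\<close> refers to the chosen \<open>weak_grad\<close>; uniqueness almost
  everywhere allows any weak gradient in its place.\<close>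

lemma H1_norm_eq:
  assumes \<Omega>: "open \<Omega>" "bounded \<Omega>" and g: "has_L2_gradient \<Omega> v g"
  shows "H1_norm \<Omega> v = sqrt (L2_inner \<Omega> v v + L2_inner \<Omega> g g)"
proof -
  have "square_integrable \<Omega> g" "square_integrable \<Omega> (weak_grad \<Omega> v)"
    using g weak_grad_has_L2_gradient[OF g] by (auto simp: has_L2_gradient_def)
  then have "L2_inner \<Omega> (weak_grad \<Omega> v) (weak_grad \<Omega> v) = L2_inner \<Omega> g g"
    using weak_grad_AE[OF assms] by (intro L2_inner_cong_AE)
  then show ?thesis by (simp add: H1_norm_def)
qed

lemma has_L2_gradient_diff_test_function:
  assumes "\<Omega> \<in> lmeasurable" "square_integrable \<Omega> v" "has_L2_gradient \<Omega> v g" "\<psi> \<in> test_functions \<Omega>"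
  shows "has_L2_gradient \<Omega> (\<lambda>x. v x - \<psi> x) (\<lambda>x. g x - grad \<psi> x)"
  using has_L2_gradient_add[OF assms(1,2) square_integrable_mult[OF test_function_square_integrable[OF assms(4,1)]]
      assms(3) has_L2_gradient_mult[OF test_function_has_L2_gradient[OF assms(4,1)]], of "-1"]
  by simp

text \<open>The form in which zero boundary values are used: no boundary term occurs although
  \<open>\<xi>\<close> need not vanish on the boundary. The defect \<open>X\<close> is bounded by
  the \<open>H1\<close> norm and is zero for test functions in \<open>\<Omega>\<close>, which
  approximate \<open>v\<close>.\<close>

lemma H1_0_integration_by_parts:
  assumes \<Omega>: "open \<Omega>" "bounded \<Omega>" and v: "v \<in> H1_0 \<Omega>" and g: "has_L2_gradient \<Omega> v g"
    and \<xi>: "\<xi> \<in> test_functions UNIV" and b: "b \<in> Basis"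
  shows "(LINT x|lebesgue_on \<Omega>. v x * frechet_derivative \<xi> (at x) b) =
    - (LINT x|lebesgue_on \<Omega>. (g x \<bullet> b) * \<xi> x)"
proof -
  have l\<Omega>: "\<Omega> \<in> lmeasurable" using \<Omega> by (simp add: bounded_set_imp_lmeasurable)
  have sv: "square_integrable \<Omega> v" using v by (simp add: H1_0_def H1_def)
  have sg: "square_integrable \<Omega> g" using g by (simp add: has_L2_gradient_def)
  define D where "D = (\<lambda>x. frechet_derivative \<xi> (at x) b)"
  define X where "X = (LINT x|lebesgue_on \<Omega>. v x * D x) + (LINT x|lebesgue_on \<Omega>. (g x \<bullet> b) * \<xi> x)"
  obtain M1 where M1: "M1 > 0" "\<And>x. \<bar>D x\<bar> \<le> M1"
    unfolding D_def using test_function_bounded[OF test_function_partial[OF \<xi> b]] by blast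
  obtain M2 where M2: "M2 > 0" "\<And>x. \<bar>\<xi> x\<bar> \<le> M2"
    using test_function_bounded[OF \<xi>] by blast
  have mD: "D \<in> borel_measurable (lebesgue_on \<Omega>)" "\<xi> \<in> borel_measurable (lebesgue_on \<Omega>)"
    unfolding D_def using test_function_continuous[OF test_function_partial[OF \<xi> b]] test_function_continuous[OF \<xi>]
    by (auto intro: measurable_lebesgue_on continuous_imp_measurable_lebesgue)
  have bound: "\<bar>LINT x|lebesgue_on \<Omega>. w x * F x\<bar> \<le> M * (e * (1 + measure lebesgue \<Omega>))"
    if w: "square_integrable \<Omega> w" "L2_inner \<Omega> w w \<le> e\<^sup>2" and e: "e > 0" and M: "M > 0" "\<And>x. \<bar>F x\<bar> \<le> M"
      and F: "F \<in> borel_measurable (lebesgue_on \<Omega>)" for w F :: "'a \<Rightarrow> real" and M e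
  proof -
    note iw = square_integrable_integrable[OF w(1) l\<Omega>]
    have "\<bar>LINT x|lebesgue_on \<Omega>. w x * F x\<bar> \<le> (LINT x|lebesgue_on \<Omega>. \<bar>w x * F x\<bar>)"
      by (rule integral_abs_bound)
    also have "\<dots> \<le> (LINT x|lebesgue_on \<Omega>. M * \<bar>w x\<bar>)"
    proof (rule integral_mono)
      show "integrable (lebesgue_on \<Omega>) (\<lambda>x. \<bar>w x * F x\<bar>)"
        using integrable_mult_bounded[OF iw F M(2)] by simp
      show "\<bar>w x * F x\<bar> \<le> M * \<bar>w x\<bar>" for x
        using mult_left_mono[OF M(2)[of x], of "\<bar>w x\<bar>"] by (simp add: abs_mult mult.commute)
    qed (use iw in auto)
    also have "\<dots> = M * (LINT x|lebesgue_on \<Omega>. \<bar>w x\<bar>)" by simp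
    also have "\<dots> \<le> M * (e * (1 + measure lebesgue \<Omega>))"
      using integral_abs_le_L2[OF w(1) l\<Omega> w(2) e] M by (intro mult_left_mono) auto
    finally show ?thesis .
  qed
  \<comment> \<open>Subtracting a test function \<open>\<psi>\<close> does not change the defect, so
    it can be estimated by the small remainder \<open>w\<close> and its gradient
    \<open>k\<close>.\<close>
  have X: "\<bar>X\<bar> \<le> e * ((M1 + M2) * (1 + measure lebesgue \<Omega>))" if e: "e > 0" for e
  proof -
    obtain \<psi> where \<psi>: "\<psi> \<in> test_functions \<Omega>" and small: "H1_norm \<Omega> (\<lambda>x. v x - \<psi> x) < e"
      using v e by (auto simp: H1_0_def)
    note s\<psi> = test_function_square_integrable[OF \<psi> l\<Omega>]
    define w where "w = (\<lambda>x. v x - \<psi> x)"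
    define k where "k = (\<lambda>x. g x - grad \<psi> x)"
    have gw: "has_L2_gradient \<Omega> w k"
      unfolding w_def k_def by (rule has_L2_gradient_diff_test_function[OF l\<Omega> sv g \<psi>])
    have sw: "square_integrable \<Omega> w" unfolding w_def by (rule square_integrable_diff[OF sv s\<psi>])
    have sk: "square_integrable \<Omega> k" using gw by (simp add: has_L2_gradient_def)
    have "sqrt (L2_inner \<Omega> w w + L2_inner \<Omega> k k) < e"
      using small H1_norm_eq[OF \<Omega> gw] by (simp add: w_def)
    then have "L2_inner \<Omega> w w + L2_inner \<Omega> k k \<le> e\<^sup>2"
      using e by (metis less_imp_le real_le_rsqrt real_sqrt_le_iff real_sqrt_unique)
    then have small': "L2_inner \<Omega> w w \<le> e\<^sup>2" "L2_inner \<Omega> k k \<le> e\<^sup>2"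
      using L2_inner_nonneg[of \<Omega> w] L2_inner_nonneg[of \<Omega> k] by linarith+
    have skb: "square_integrable \<Omega> (\<lambda>x. k x \<bullet> b)" by (rule square_integrable_component[OF sk])
    have "L2_inner \<Omega> (\<lambda>x. k x \<bullet> b) (\<lambda>x. k x \<bullet> b) \<le> L2_inner \<Omega> k k"
      unfolding L2_inner_def
    proof (rule integral_mono)
      show "(k x \<bullet> b) \<bullet> (k x \<bullet> b) \<le> k x \<bullet> k x" for x
        using Cauchy_Schwarz_ineq[of "k x" b] b by (simp add: power2_eq_square)
    qed (use square_integrable_inner[OF sk sk] square_integrable_inner[OF skb skb] in auto)
    with small'(2) have small'': "L2_inner \<Omega> (\<lambda>x. k x \<bullet> b) (\<lambda>x. k x \<bullet> b) \<le> e\<^sup>2" by linarith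
    have i: "integrable (lebesgue_on \<Omega>) (\<lambda>x. f x * D x)" "integrable (lebesgue_on \<Omega>) (\<lambda>x. f x * \<xi> x)"
      if "square_integrable \<Omega> f" for f :: "'a \<Rightarrow> real"
      using integrable_mult_bounded[OF square_integrable_integrable[OF that l\<Omega>]] mD M1 M2 by blast+
    have sgb: "square_integrable \<Omega> (\<lambda>x. grad \<psi> x \<bullet> b)"
      by (rule square_integrable_component[OF grad_square_integrable[OF \<psi> l\<Omega>]])
    have "(LINT x|lebesgue_on \<Omega>. v x * D x) = (LINT x|lebesgue_on \<Omega>. w x * D x) + (LINT x|lebesgue_on \<Omega>. \<psi> x * D x)"
      using i[OF sv] i[OF s\<psi>] by (simp add: w_def left_diff_distrib)
    moreover have "(LINT x|lebesgue_on \<Omega>. (g x \<bullet> b) * \<xi> x) =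
      (LINT x|lebesgue_on \<Omega>. (k x \<bullet> b) * \<xi> x) + (LINT x|lebesgue_on \<Omega>. (grad \<psi> x \<bullet> b) * \<xi> x)"
      using i[OF square_integrable_component[OF sg]] i[OF sgb] by (simp add: k_def inner_diff_left left_diff_distrib)
    moreover have "(LINT x|lebesgue_on \<Omega>. \<psi> x * D x) = - (LINT x|lebesgue_on \<Omega>. (grad \<psi> x \<bullet> b) * \<xi> x)"
      unfolding D_def by (rule test_function_integration_by_parts_on[OF \<psi> \<xi> b fmeasurableD[OF l\<Omega>]])
    ultimately have "X = (LINT x|lebesgue_on \<Omega>. w x * D x) + (LINT x|lebesgue_on \<Omega>. (k x \<bullet> b) * \<xi> x)"
      by (simp add: X_def)
    also have "\<bar>\<dots>\<bar> \<le> M1 * (e * (1 + measure lebesgue \<Omega>)) + M2 * (e * (1 + measure lebesgue \<Omega>))"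
      using bound[OF sw small'(1) e M1 mD(1)] bound[OF skb small'' e M2 mD(2)] by linarith
    finally show ?thesis by (simp add: algebra_simps)
  qed
  have "X = 0"
  proof (rule ccontr)
    assume "X \<noteq> 0"
    \<comment> \<open>With \<open>e\<close> equal to \<open>\<bar>X\<bar> / (2 * K)\<close> the
      estimate reads \<open>\<bar>X\<bar> \<le> \<bar>X\<bar> / 2\<close>.\<close>
    define K where "K = (M1 + M2) * (1 + measure lebesgue \<Omega>)"
    have K: "K > 0" unfolding K_def using M1(1) M2(1) by (intro mult_pos_pos) (auto intro: add_pos_nonneg)
    show False
      using X[of "\<bar>X\<bar> / (2 * K)"] \<open>X \<noteq> 0\<close> K by (simp add: K_def[symmetric])
  qed
  then show ?thesis by (simp add: X_def D_def)
qed

subsection \<open>Mollified Lipschitz and affine functions\<close>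

text \<open>With the kernel centred at the origin, a change of \<open>x\<close> acts on
  \<open>f\<close> alone.\<close>

lemma mollify_eq_translate:
  assumes \<delta>: "\<delta> > 0" and f: "continuous_on UNIV f"
  shows "mollify \<delta> f x = (LINT y|lebesgue. f (y + x) * mollifier \<delta> y)"
    "integrable lebesgue (\<lambda>y. f (y + x) * mollifier \<delta> y)"
proof -
  have c: "continuous_on UNIV (\<lambda>y. f y * mollifier \<delta> (x - y))"
    by (intro continuous_on_mult f continuous_on_compose2[OF mollifier_continuous[OF \<delta>]] continuous_intros) auto
  show "mollify \<delta> f x = (LINT y|lebesgue. f (y + x) * mollifier \<delta> y)"
    unfolding mollify_def using integral_translate[OF c, of x] by (simp add: mollifier_minus)
  show "integrable lebesgue (\<lambda>y. f (y + x) * mollifier \<delta> y)"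
  proof (rule continuous_compact_support_integrable)
    show "continuous_on UNIV (\<lambda>y. f (y + x) * mollifier \<delta> y)"
      by (rule continuous_on_mult[OF continuous_on_compose2[OF f] mollifier_continuous[OF \<delta>]])
         (auto intro: continuous_intros)
    have "bounded {y::'a. mollifier \<delta> y \<noteq> 0}"
      using mollifier_test_function[OF \<delta>, where 'a='a] by (simp add: test_functions_UNIV_iff)
    then show "bounded {y. f (y + x) * mollifier \<delta> y \<noteq> 0}"
      by (rule bounded_subset) auto
  qed
qed

text \<open>The mollification is an average of translates of \<open>f\<close>, which share its
  Lipschitz constant.\<close>

lemma mollify_Lipschitz:
  assumes \<delta>: "\<delta> > 0" and L: "L \<ge> 0" "\<And>x y. \<bar>f x - f y\<bar> \<le> L * norm (x - y)"
  shows "\<bar>mollify \<delta> f x - mollify \<delta> f y\<bar> \<le> L * norm (x - y)"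
proof -
  have f: "continuous_on UNIV f"
    using L lipschitz_on_continuous_on[of L UNIV f] by (auto simp: lipschitz_on_def dist_norm)
  note t = mollify_eq_translate[OF \<delta> f]
  note K = mollifier_integrable[OF \<delta>, where 'a='a] mollifier_integral[OF \<delta>, where 'a='a]
  have "\<bar>mollify \<delta> f x - mollify \<delta> f y\<bar> = \<bar>LINT z|lebesgue. (f (z + x) - f (z + y)) * mollifier \<delta> z\<bar>"
    using t(2) by (simp add: t(1) left_diff_distrib)
  also have "\<dots> \<le> (LINT z|lebesgue. \<bar>(f (z + x) - f (z + y)) * mollifier \<delta> z\<bar>)"
    by (rule integral_abs_bound)
  also have "\<dots> \<le> (LINT z|lebesgue. L * norm (x - y) * mollifier \<delta> (z::'a))"
  proof (rule integral_mono)
    show "integrable lebesgue (\<lambda>z. \<bar>(f (z + x) - f (z + y)) * mollifier \<delta> z\<bar>)"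
      using t(2) by (simp add: left_diff_distrib)
    show "\<bar>(f (z + x) - f (z + y)) * mollifier \<delta> z\<bar> \<le> L * norm (x - y) * mollifier \<delta> z" for z
      using mult_right_mono[OF L(2)[of "z + x" "z + y"] mollifier_nonneg[of \<delta> z]]
      by (simp add: abs_mult mollifier_nonneg)
  qed (use K in auto)
  finally show ?thesis using K by simp
qed

text \<open>Around \<open>x\<close> an affine function is its value at \<open>x\<close> plus an odd
  part, and the even kernel averages the odd part to zero. Only the values of \<open>f\<close>
  within distance \<open>\<delta>\<close> matter, so \<open>f\<close> need be affine only
  there.\<close>

lemma mollify_affine:
  assumes \<delta>: "\<delta> > 0" and f: "\<And>y. norm (y - x) < \<delta> \<Longrightarrow> f y = g \<bullet> y + c"
  shows "mollify \<delta> f x = g \<bullet> x + c"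
proof -
  note K = mollifier_integrable[OF \<delta>, where 'a='a] mollifier_integral[OF \<delta>, where 'a='a]
  have 0: "continuous_on UNIV (\<lambda>y. (g \<bullet> y) * mollifier \<delta> y)"
    by (intro continuous_intros mollifier_continuous[OF \<delta>])
  \<comment> \<open>Reflection changes the sign of the integrand, so the integral equals its own
    negative.\<close>
  have odd: "(LINT y|lebesgue. (g \<bullet> y) * mollifier \<delta> y) = 0"
    using integral_reflect[OF 0] by (simp add: mollifier_minus)
  have i: "integrable lebesgue (\<lambda>y. (g \<bullet> y) * mollifier \<delta> y)"
    using mollify_eq_translate(2)[OF \<delta>, of "\<lambda>y. g \<bullet> y" 0] by (simp add: continuous_intros)
  have "f y * mollifier \<delta> (x - y) = (g \<bullet> y + c) * mollifier \<delta> (x - y)" for y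
    using f[of y] mollifier_eq_0[OF \<delta>, of "x - y"] by (cases "norm (y - x) < \<delta>") (auto simp: norm_minus_commute)
  then have "mollify \<delta> f x = mollify \<delta> (\<lambda>y. g \<bullet> y + c) x"
    by (simp only: mollify_def)
  also have "\<dots> = (LINT y|lebesgue. (g \<bullet> (y + x) + c) * mollifier \<delta> y)"
    by (rule mollify_eq_translate[OF \<delta>]) (intro continuous_intros)
  also have "\<dots> = (LINT y|lebesgue. (g \<bullet> y) * mollifier \<delta> y + (g \<bullet> x + c) * mollifier \<delta> y)"
    by (simp add: inner_add_right algebra_simps)
  also have "\<dots> = g \<bullet> x + c"
    using K i odd by simp
  finally show ?thesis .
qed

lemma linear_bound_Basis:
  fixes D :: "'a::euclidean_space \<Rightarrow> real"
  assumes "linear D" "\<And>b. b \<in> Basis \<Longrightarrow> \<bar>D b\<bar> \<le> M"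
  shows "\<bar>D h\<bar> \<le> real DIM('a) * M * norm h"
proof -
  have "D h = D (\<Sum>b\<in>Basis. (h \<bullet> b) *\<^sub>R b)" by (simp add: euclidean_representation)
  also have "\<dots> = (\<Sum>b\<in>Basis. (h \<bullet> b) * D b)"
    by (simp add: linear_sum[OF assms(1)] linear_cmul[OF assms(1)])
  also have "\<bar>\<dots>\<bar> \<le> (\<Sum>b\<in>(Basis::'a set). norm h * M)"
    by (intro order_trans[OF sum_abs] sum_mono)
       (auto simp: abs_mult Basis_le_norm intro!: mult_mono assms)
  finally show ?thesis by (simp add: mult_ac)
qed

lemma Lipschitz_derivative_bound:
  fixes w :: "'a::real_normed_vector \<Rightarrow> real"
  assumes "(w has_derivative D) (at x)" "\<And>x y. \<bar>w x - w y\<bar> \<le> M * norm (x - y)"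
  shows "\<bar>D b\<bar> \<le> M * norm b"
proof -
  have "((\<lambda>t. (w (x + t *\<^sub>R b) - w x) / t) \<longlongrightarrow> D b) (at 0)"
    by (rule has_derivative_directional_quotient[OF assms(1)])
  then have "((\<lambda>t. \<bar>(w (x + t *\<^sub>R b) - w x) / t\<bar>) \<longlongrightarrow> \<bar>D b\<bar>) (at 0)"
    by (rule tendsto_rabs)
  moreover have "\<bar>(w (x + t *\<^sub>R b) - w x) / t\<bar> \<le> M * norm b" if "t \<noteq> 0" for t
    using assms(2)[of "x + t *\<^sub>R b" x] that by (simp add: divide_le_eq abs_divide mult_ac)
  then have "\<forall>\<^sub>F t in at 0. \<bar>(w (x + t *\<^sub>R b) - w x) / t\<bar> \<le> M * norm b"
    by (auto simp: eventually_at intro: exI[of _ 1])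
  ultimately show ?thesis
    by (rule tendsto_upperbound) simp
qed

text \<open>Approach \<open>z\<close> from both sets: the right-hand side tends to zero. It is
  applied to the affine formulas of two touching elements, and to one such formula against zero
  outside the domain.\<close>

lemma eq_on_common_closure:
  fixes f g :: "'a::euclidean_space \<Rightarrow> real"
  assumes "continuous_on UNIV f" "continuous_on UNIV g"
    and "\<And>x y. x \<in> A \<Longrightarrow> y \<in> B \<Longrightarrow> \<bar>f x - g y\<bar> \<le> M * norm (x - y)"
    and "z \<in> closure A" "z \<in> closure B"
  shows "f z = g z"
proof -
  obtain a b where a: "\<And>n. a n \<in> A" "a \<longlonglongrightarrow> z" and b: "\<And>n. b n \<in> B" "b \<longlonglongrightarrow> z"
    using assms(4,5) unfolding closure_sequential by blast
  have "(\<lambda>n. \<bar>f (a n) - g (b n)\<bar>) \<longlonglongrightarrow> \<bar>f z - g z\<bar>"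
    using assms(1,2) by (intro tendsto_intros)
      (auto intro!: continuous_on_tendsto_compose[OF _ a(2)] continuous_on_tendsto_compose[OF _ b(2)])
  moreover have "(\<lambda>n. M * norm (a n - b n)) \<longlonglongrightarrow> M * norm (z - z)"
    by (intro tendsto_intros a b)
  ultimately have "\<bar>f z - g z\<bar> \<le> M * norm (z - z)"
    using assms(3) a(1) b(1) by (intro LIMSEQ_le) auto
  then show ?thesis by simp
qed

subsection \<open>Continuous piecewise affine functions\<close>

text \<open>A normal form for finite element functions with values fixed at every point. Continuity
  is implicit: the affine formulas hold on closed elements, which overlap in common faces, and
  boundary points of the open domain count as outside.\<close>

definition piecewise_affine :: "'a::euclidean_space set \<Rightarrow> 'a set set \<Rightarrow> ('a \<Rightarrow> real) \<Rightarrow> bool" where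
  "piecewise_affine \<Omega> \<T> u \<longleftrightarrow>
     (\<forall>x. x \<notin> \<Omega> \<longrightarrow> u x = 0) \<and> (\<forall>\<tau>\<in>\<T>. \<exists>g c. \<forall>x\<in>closure \<tau>. u x = g \<bullet> x + c)"

locale mesh =
  fixes \<Omega> :: "'a::euclidean_space set" and \<T> :: "'a set set"
  assumes domain: "polyhedral_convex_domain \<Omega>" and mesh: "triangulation_of \<Omega> \<T>"
begin

lemma open_domain: "open \<Omega>" and domain_nonempty: "\<Omega> \<noteq> {}" and bounded_domain: "bounded \<Omega>"
  and convex_domain: "convex \<Omega>"
  using domain by (auto simp: polyhedral_convex_domain_def)

lemma lmeasurable_domain: "\<Omega> \<in> lmeasurable"
  using open_domain bounded_domain by (simp add: bounded_set_imp_lmeasurable)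

lemma sets_domain: "\<Omega> \<in> sets lebesgue"
  using lmeasurable_domain by (rule fmeasurableD)

lemma interior_closure_domain: "interior (closure \<Omega>) = \<Omega>"
  using convex_interior_closure[OF convex_domain] open_domain by (simp add: interior_open)

lemma finite_mesh: "finite \<T>"
  using mesh by (simp add: triangulation_of_def)

lemma closure_domain: "closure \<Omega> = (\<Union>\<tau>\<in>\<T>. closure \<tau>)"
  using mesh by (simp add: triangulation_of_def)

text \<open>Full dimension makes the interior of the simplex nonempty, so its closure gives the
  simplex back; affine independence then identifies the extreme points with the spanning
  points.\<close>

lemma element_simplex:
  assumes "\<tau> \<in> \<T>"
  shows "closure \<tau> = convex hull (vertices \<tau>)" "\<not> affine_dependent (vertices \<tau>)"
    "card (vertices \<tau>) = Suc DIM('a)" "\<tau> = interior (closure \<tau>)" "\<tau> \<noteq> {}"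
proof -
  obtain S where S: "int DIM('a) simplex S" "\<tau> = interior S"
    using mesh assms by (auto simp: triangulation_of_def open_simplex_def)
  then obtain C where C: "\<not> affine_dependent C" "card C = Suc DIM('a)" "S = convex hull C"
    by (auto simp: simplex_def)
  have ne: "interior S \<noteq> {}"
    using interior_convex_hull_eq_empty[OF C(2)] C by simp
  have "finite C" using C(1) aff_independent_finite by blast
  then have "closed S" using C(3) by (simp add: finite_imp_compact_convex_hull compact_imp_closed)
  then have cl: "closure \<tau> = S"
    using convex_closure_interior[of S] ne C(3) S(2) by (simp add: convex_convex_hull)
  have v: "vertices \<tau> = C"
    using C(1,3) cl by (auto simp: vertices_def extreme_point_of_convex_hull_affine_independent)
  show "closure \<tau> = convex hull (vertices \<tau>)" "\<not> affine_dependent (vertices \<tau>)"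
    "card (vertices \<tau>) = Suc DIM('a)" "\<tau> = interior (closure \<tau>)" "\<tau> \<noteq> {}"
    using cl C v S(2) ne by auto
qed

lemma finite_vertices: "\<tau> \<in> \<T> \<Longrightarrow> finite (vertices \<tau>)"
  using element_simplex(2) aff_independent_finite by blast

lemma open_element: "\<tau> \<in> \<T> \<Longrightarrow> open \<tau>"
  using element_simplex(4) open_interior by metis

lemma closure_element_subset: "\<tau> \<in> \<T> \<Longrightarrow> closure \<tau> \<subseteq> closure \<Omega>"
  using closure_domain by auto

lemma element_subset: "\<tau> \<in> \<T> \<Longrightarrow> \<tau> \<subseteq> \<Omega>"
  using closure_element_subset[of \<tau>] interior_closure_domain element_simplex(4)[of \<tau>] interior_mono by metis

lemma bounded_element: "\<tau> \<in> \<T> \<Longrightarrow> bounded \<tau>"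
  using element_subset bounded_domain bounded_subset by blast

lemma convex_closure_element: "\<tau> \<in> \<T> \<Longrightarrow> convex (closure \<tau>)"
  using element_simplex(1) by (simp add: convex_convex_hull)

lemma lmeasurable_element: "\<tau> \<in> \<T> \<Longrightarrow> \<tau> \<in> lmeasurable"
  using open_element bounded_element by (simp add: bounded_set_imp_lmeasurable)

lemma sets_element: "\<tau> \<in> \<T> \<Longrightarrow> \<tau> \<in> sets lebesgue"
  using lmeasurable_element by (rule fmeasurableD)

lemma disjoint_elements: "\<tau> \<in> \<T> \<Longrightarrow> \<tau>' \<in> \<T> \<Longrightarrow> x \<in> \<tau> \<Longrightarrow> x \<in> \<tau>' \<Longrightarrow> \<tau> = \<tau>'"
  using mesh by (auto simp: triangulation_of_def pairwise_def disjnt_def)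

lemma negligible_element_boundary: "\<tau> \<in> \<T> \<Longrightarrow> negligible (closure \<tau> - \<tau>)"
  using negligible_convex_frontier[OF convex_closure_element[of \<tau>]] element_simplex(4)[of \<tau>]
  by (simp add: frontier_def)

lemma AE_element: "AE x in lebesgue. x \<in> closure \<Omega> \<longrightarrow> (\<exists>\<tau>\<in>\<T>. x \<in> \<tau>)"
proof -
  have "negligible (\<Union>\<tau>\<in>\<T>. closure \<tau> - \<tau>)"
    using finite_mesh negligible_element_boundary by (intro negligible_Union) auto
  then have "AE x in lebesgue. x \<notin> (\<Union>\<tau>\<in>\<T>. closure \<tau> - \<tau>)"
    unfolding negligible_iff_null_sets by (rule AE_not_in)
  then show ?thesis
    by eventually_elim (auto simp: closure_domain)
qed

text \<open>The elements cover the domain up to finitely many null boundaries, so almost-everywhere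
  statements can be checked on one element at a time.\<close>

lemma AE_on_elements:
  assumes "\<And>\<tau>. \<tau> \<in> \<T> \<Longrightarrow> AE x in lebesgue_on \<tau>. P x"
  shows "AE x in lebesgue_on \<Omega>. P x"
proof -
  have "AE x in lebesgue. \<forall>\<tau>\<in>\<T>. x \<in> \<tau> \<longrightarrow> P x"
    using assms by (intro AE_finite_allI finite_mesh) (simp add: AE_lebesgue_on_iff[OF sets_element])
  with AE_element have "AE x in lebesgue. x \<in> \<Omega> \<longrightarrow> P x"
    by eventually_elim (use closure_subset in blast)
  then show ?thesis by (simp add: AE_lebesgue_on_iff[OF sets_domain])
qed

text \<open>The first hypothesis makes the choice of an element containing \<open>x\<close>
  irrelevant; the second reconciles the pieces with the value zero at points of closed elements on
  the boundary of the domain.\<close>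

lemma piecewise_affine_glue:
  assumes "\<And>\<tau> \<tau>' x. \<lbrakk>\<tau> \<in> \<T>; \<tau>' \<in> \<T>; x \<in> closure \<tau>; x \<in> closure \<tau>'\<rbrakk> \<Longrightarrow> G \<tau> \<bullet> x + c \<tau> = G \<tau>' \<bullet> x + c \<tau>'"
    and "\<And>\<tau> x. \<lbrakk>\<tau> \<in> \<T>; x \<in> closure \<tau>; x \<notin> \<Omega>\<rbrakk> \<Longrightarrow> G \<tau> \<bullet> x + c \<tau> = 0"
  shows "\<exists>u. piecewise_affine \<Omega> \<T> u \<and> (\<forall>\<tau>\<in>\<T>. \<forall>x\<in>closure \<tau>. u x = G \<tau> \<bullet> x + c \<tau>)"
proof -
  define s where "s = (\<lambda>x. SOME \<tau>. \<tau> \<in> \<T> \<and> x \<in> closure \<tau>)"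
  have s: "s x \<in> \<T> \<and> x \<in> closure (s x)" if "x \<in> \<Omega>" for x
  proof -
    have "\<exists>\<tau>. \<tau> \<in> \<T> \<and> x \<in> closure \<tau>" using that closure_subset closure_domain by blast
    then show ?thesis unfolding s_def by (rule someI_ex)
  qed
  define u where "u = (\<lambda>x. if x \<in> \<Omega> then G (s x) \<bullet> x + c (s x) else 0)"
  have u: "u x = G \<tau> \<bullet> x + c \<tau>" if "\<tau> \<in> \<T>" "x \<in> closure \<tau>" for \<tau> x
    using assms(1)[of "s x" \<tau> x] assms(2)[OF that] s[of x] that by (auto simp: u_def)
  then have "piecewise_affine \<Omega> \<T> u"
    unfolding piecewise_affine_def by (auto simp: u_def)
  with u show ?thesis by blast
qed

lemma piecewise_affine_eqI:
  assumes "piecewise_affine \<Omega> \<T> u" "piecewise_affine \<Omega> \<T> v" "\<And>\<tau> x. \<tau> \<in> \<T> \<Longrightarrow> x \<in> closure \<tau> \<Longrightarrow> u x = v x"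
  shows "u = v"
proof
  fix x show "u x = v x"
    using assms closure_domain closure_subset[of \<Omega>] by (cases "x \<in> \<Omega>") (auto simp: piecewise_affine_def)
qed

end

text \<open>A piecewise affine function together with a choice of its coefficients, so that a
  gradient can be written down.\<close>

locale mesh_function = mesh \<Omega> \<T> for \<Omega> :: "'a::euclidean_space set" and \<T> +
  fixes u :: "'a \<Rightarrow> real" and G :: "'a set \<Rightarrow> 'a" and c :: "'a set \<Rightarrow> real"
  assumes outside: "\<And>x. x \<notin> \<Omega> \<Longrightarrow> u x = 0"
    and affine: "\<And>\<tau> x. \<tau> \<in> \<T> \<Longrightarrow> x \<in> closure \<tau> \<Longrightarrow> u x = G \<tau> \<bullet> x + c \<tau>"
begin

text \<open>A sum instead of a maximum, since any common bound for the element gradients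
  serves.\<close>

definition L where "L = (\<Sum>\<tau>\<in>\<T>. norm (G \<tau>))"

lemma L_nonneg: "0 \<le> L" by (simp add: L_def sum_nonneg)

lemma norm_G_le: "\<tau> \<in> \<T> \<Longrightarrow> norm (G \<tau>) \<le> L"
  unfolding L_def by (rule member_le_sum) (use finite_mesh in auto)

text \<open>Along a segment the function is Lipschitz on each of finitely many closed pieces.\<close>

lemma Lipschitz: "\<bar>u x - u y\<bar> \<le> L * norm (x - y)"
proof -
  define p where "p = (\<lambda>s::real. y + s *\<^sub>R (x - y))"
  have p: "continuous_on UNIV p" unfolding p_def by (intro continuous_intros)
  \<comment> \<open>The index \<open>None\<close> stands for the closed complement of the domain,
    where \<open>u\<close> is zero, and \<open>Some \<tau>\<close> for a closed element.\<close>
  define U where "U = (\<lambda>i. case i of None \<Rightarrow> p -` (- \<Omega>) | Some \<tau> \<Rightarrow> p -` closure \<tau>)"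
  have "lipschitz_on (L * norm (x - y)) {0..1} (\<lambda>s. u (p s))"
  proof (rule lipschitz_on_closed_Union[where I = "insert None (Some ` \<T>)" and U = U])
    fix i assume i: "i \<in> insert None (Some ` \<T>)"
    show "closed (U i)"
    proof (cases i)
      case None
      then show ?thesis using open_domain p by (auto simp: U_def intro!: closed_vimage continuous_on_subset)
    next
      case (Some \<tau>)
      then show ?thesis using p by (auto simp: U_def intro!: closed_vimage)
    qed
    show "lipschitz_on (L * norm (x - y)) (U i) (\<lambda>s. u (p s))"
    proof (cases i)
      case None
      then show ?thesis using outside L_nonneg by (auto simp: U_def lipschitz_on_def)
    next
      case (Some \<tau>)
      then have \<tau>: "\<tau> \<in> \<T>" using i by auto
      show ?thesis
      proof (rule lipschitz_onI)
        fix s t assume st: "s \<in> U i" "t \<in> U i"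
        then have "u (p s) - u (p t) = G \<tau> \<bullet> (p s - p t)"
          using affine[OF \<tau>] Some by (simp add: U_def inner_diff_right)
        also have "\<dots> = (s - t) * (G \<tau> \<bullet> (x - y))"
          by (simp add: p_def algebra_simps inner_diff_right)
        also have "\<bar>\<dots>\<bar> \<le> \<bar>s - t\<bar> * (L * norm (x - y))"
          unfolding abs_mult using Cauchy_Schwarz_ineq2[of "G \<tau>" "x - y"] mult_right_mono[OF norm_G_le[OF \<tau>], of "norm (x - y)"]
          by (intro mult_left_mono) auto
        finally show "dist (u (p s)) (u (p t)) \<le> L * norm (x - y) * dist s t"
          by (simp add: dist_real_def mult.commute)
      qed (simp add: L_nonneg)
    qed
  next
    show "{0..1} \<subseteq> (\<Union>i\<in>insert None (Some ` \<T>). U i)"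
      using closure_domain closure_subset[of \<Omega>] by (auto simp: U_def subset_iff)
  qed (use finite_mesh L_nonneg in auto)
  then have "dist (u (p 1)) (u (p 0)) \<le> L * norm (x - y) * dist 1 (0::real)"
    by (rule lipschitz_onD) auto
  then show ?thesis by (simp add: p_def dist_real_def)
qed

lemma continuous: "continuous_on UNIV u"
  using Lipschitz L_nonneg lipschitz_on_continuous_on[of L UNIV u] by (auto simp: lipschitz_on_def dist_norm)

text \<open>At most one term is nonzero because the open elements are disjoint. On the element
  boundaries, a null set, the value is zero.\<close>

definition pgrad where "pgrad x = (\<Sum>\<tau>\<in>\<T>. indicator \<tau> x *\<^sub>R G \<tau>)"

lemma pgrad_element:
  assumes "\<tau> \<in> \<T>" "x \<in> \<tau>"
  shows "pgrad x = G \<tau>"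
proof -
  have "indicator \<tau>' x *\<^sub>R G \<tau>' = (if \<tau>' = \<tau> then G \<tau> else 0)" if "\<tau>' \<in> \<T>" for \<tau>'
    using disjoint_elements[OF assms(1) that assms(2)] assms(2) by (cases "x \<in> \<tau>'") auto
  then have "pgrad x = (\<Sum>\<tau>'\<in>\<T>. if \<tau>' = \<tau> then G \<tau> else 0)"
    unfolding pgrad_def by (intro sum.cong) auto
  then show ?thesis using assms finite_mesh by simp
qed

lemma pgrad_outside: "x \<notin> \<Omega> \<Longrightarrow> pgrad x = 0"
  unfolding pgrad_def using element_subset by (intro sum.neutral) (auto simp: indicator_def)

lemma pgrad_measurable: "pgrad \<in> borel_measurable lebesgue"
  unfolding pgrad_def[abs_def]
  by (intro borel_measurable_sum borel_measurable_scaleR borel_measurable_indicator sets_element) auto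

lemma pgrad_bound: "norm (pgrad x) \<le> L"
proof (cases "\<exists>\<tau>\<in>\<T>. x \<in> \<tau>")
  case True
  then show ?thesis using pgrad_element norm_G_le by auto
next
  case False
  then have "pgrad x = 0" unfolding pgrad_def by (intro sum.neutral) (auto simp: indicator_def)
  then show ?thesis using L_nonneg by simp
qed

lemma pgrad_square_integrable: "square_integrable \<Omega> pgrad"
  by (rule bounded_square_integrable[OF measurable_lebesgue_on[OF pgrad_measurable] pgrad_bound lmeasurable_domain])

lemma bounded: obtains B where "\<And>x. \<bar>u x\<bar> \<le> B"
proof -
  have "compact (u ` closure \<Omega>)"
    using continuous bounded_domain by (auto intro!: compact_continuous_image intro: continuous_on_subset simp: compact_closure)
  then obtain B where B: "\<forall>y\<in>u ` closure \<Omega>. norm y \<le> B"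
    using compact_imp_bounded[of "u ` closure \<Omega>"] unfolding bounded_iff by blast
  have "\<bar>u x\<bar> \<le> max 0 B" for x
    using B outside[of x] closure_subset[of \<Omega>] by (cases "x \<in> \<Omega>") (auto simp: subset_iff le_max_iff_disj)
  then show ?thesis using that by blast
qed

lemma square_integrable_u: "square_integrable \<Omega> u"
proof -
  obtain B where "\<And>x. \<bar>u x\<bar> \<le> B" using bounded by blast
  then show ?thesis
    using continuous lmeasurable_domain
    by (intro bounded_square_integrable[of _ _ B] measurable_lebesgue_on continuous_imp_measurable_lebesgue) auto
qed

text \<open>Off the element boundaries a point lies in an open element or in the open exterior, and
  short steps stay there, so the quotient is eventually constant.\<close>

lemma pgrad_directional:
  "AE x in lebesgue. ((\<lambda>t. (u (x + t *\<^sub>R b) - u x) / t) \<longlongrightarrow> pgrad x \<bullet> b) (at 0)"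
  using AE_element
proof eventually_elim
  fix x assume x: "x \<in> closure \<Omega> \<longrightarrow> (\<exists>\<tau>\<in>\<T>. x \<in> \<tau>)"
  have near: "\<forall>\<^sub>F t in at 0. x + t *\<^sub>R b \<in> S" if "open S" "x \<in> S" for S
  proof -
    have "((\<lambda>t. x + t *\<^sub>R b) \<longlongrightarrow> x + 0 *\<^sub>R b) (at 0)" by (intro tendsto_intros)
    then show ?thesis using that by (auto dest: topological_tendstoD)
  qed
  show "((\<lambda>t. (u (x + t *\<^sub>R b) - u x) / t) \<longlongrightarrow> pgrad x \<bullet> b) (at 0)"
  proof (cases "x \<in> closure \<Omega>")
    case True
    then obtain \<tau> where \<tau>: "\<tau> \<in> \<T>" "x \<in> \<tau>" using x by blast
    have "\<forall>\<^sub>F t in at 0. pgrad x \<bullet> b = (u (x + t *\<^sub>R b) - u x) / t"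
      using near[OF open_element[OF \<tau>(1)] \<tau>(2)] eventually_neq_at_within[of 0 0 UNIV]
    proof eventually_elim
      fix t :: real assume "x + t *\<^sub>R b \<in> \<tau>" "t \<noteq> 0"
      then show "pgrad x \<bullet> b = (u (x + t *\<^sub>R b) - u x) / t"
        using affine[OF \<tau>(1)] closure_subset[of \<tau>] \<tau> pgrad_element[OF \<tau>]
        by (simp add: subset_iff inner_add_right)
    qed
    then show ?thesis by (rule Lim_transform_eventually[OF tendsto_const])
  next
    case False
    have 0: "x \<notin> \<Omega>" using False closure_subset by blast
    have "\<forall>\<^sub>F t in at 0. pgrad x \<bullet> b = (u (x + t *\<^sub>R b) - u x) / t"
      using near[of "- closure \<Omega>"] False outside[OF 0] pgrad_outside[OF 0] outside closure_subset[of \<Omega>]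
      by (auto elim!: eventually_mono simp: open_Compl subset_iff)
    then show ?thesis by (rule Lim_transform_eventually[OF tendsto_const])
  qed
qed

lemma has_L2_gradient_pgrad: "has_L2_gradient \<Omega> u pgrad"
  unfolding has_L2_gradient_def
proof (intro conjI ballI pgrad_square_integrable)
  fix \<psi> and b :: 'a assume \<psi>: "\<psi> \<in> test_functions \<Omega>" and b: "b \<in> Basis"
  have "(LINT x|lebesgue. u x * frechet_derivative \<psi> (at x) b) = - (LINT x|lebesgue. (pgrad x \<bullet> b) * \<psi> x)"
    by (rule Lipschitz_integration_by_parts[OF L_nonneg Lipschitz test_functions_UNIV[OF \<psi>] b _ pgrad_directional])
       (use pgrad_measurable in auto)
  then show "(LINT x|lebesgue_on \<Omega>. u x * frechet_derivative \<psi> (at x) b) = - (LINT x|lebesgue_on \<Omega>. (pgrad x \<bullet> b) * \<psi> x)"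
    by (simp add: lebesgue_on_integral_support[OF sets_domain] outside pgrad_outside)
qed

end

lemma dominated_convergence_const:
  fixes f :: "nat \<Rightarrow> 'a::euclidean_space \<Rightarrow> real"
  assumes "\<Omega> \<in> lmeasurable" "\<And>n. f n \<in> borel_measurable (lebesgue_on \<Omega>)"
    and "AE x in lebesgue_on \<Omega>. (\<lambda>n. f n x) \<longlonglongrightarrow> 0"
    and "\<And>n. AE x in lebesgue_on \<Omega>. \<bar>f n x\<bar> \<le> B"
  shows "(\<lambda>n. LINT x|lebesgue_on \<Omega>. f n x) \<longlonglongrightarrow> 0"
proof -
  have "(\<lambda>n. LINT x|lebesgue_on \<Omega>. f n x) \<longlonglongrightarrow> (LINT x|lebesgue_on \<Omega>. 0)"
    by (rule integral_dominated_convergence[where w = "\<lambda>x. B"])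
       (use assms integrable_const_lebesgue_on in auto)
  then show ?thesis by simp
qed

context mesh_function
begin

text \<open>Composing \<open>u\<close> with an expansion about \<open>x0\<close> pulls its support
  into the compact set \<open>C n\<close> inside the domain, which leaves room for mollification.
  The values converge with rate \<open>e n\<close>; for the gradients, convergence on open elements
  and a uniform bound suffice by dominated convergence.\<close>

lemma in_H1_0: "u \<in> H1_0 \<Omega>"
proof -
  obtain x0 where x0: "x0 \<in> \<Omega>" using domain_nonempty by blast
  obtain R where R: "\<And>x. x \<in> \<Omega> \<Longrightarrow> norm (x - x0) \<le> R" "R > 0"
  proof -
    obtain R where R: "R > 0" "\<And>x. x \<in> \<Omega> \<Longrightarrow> norm x \<le> R"
      using bounded_domain unfolding bounded_pos by blast
    have "norm (x - x0) \<le> 2 * R" if "x \<in> \<Omega>" for x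
      using norm_triangle_ineq4[of x x0] R(2)[OF that] R(2)[OF x0] by linarith
    then show ?thesis using that[of "2 * R"] \<open>R > 0\<close> by simp
  qed
  define e where "e = (\<lambda>n. inverse (real (Suc n)))"
  have e: "e n > 0" "e n \<le> 1" for n by (auto simp: e_def field_simps)
  have e0: "e \<longlonglongrightarrow> 0" unfolding e_def by (rule LIMSEQ_inverse_real_of_nat)
  define p where "p = (\<lambda>n x. x0 + (1 + e n) *\<^sub>R (x - x0))"
  define C where "C = (\<lambda>n. {x. p n x \<in> closure \<Omega>})"
  have p_diff: "norm (p n x - p n y) \<le> 2 * norm (x - y)" for n x y
  proof -
    have "p n x - p n y = (1 + e n) *\<^sub>R (x - y)" by (simp add: p_def algebra_simps)
    then show ?thesis using e[of n] mult_right_mono[of "1 + e n" 2 "norm (x - y)"] by simp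
  qed
  have p_near: "norm (p n y - x) \<le> 2 * norm (y - x) + e n * norm (x - x0)" for n x y
  proof -
    have "p n y - x = (p n y - p n x) + e n *\<^sub>R (x - x0)" by (simp add: p_def algebra_simps)
    also have "norm \<dots> \<le> norm (p n y - p n x) + norm (e n *\<^sub>R (x - x0))" by (rule norm_triangle_ineq)
    finally show ?thesis using p_diff[of n y x] e(1)[of n] by simp
  qed
  have pcont: "continuous_on UNIV (p n)" for n unfolding p_def by (intro continuous_intros)
  have C_sub: "C n \<subseteq> \<Omega>" for n
  proof
    fix x assume "x \<in> C n"
    then have c: "p n x \<in> closure \<Omega>" by (simp add: C_def)
    \<comment> \<open>The contraction towards \<open>x0\<close> by the factor
      \<open>1 - t = 1 / (1 + e n)\<close> undoes the expansion \<open>p n\<close>; by convexity it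
      moves the closed domain into the interior.\<close>
    define t where "t = e n / (1 + e n)"
    have t: "0 < t" "t \<le> 1" using e[of n] by (auto simp: t_def field_simps)
    have eq: "t * (1 + e n) = e n" using e(1)[of n] by (simp add: t_def)
    have "p n x - t *\<^sub>R (p n x - x0) \<in> interior \<Omega>"
      using x0 open_domain c t by (intro mem_interior_closure_convex_shrink convex_domain) (auto simp: interior_open)
    moreover have "p n x - t *\<^sub>R (p n x - x0) = x"
    proof -
      have "t *\<^sub>R (p n x - x0) = e n *\<^sub>R (x - x0)" by (simp add: p_def eq)
      then show ?thesis by (simp add: p_def algebra_simps)
    qed
    ultimately show "x \<in> \<Omega>" using interior_subset by auto
  qed
  have C_compact: "compact (C n)" for n
  proof -
    have "closed (C n)" unfolding C_def using pcont[of n] closed_vimage[of "closure \<Omega>" "p n"] by (simp add: vimage_def)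
    then show ?thesis using C_sub[of n] bounded_domain bounded_subset compact_eq_bounded_closed by blast
  qed
  have "\<exists>\<epsilon>>0. (\<Union>x\<in>C n. cball x \<epsilon>) \<subseteq> \<Omega>" for n
    using compact_subset_open_imp_cball_epsilon_subset[OF C_compact open_domain C_sub] by metis
  then obtain \<epsilon> where \<epsilon>: "\<And>n. \<epsilon> n > 0" "\<And>n. (\<Union>x\<in>C n. cball x (\<epsilon> n)) \<subseteq> \<Omega>" by metis
  \<comment> \<open>The bound \<open>\<epsilon> n\<close> keeps the mollified support inside the
    domain, and \<open>e n\<close> lets the mollification error vanish.\<close>
  define d where "d = (\<lambda>n. min (\<epsilon> n) (e n))"
  have d: "d n > 0" "d n \<le> \<epsilon> n" "d n \<le> e n" for n using \<epsilon>(1)[of n] e[of n] by (auto simp: d_def)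
  define f where "f = (\<lambda>n x. u (p n x))"
  define w where "w = (\<lambda>n. mollify (d n) (f n))"
  have f_lip: "\<bar>f n x - f n y\<bar> \<le> 2 * L * norm (x - y)" for n x y
    using Lipschitz[of "p n x" "p n y"] mult_left_mono[OF p_diff[of n x y] L_nonneg] by (simp add: f_def)
  have f_cont: "continuous_on UNIV (f n)" for n
    unfolding f_def by (rule continuous_on_compose2[OF continuous pcont]) auto
  have f_out: "f n x = 0" if "x \<notin> C n" for n x
    using that closure_subset[of \<Omega>] outside by (auto simp: f_def C_def)
  have f_int: "integrable lebesgue (f n)" for n
    by (rule continuous_compact_support_integrable[OF f_cont], rule bounded_subset[OF compact_imp_bounded[OF C_compact]])
       (use f_out in auto)
  have w_test: "w n \<in> test_functions \<Omega>" for n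
    unfolding w_def
  proof (rule mollify_test_function[OF d(1) f_int f_out C_compact])
    fix x y :: 'a assume "x \<in> C n" "norm y \<le> d n"
    then have "x + y \<in> cball x (\<epsilon> n)" using d(2)[of n] by (simp add: dist_norm)
    then show "x + y \<in> \<Omega>" using \<epsilon>(2)[of n] \<open>x \<in> C n\<close> by blast
  qed
  have w_near: "\<bar>w n x - u x\<bar> \<le> L * (2 * e n + e n * norm (x - x0))" for n x
    unfolding w_def
  proof (rule mollify_near[OF d(1) f_int])
    fix y assume y: "norm (y - x) < d n"
    have "\<bar>f n y - u x\<bar> \<le> L * norm (p n y - x)" unfolding f_def by (rule Lipschitz)
    also have "\<dots> \<le> L * (2 * e n + e n * norm (x - x0))"
      using p_near[of n y x] y d(3)[of n] by (intro mult_left_mono L_nonneg) linarith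
    finally show "\<bar>f n y - u x\<bar> \<le> L * (2 * e n + e n * norm (x - x0))" .
  qed
  have w_lip: "\<bar>w n x - w n y\<bar> \<le> 2 * L * norm (x - y)" for n x y
    unfolding w_def by (rule mollify_Lipschitz[OF d(1) _ f_lip]) (simp add: L_nonneg)
  have w_partial: "\<bar>grad (w n) x \<bullet> b\<bar> \<le> 2 * L" if "b \<in> Basis" for n x b
    using Lipschitz_derivative_bound[OF test_function_has_derivative[OF w_test] w_lip, of n x b] that
    by (simp add: grad_inner_Basis)
  have w_grad: "norm (grad (w n) x) \<le> real DIM('a) * (2 * L)" for n x
    using norm_le_l1[of "grad (w n) x"] sum_bounded_above[of Basis "\<lambda>b. \<bar>grad (w n) x \<bullet> b\<bar>" "2 * L"] w_partial
    by fastforce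
  \<comment> \<open>Near a point of an open element the expanded function is eventually affine with
    gradient \<open>(1 + e n) *\<^sub>R G \<tau>\<close>. Mollification leaves it unchanged there,
    so the gradient is known exactly and not only in the limit.\<close>
  have grad_lim: "(\<lambda>n. grad (w n) x) \<longlonglongrightarrow> pgrad x" if \<tau>: "\<tau> \<in> \<T>" "x \<in> \<tau>" for x \<tau>
  proof -
    obtain r where r: "r > 0" "ball x r \<subseteq> \<tau>"
      using open_element[OF \<tau>(1)] \<tau>(2) by (auto simp: open_contains_ball)
    \<comment> \<open>Points \<open>z\<close> within \<open>d n\<close> of \<open>x\<close> are
      mollified over points \<open>y\<close> within another \<open>d n\<close>; as
      \<open>d n \<le> e n\<close> and \<open>p n\<close> at most doubles distances, this gives
      \<open>4 * e n\<close>. The other term is the displacement of \<open>x\<close> itself.\<close>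
    have "(\<lambda>n. 4 * e n + e n * norm (x - x0)) \<longlonglongrightarrow> 4 * 0 + 0 * norm (x - x0)"
      by (intro tendsto_intros e0)
    then have ev: "\<forall>\<^sub>F n in sequentially. 4 * e n + e n * norm (x - x0) < r"
      using r(1) by (intro order_tendstoD(2)) auto
    have "\<forall>\<^sub>F n in sequentially. (1 + e n) *\<^sub>R G \<tau> = grad (w n) x"
      using ev
    proof eventually_elim
      fix n assume n: "4 * e n + e n * norm (x - x0) < r"
      have aff: "f n y = ((1 + e n) *\<^sub>R G \<tau>) \<bullet> y + (c \<tau> - e n * (G \<tau> \<bullet> x0))"
        if "norm (y - x) < 2 * d n" for y
      proof -
        have "norm (p n y - x) < r" using p_near[of n y x] that d(3)[of n] n by linarith
        then have "p n y \<in> closure \<tau>" using r(2) closure_subset[of \<tau>] by (auto simp: dist_norm norm_minus_commute)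
        then have "f n y = G \<tau> \<bullet> p n y + c \<tau>" using affine[OF \<tau>(1)] by (simp add: f_def)
        then show ?thesis by (simp add: p_def inner_simps algebra_simps)
      qed
      have eq: "((1 + e n) *\<^sub>R G \<tau>) \<bullet> z + (c \<tau> - e n * (G \<tau> \<bullet> x0)) = w n z" if "z \<in> ball x (d n)" for z
        unfolding w_def
      proof (rule mollify_affine[OF d(1), symmetric])
        fix y assume "norm (y - z) < d n"
        then have "norm (y - x) < 2 * d n"
          using that norm_triangle_ineq[of "y - z" "z - x"] by (simp add: dist_norm norm_minus_commute)
        then show "f n y = ((1 + e n) *\<^sub>R G \<tau>) \<bullet> y + (c \<tau> - e n * (G \<tau> \<bullet> x0))" by (rule aff)
      qed
      have der: "((\<lambda>z. ((1 + e n) *\<^sub>R G \<tau>) \<bullet> z + (c \<tau> - e n * (G \<tau> \<bullet> x0))) has_derivative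
          (\<lambda>h. ((1 + e n) *\<^sub>R G \<tau>) \<bullet> h)) (at x)"
        by (auto intro!: derivative_eq_intros)
      have "(w n has_derivative (\<lambda>h. ((1 + e n) *\<^sub>R G \<tau>) \<bullet> h)) (at x)"
        by (rule has_derivative_transform_within_open[OF der open_ball centre_in_ball[THEN iffD2, OF d(1)] eq])
      then have fd: "frechet_derivative (w n) (at x) = (\<lambda>h. ((1 + e n) *\<^sub>R G \<tau>) \<bullet> h)"
        using frechet_derivative_at by metis
      show "(1 + e n) *\<^sub>R G \<tau> = grad (w n) x"
        unfolding grad_def fd by (rule euclidean_representation[symmetric])
    qed
    moreover have "(\<lambda>n. (1 + e n) *\<^sub>R G \<tau>) \<longlonglongrightarrow> (1 + 0) *\<^sub>R G \<tau>"
      by (intro tendsto_intros e0)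
    ultimately have "(\<lambda>n. grad (w n) x) \<longlonglongrightarrow> (1 + 0) *\<^sub>R G \<tau>"
      by (rule Lim_transform_eventually[rotated])
    then show ?thesis using pgrad_element[OF \<tau>] by simp
  qed
  have meas_w: "w n \<in> borel_measurable (lebesgue_on \<Omega>)" for n
    using test_function_square_integrable[OF w_test lmeasurable_domain] by (simp add: square_integrable_def)
  have meas_u: "u \<in> borel_measurable (lebesgue_on \<Omega>)"
    using square_integrable_u by (simp add: square_integrable_def)
  have meas_gw: "grad (w n) \<in> borel_measurable (lebesgue_on \<Omega>)" for n
    using grad_square_integrable[OF w_test lmeasurable_domain] by (simp add: square_integrable_def)
  have meas_pg: "pgrad \<in> borel_measurable (lebesgue_on \<Omega>)"
    using pgrad_square_integrable by (simp add: square_integrable_def)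
  have lim1: "(\<lambda>n. L2_inner \<Omega> (\<lambda>x. u x - w n x) (\<lambda>x. u x - w n x)) \<longlonglongrightarrow> 0"
    unfolding L2_inner_def
  proof (rule dominated_convergence_const[OF lmeasurable_domain, where B = "(L * (2 + R))\<^sup>2"])
    show "AE x in lebesgue_on \<Omega>. (\<lambda>n. (u x - w n x) \<bullet> (u x - w n x)) \<longlonglongrightarrow> 0"
    proof (rule AE_I2)
      fix x
      have "(\<lambda>n. L * (2 * e n + e n * norm (x - x0))) \<longlonglongrightarrow> L * (2 * 0 + 0 * norm (x - x0))"
        by (intro tendsto_intros e0)
      then have "(\<lambda>n. L * (2 * e n + e n * norm (x - x0))) \<longlonglongrightarrow> 0" by simp
      then have "(\<lambda>n. w n x - u x) \<longlonglongrightarrow> 0"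
        by (rule Lim_null_comparison[rotated]) (use w_near in auto)
      then have "(\<lambda>n. (w n x - u x) * (w n x - u x)) \<longlonglongrightarrow> 0 * 0" by (intro tendsto_mult)
      then show "(\<lambda>n. (u x - w n x) \<bullet> (u x - w n x)) \<longlonglongrightarrow> 0" by (simp add: algebra_simps)
    qed
    show "AE x in lebesgue_on \<Omega>. \<bar>(u x - w n x) \<bullet> (u x - w n x)\<bar> \<le> (L * (2 + R))\<^sup>2" for n
    proof (rule AE_I2)
      fix x assume "x \<in> space (lebesgue_on \<Omega>)"
      then have x: "x \<in> \<Omega>" by (simp add: space_restrict_space)
      have "2 * e n + e n * norm (x - x0) \<le> 2 + R"
        using e[of n] R(1)[OF x] R(2) mult_mono[of "e n" 1 "norm (x - x0)" R] by simp
      then have "\<bar>u x - w n x\<bar> \<le> L * (2 + R)"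
        using w_near[of n x] mult_left_mono[OF _ L_nonneg, of "2 * e n + e n * norm (x - x0)" "2 + R"] by linarith
      then have "\<bar>u x - w n x\<bar>\<^sup>2 \<le> (L * (2 + R))\<^sup>2" by (intro power_mono) auto
      then show "\<bar>(u x - w n x) \<bullet> (u x - w n x)\<bar> \<le> (L * (2 + R))\<^sup>2" by (simp add: power2_eq_square)
    qed
  qed (intro borel_measurable_inner borel_measurable_diff meas_u meas_w)
  have lim2: "(\<lambda>n. L2_inner \<Omega> (\<lambda>x. pgrad x - grad (w n) x) (\<lambda>x. pgrad x - grad (w n) x)) \<longlonglongrightarrow> 0"
    unfolding L2_inner_def
  proof (rule dominated_convergence_const[OF lmeasurable_domain, where B = "(L + real DIM('a) * (2 * L))\<^sup>2"])
    show "AE x in lebesgue_on \<Omega>. (\<lambda>n. (pgrad x - grad (w n) x) \<bullet> (pgrad x - grad (w n) x)) \<longlonglongrightarrow> 0"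
    proof (rule AE_on_elements, rule AE_I2)
      fix \<tau> x assume "\<tau> \<in> \<T>" "x \<in> space (lebesgue_on \<tau>)"
      then have "(\<lambda>n. (pgrad x - grad (w n) x) \<bullet> (pgrad x - grad (w n) x)) \<longlonglongrightarrow> (pgrad x - pgrad x) \<bullet> (pgrad x - pgrad x)"
        by (intro tendsto_intros grad_lim) (auto simp: space_restrict_space)
      then show "(\<lambda>n. (pgrad x - grad (w n) x) \<bullet> (pgrad x - grad (w n) x)) \<longlonglongrightarrow> 0" by simp
    qed
    show "AE x in lebesgue_on \<Omega>. \<bar>(pgrad x - grad (w n) x) \<bullet> (pgrad x - grad (w n) x)\<bar> \<le> (L + real DIM('a) * (2 * L))\<^sup>2" for n
    proof (rule AE_I2)
      fix x
      have "norm (pgrad x - grad (w n) x) \<le> L + real DIM('a) * (2 * L)"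
        using norm_triangle_ineq4[of "pgrad x" "grad (w n) x"] pgrad_bound[of x] w_grad[of n x] by linarith
      then have "(norm (pgrad x - grad (w n) x))\<^sup>2 \<le> (L + real DIM('a) * (2 * L))\<^sup>2" by (intro power_mono) auto
      then show "\<bar>(pgrad x - grad (w n) x) \<bullet> (pgrad x - grad (w n) x)\<bar> \<le> (L + real DIM('a) * (2 * L))\<^sup>2"
        by (simp add: power2_norm_eq_inner)
    qed
  qed (intro borel_measurable_inner borel_measurable_diff meas_pg meas_gw)
  have H1: "H1_norm \<Omega> (\<lambda>x. u x - w n x) = sqrt (L2_inner \<Omega> (\<lambda>x. u x - w n x) (\<lambda>x. u x - w n x)
      + L2_inner \<Omega> (\<lambda>x. pgrad x - grad (w n) x) (\<lambda>x. pgrad x - grad (w n) x))" for n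
    by (rule H1_norm_eq[OF open_domain bounded_domain
        has_L2_gradient_diff_test_function[OF lmeasurable_domain square_integrable_u has_L2_gradient_pgrad w_test]])
  have "(\<lambda>n. H1_norm \<Omega> (\<lambda>x. u x - w n x)) \<longlonglongrightarrow> sqrt (0 + 0)"
    unfolding H1 by (intro tendsto_intros lim1 lim2)
  then have lim: "(\<lambda>n. H1_norm \<Omega> (\<lambda>x. u x - w n x)) \<longlonglongrightarrow> 0" by simp
  have "\<exists>\<psi>\<in>test_functions \<Omega>. H1_norm \<Omega> (\<lambda>x. u x - \<psi> x) < \<epsilon>" if "\<epsilon> > 0" for \<epsilon>
  proof -
    have "\<forall>\<^sub>F n in sequentially. H1_norm \<Omega> (\<lambda>x. u x - w n x) < \<epsilon>"
      using lim that by (rule order_tendstoD)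
    then show ?thesis using w_test eventually_happens'[OF sequentially_bot] by blast
  qed
  then show ?thesis
    using square_integrable_u has_L2_gradient_pgrad by (auto simp: H1_0_def H1_def)
qed

lemma in_fe_space: "u \<in> fe_space \<Omega> \<T>"
proof -
  have "eq_ae \<tau> u (\<lambda>x. G \<tau> \<bullet> x + c \<tau>)" if "\<tau> \<in> \<T>" for \<tau>
    unfolding eq_ae_def
    by (rule AE_I2) (use affine[OF that] closure_subset[of \<tau>] in \<open>auto simp: space_restrict_space\<close>)
  then show ?thesis using in_H1_0 by (auto simp: fe_space_def)
qed

end

section \<open>From the Sobolev description to piecewise affine functions\<close>

context mesh
begin

lemma piecewise_affine_mesh_function:
  assumes "piecewise_affine \<Omega> \<T> u"
  obtains G c where "mesh_function \<Omega> \<T> u G c"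
proof -
  have "\<forall>\<tau>\<in>\<T>. \<exists>g c. \<forall>x\<in>closure \<tau>. u x = g \<bullet> x + c" using assms by (simp add: piecewise_affine_def)
  then obtain G c where "\<forall>\<tau>\<in>\<T>. \<forall>x\<in>closure \<tau>. u x = G \<tau> \<bullet> x + c \<tau>" by metis
  then have "mesh_function \<Omega> \<T> u G c"
    using assms by unfold_locales (auto simp: piecewise_affine_def)
  then show ?thesis by (rule that)
qed

lemma piecewise_affine_fe_space: "piecewise_affine \<Omega> \<T> u \<Longrightarrow> u \<in> fe_space \<Omega> \<T>"
  by (metis piecewise_affine_mesh_function mesh_function.in_fe_space)

lemma piecewise_affine_continuous: "piecewise_affine \<Omega> \<T> u \<Longrightarrow> continuous_on UNIV u"
  by (metis piecewise_affine_mesh_function mesh_function.continuous)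

lemma piecewise_affine_square_integrable: "piecewise_affine \<Omega> \<T> u \<Longrightarrow> square_integrable \<Omega> u"
  by (metis piecewise_affine_mesh_function mesh_function.square_integrable_u)

lemma square_integrable_element:
  fixes f :: "'a \<Rightarrow> 'b::euclidean_space"
  assumes \<tau>: "\<tau> \<in> \<T>" and "square_integrable \<Omega> f"
  shows "square_integrable \<tau> f"
proof -
  have "f \<in> borel_measurable (lebesgue_on \<tau>)"
    using assms(2) element_subset[OF \<tau>] measurable_restrict_mono unfolding square_integrable_def by blast
  moreover have "integrable lebesgue (\<lambda>x. (indicator \<Omega> x * (norm (f x))\<^sup>2) * indicator \<tau> x)"
    using assms(2) by (intro integrable_real_mult_indicator sets_element[OF \<tau>])
      (simp add: square_integrable_def lebesgue_on_integrable_iff[OF sets_domain])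
  moreover have "(\<lambda>x. (indicator \<Omega> x * (norm (f x))\<^sup>2) * indicator \<tau> x) = (\<lambda>x. indicator \<tau> x * (norm (f x))\<^sup>2)"
    using element_subset[OF \<tau>] by (auto simp: indicator_def fun_eq_iff)
  ultimately show ?thesis by (simp add: square_integrable_def lebesgue_on_integrable_iff[OF sets_element[OF \<tau>]])
qed

text \<open>Test functions on an element are test functions on the domain, so the weak gradient
  restricts to the element; there it must agree with that of the affine function, the constant
  \<open>G\<close>.\<close>

lemma has_L2_gradient_element:
  assumes v: "square_integrable \<Omega> v" and g: "has_L2_gradient \<Omega> v g"
    and \<tau>: "\<tau> \<in> \<T>" and eq: "eq_ae \<tau> v (\<lambda>x. G \<bullet> x + c)"
  shows "AE x in lebesgue_on \<tau>. g x = G"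
proof (rule has_L2_gradient_unique[OF open_element[OF \<tau>] bounded_element[OF \<tau>]])
  note l\<tau> = lmeasurable_element[OF \<tau>]
  show "has_L2_gradient \<tau> v g"
    unfolding has_L2_gradient_def
  proof (intro conjI ballI)
    show "square_integrable \<tau> g" using g by (simp add: has_L2_gradient_def square_integrable_element[OF \<tau>])
    fix \<psi> and b :: 'a assume \<psi>: "\<psi> \<in> test_functions \<tau>" and b: "b \<in> Basis"
    have \<psi>': "\<psi> \<in> test_functions \<Omega>" using \<psi> element_subset[OF \<tau>] by (auto simp: test_functions_def)
    have "(LINT x|lebesgue_on \<Omega>. v x * frechet_derivative \<psi> (at x) b) = - (LINT x|lebesgue_on \<Omega>. (g x \<bullet> b) * \<psi> x)"
      using g \<psi>' b unfolding has_L2_gradient_def by blast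
    then show "(LINT x|lebesgue_on \<tau>. v x * frechet_derivative \<psi> (at x) b) = - (LINT x|lebesgue_on \<tau>. (g x \<bullet> b) * \<psi> x)"
      by (simp add: lebesgue_on_integral_support[OF sets_domain] lebesgue_on_integral_support[OF sets_element[OF \<tau>]]
          test_function_eq_0[OF \<psi>] test_function_eq_0[OF \<psi>'] test_function_eq_0[OF test_function_partial[OF \<psi> b]]
          test_function_eq_0[OF test_function_partial[OF \<psi>' b]])
  qed
  have "has_L2_gradient \<tau> (\<lambda>x. G \<bullet> x + c) (\<lambda>x. G)"
    unfolding has_L2_gradient_def
  proof (intro conjI ballI)
    show "square_integrable \<tau> (\<lambda>x. G)" by (rule bounded_square_integrable[OF _ order_refl l\<tau>]) simp
    fix \<psi> and b :: 'a assume \<psi>: "\<psi> \<in> test_functions \<tau>" and b: "b \<in> Basis"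
    have "(LINT x|lebesgue. (G \<bullet> x + c) * frechet_derivative \<psi> (at x) b) = - (LINT x|lebesgue. (G \<bullet> b) * \<psi> x)"
    proof (rule Lipschitz_integration_by_parts[OF norm_ge_zero[of G] _ test_functions_UNIV[OF \<psi>] b])
      show "\<bar>G \<bullet> x + c - (G \<bullet> y + c)\<bar> \<le> norm G * norm (x - y)" for x y
        using Cauchy_Schwarz_ineq2[of G "x - y"] by (simp add: inner_diff_right)
      show "AE x in lebesgue. ((\<lambda>t. (G \<bullet> (x + t *\<^sub>R b) + c - (G \<bullet> x + c)) / t) \<longlongrightarrow> G \<bullet> b) (at 0)"
        by (intro AE_I2 Lim_transform_eventually[OF tendsto_const])
           (auto simp: eventually_at inner_add_right intro!: exI[of _ 1])
    qed simp
    then show "(LINT x|lebesgue_on \<tau>. (G \<bullet> x + c) * frechet_derivative \<psi> (at x) b) = - (LINT x|lebesgue_on \<tau>. (G \<bullet> b) * \<psi> x)"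
      by (simp add: lebesgue_on_integral_support[OF sets_element[OF \<tau>]]
          test_function_eq_0[OF \<psi>] test_function_eq_0[OF test_function_partial[OF \<psi> b]])
  qed
  moreover have "square_integrable \<tau> (\<lambda>x. G \<bullet> x + c)"
  proof -
    obtain B where "\<And>x. x \<in> \<tau> \<Longrightarrow> norm x \<le> B"
      using bounded_element[OF \<tau>] unfolding bounded_iff by blast
    then have "norm (G \<bullet> x + c) \<le> norm G * B + \<bar>c\<bar>" if "x \<in> \<tau>" for x
      using Cauchy_Schwarz_ineq2[of G x] mult_left_mono[of "norm x" B "norm G"] that by fastforce
    then show ?thesis
      by (intro bounded_square_integrable[OF _ _ l\<tau>] measurable_lebesgue_on continuous_imp_measurable_lebesgue continuous_intros)
  qed
  ultimately show "has_L2_gradient \<tau> v (\<lambda>x. G)"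
    using square_integrable_element[OF \<tau> v] eq l\<tau>
    by (intro has_L2_gradient_cong_AE[where v = "\<lambda>x. G \<bullet> x + c" and w = v]) (auto simp: eq_ae_def elim: eventually_mono)
qed

text \<open>A function in the finite element space has a bounded weak gradient, so the mollifications of
  its extension by zero are uniformly Lipschitz on the whole space. Hence the affine pieces agree on
  common boundary points and vanish on the boundary of the domain.\<close>

lemma fe_space_piecewise_affine:
  assumes "v \<in> fe_space \<Omega> \<T>"
  obtains u where "piecewise_affine \<Omega> \<T> u" "eq_ae \<Omega> v u"
proof -
  have vH: "v \<in> H1_0 \<Omega>" and "\<forall>\<tau>\<in>\<T>. \<exists>g c. eq_ae \<tau> v (\<lambda>x. g \<bullet> x + c)"
    using assms by (auto simp: fe_space_def)
  then obtain G c where Gc: "\<And>\<tau>. \<tau> \<in> \<T> \<Longrightarrow> eq_ae \<tau> v (\<lambda>x. G \<tau> \<bullet> x + c \<tau>)" by metis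
  have sv: "square_integrable \<Omega> v" using vH by (simp add: H1_0_def H1_def)
  obtain g where g: "has_L2_gradient \<Omega> v g" using vH by (auto simp: H1_0_def H1_def)
  define M where "M = (\<Sum>\<tau>\<in>\<T>. norm (G \<tau>))"
  have M: "norm (G \<tau>) \<le> M" if "\<tau> \<in> \<T>" for \<tau>
    unfolding M_def by (rule member_le_sum) (use finite_mesh that in auto)
  have M0: "0 \<le> M" by (simp add: M_def sum_nonneg)
  have g_bound: "AE x in lebesgue_on \<Omega>. norm (g x) \<le> M"
  proof (rule AE_on_elements)
    fix \<tau> assume \<tau>: "\<tau> \<in> \<T>"
    show "AE x in lebesgue_on \<tau>. norm (g x) \<le> M"
      using has_L2_gradient_element[OF sv g \<tau> Gc[OF \<tau>]] by eventually_elim (use M[OF \<tau>] in simp)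
  qed
  \<comment> \<open>A representative with prescribed values everywhere: affine on open elements and
    zero elsewhere. It is mollified in place of \<open>v\<close>, so that limits can be read off
    pointwise.\<close>
  define vt where "vt = (\<lambda>x. \<Sum>\<tau>\<in>\<T>. indicator \<tau> x * (G \<tau> \<bullet> x + c \<tau>))"
  have vt_element: "vt x = G \<tau> \<bullet> x + c \<tau>" if \<tau>: "\<tau> \<in> \<T>" "x \<in> \<tau>" for \<tau> x
  proof -
    have "indicator \<tau>' x * (G \<tau>' \<bullet> x + c \<tau>') = (if \<tau>' = \<tau> then G \<tau> \<bullet> x + c \<tau> else 0)" if "\<tau>' \<in> \<T>" for \<tau>'
      using disjoint_elements[OF \<tau>(1) that \<tau>(2)] \<tau>(2) by (cases "x \<in> \<tau>'") auto
    then have "vt x = (\<Sum>\<tau>'\<in>\<T>. if \<tau>' = \<tau> then G \<tau> \<bullet> x + c \<tau> else 0)"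
      unfolding vt_def by (intro sum.cong) auto
    then show ?thesis using \<tau> finite_mesh by simp
  qed
  have vt_outside: "vt x = 0" if "x \<notin> \<Omega>" for x
    unfolding vt_def using that element_subset by (intro sum.neutral) (auto simp: indicator_def)
  have vt_v: "AE x in lebesgue_on \<Omega>. vt x = v x"
  proof (rule AE_on_elements)
    fix \<tau> assume \<tau>: "\<tau> \<in> \<T>"
    have "AE x in lebesgue_on \<tau>. x \<in> \<tau>" by (rule AE_I2) (simp add: space_restrict_space)
    then show "AE x in lebesgue_on \<tau>. vt x = v x"
      using Gc[OF \<tau>, unfolded eq_ae_def] by eventually_elim (simp add: vt_element[OF \<tau>])
  qed
  have vt_meas: "vt \<in> borel_measurable lebesgue"
    unfolding vt_def
    by (intro borel_measurable_sum borel_measurable_times borel_measurable_indicator sets_element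
        continuous_imp_measurable_lebesgue continuous_intros)
  have vt_integral: "(LINT y|lebesgue. vt y * F y) = (LINT y|lebesgue_on \<Omega>. v y * F y)"
    if "continuous_on UNIV F" for F
  proof -
    have "(LINT y|lebesgue. vt y * F y) = (LINT y|lebesgue_on \<Omega>. vt y * F y)"
      using vt_outside by (simp add: lebesgue_on_integral_support[OF sets_domain])
    also have "\<dots> = (LINT y|lebesgue_on \<Omega>. v y * F y)"
    proof (rule integral_cong_AE)
      show "AE x in lebesgue_on \<Omega>. vt x * F x = v x * F x" using vt_v by eventually_elim simp
    qed (use sv in \<open>auto simp: square_integrable_def intro!: borel_measurable_times
        measurable_lebesgue_on[OF vt_meas] measurable_lebesgue_on[OF continuous_imp_measurable_lebesgue[OF that]]\<close>)
    finally show ?thesis .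
  qed
  have vt_int: "integrable lebesgue vt"
  proof -
    have "integrable (lebesgue_on \<Omega>) vt"
    proof (rule integrable_cong_AE_imp[OF square_integrable_integrable[OF sv lmeasurable_domain]])
      show "vt \<in> borel_measurable (lebesgue_on \<Omega>)" by (rule measurable_lebesgue_on[OF vt_meas])
      show "AE x in lebesgue_on \<Omega>. v x = vt x" using vt_v by eventually_elim simp
    qed
    moreover have "(\<lambda>x. indicator \<Omega> x * vt x) = vt" using vt_outside by (auto simp: indicator_def fun_eq_iff)
    ultimately show ?thesis by (simp add: lebesgue_on_integrable_iff[OF sets_domain])
  qed
  define w where "w = (\<lambda>\<delta>. mollify \<delta> vt)"
  have w_lip: "\<bar>w \<delta> x - w \<delta> y\<bar> \<le> (real DIM('a) * M) * norm (x - y)" if \<delta>: "\<delta> > 0" for \<delta> x y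
  proof -
    define D where "D = (\<lambda>x h. LINT y|lebesgue. vt y * frechet_derivative (mollifier \<delta>) (at (x - y)) h)"
    have D: "(w \<delta> has_derivative D x) (at x)" for x
      unfolding w_def D_def mollify_def by (rule convolution_has_derivative[OF vt_int mollifier_test_function[OF \<delta>]])
    \<comment> \<open>The derivative of the convolution falls on the kernel. Since the kernel around
      \<open>x\<close> may cross the boundary of the domain, moving the derivative to
      \<open>v\<close> takes \<open>H1_0_integration_by_parts\<close> and not just the definition of
      a weak gradient.\<close>
    have Db: "\<bar>D x b\<bar> \<le> M" if b: "b \<in> Basis" for x b
    proof -
      define \<xi> where "\<xi> = (\<lambda>y. mollifier \<delta> (y - x))"
      have \<xi>: "\<xi> \<in> test_functions UNIV"
        unfolding test_functions_UNIV_iff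
      proof (intro conjI allI)
        show "C_diff k \<xi>" for k
          using mollifier_test_function[OF \<delta>, where 'a='a] by (auto simp: \<xi>_def test_functions_def intro: C_diff_translate)
        show "bounded {y. \<xi> y \<noteq> 0}"
        proof (rule bounded_subset[OF bounded_ball], rule subsetI)
          fix y assume "y \<in> {y. \<xi> y \<noteq> 0}"
          then show "y \<in> ball x \<delta>"
            using mollifier_eq_0[OF \<delta>, of "y - x"]
            by (cases "\<delta> \<le> norm (y - x)") (auto simp: \<xi>_def dist_norm norm_minus_commute)
        qed
      qed
      \<comment> \<open>The convolution differentiates the kernel in \<open>x\<close>, the
        integration by parts in \<open>y\<close>; the sign comes from the argument
        \<open>x - y\<close>.\<close>
      have neg: "frechet_derivative (mollifier \<delta>) (at (x - y)) b = - frechet_derivative \<xi> (at y) b" for y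
      proof -
        have "((\<lambda>y. x - y) has_derivative (\<lambda>h. - h)) (at y)" by (auto intro!: derivative_eq_intros)
        from has_derivative_compose[OF this test_function_has_derivative[OF mollifier_test_function[OF \<delta>]]]
        have "(\<xi> has_derivative (\<lambda>h. frechet_derivative (mollifier \<delta>) (at (x - y)) (- h))) (at y)"
          by (simp add: \<xi>_def mollifier_diff_commute[of \<delta> x])
        then have "frechet_derivative \<xi> (at y) = (\<lambda>h. frechet_derivative (mollifier \<delta>) (at (x - y)) (- h))"
          using frechet_derivative_at by metis
        moreover have "linear (frechet_derivative (mollifier \<delta>) (at (x - y)))"
          using test_function_has_derivative[OF mollifier_test_function[OF \<delta>]] has_derivative_linear by blast
        ultimately show ?thesis by (simp add: linear_neg)
      qed
      have "D x b = - (LINT y|lebesgue. vt y * frechet_derivative \<xi> (at y) b)"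
        by (simp add: D_def neg)
      also have "\<dots> = - (LINT y|lebesgue_on \<Omega>. v y * frechet_derivative \<xi> (at y) b)"
        by (simp add: vt_integral test_function_continuous[OF test_function_partial[OF \<xi> b]])
      also have "\<dots> = (LINT y|lebesgue_on \<Omega>. (g y \<bullet> b) * \<xi> y)"
        using H1_0_integration_by_parts[OF open_domain bounded_domain vH g \<xi> b] by simp
      finally have "\<bar>D x b\<bar> = \<bar>LINT y|lebesgue_on \<Omega>. (g y \<bullet> b) * \<xi> y\<bar>" by simp
      also have "\<dots> \<le> (LINT y|lebesgue_on \<Omega>. \<bar>(g y \<bullet> b) * \<xi> y\<bar>)" by (rule integral_abs_bound)
      also have "\<dots> \<le> (LINT y|lebesgue_on \<Omega>. M * \<xi> y)"
      proof (rule integral_mono_AE)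
        have "square_integrable \<Omega> (\<lambda>y. g y \<bullet> b)" using g square_integrable_component by (auto simp: has_L2_gradient_def)
        from square_integrable_inner[OF this test_function_square_integrable[OF \<xi> lmeasurable_domain]]
        show "integrable (lebesgue_on \<Omega>) (\<lambda>y. \<bar>(g y \<bullet> b) * \<xi> y\<bar>)" by simp
        show "integrable (lebesgue_on \<Omega>) (\<lambda>y. M * \<xi> y)"
          using square_integrable_integrable[OF test_function_square_integrable[OF \<xi> lmeasurable_domain] lmeasurable_domain] by simp
        show "AE y in lebesgue_on \<Omega>. \<bar>(g y \<bullet> b) * \<xi> y\<bar> \<le> M * \<xi> y"
          using g_bound
        proof eventually_elim
          fix y assume "norm (g y) \<le> M"
          then have "\<bar>g y \<bullet> b\<bar> \<le> M" using Cauchy_Schwarz_ineq2[of "g y" b] b by simp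
          moreover have "\<xi> y \<ge> 0" by (simp add: \<xi>_def mollifier_nonneg)
          ultimately show "\<bar>(g y \<bullet> b) * \<xi> y\<bar> \<le> M * \<xi> y" by (simp add: abs_mult mult_right_mono)
        qed
      qed
      also have "\<dots> \<le> (LINT y|lebesgue. M * \<xi> y)"
      proof -
        have i: "integrable lebesgue \<xi>" by (rule test_function_integrable[OF \<xi>])
        have "(LINT y|lebesgue. indicator \<Omega> y * (M * \<xi> y)) \<le> (LINT y|lebesgue. M * \<xi> y)"
          by (rule integral_mono) (use i M0 in \<open>auto simp: \<xi>_def mollifier_nonneg indicator_def
              intro!: integrable_mult_indicator[where 'b=real, simplified] sets_domain\<close>)
        then show ?thesis by (simp only: lebesgue_on_integral_eq[OF sets_domain])
      qed
      also have "\<dots> = M"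
        using mollifier_translate(1)[OF \<delta>, of x] by (simp add: \<xi>_def mollifier_diff_commute[of \<delta> x])
      finally show ?thesis .
    qed
    have "norm (w \<delta> x - w \<delta> y) \<le> (real DIM('a) * M) * norm (x - y)"
    proof (rule differentiable_bound[of UNIV "w \<delta>" D])
      show "onorm (D x) \<le> real DIM('a) * M" for x
        using linear_bound_Basis[OF has_derivative_linear[OF D] Db] M0 by (intro onorm_bound) auto
    qed (use D in auto)
    then show ?thesis by simp
  qed
  define \<delta> where "\<delta> = (\<lambda>n. inverse (real (Suc n)))"
  have \<delta>: "\<delta> n > 0" for n by (simp add: \<delta>_def)
  have \<delta>0: "\<delta> \<longlonglongrightarrow> 0" unfolding \<delta>_def by (rule LIMSEQ_inverse_real_of_nat)
  have w_lim: "(\<lambda>n. w (\<delta> n) x) \<longlonglongrightarrow> vt x" if "open S" "x \<in> S" "continuous_on S vt" for x S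
    unfolding w_def by (rule mollify_tendsto[OF \<delta> \<delta>0 vt_int]) (use that continuous_on_eq_continuous_at in blast)
  \<comment> \<open>The uniform Lipschitz bound passes to the limit between any two points of
    convergence, even across an interface or the boundary; this forces the affine pieces to
    match.\<close>
  have vt_lip: "\<bar>vt x - vt y\<bar> \<le> (real DIM('a) * M) * norm (x - y)"
    if "(\<lambda>n. w (\<delta> n) x) \<longlonglongrightarrow> vt x" "(\<lambda>n. w (\<delta> n) y) \<longlonglongrightarrow> vt y" for x y
    by (rule LIMSEQ_le_const2[OF tendsto_rabs[OF tendsto_diff[OF that]]]) (use w_lip[OF \<delta>] in auto)
  have lim_element: "(\<lambda>n. w (\<delta> n) x) \<longlonglongrightarrow> vt x" if \<tau>: "\<tau> \<in> \<T>" "x \<in> \<tau>" for \<tau> x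
  proof (rule w_lim[OF open_element[OF \<tau>(1)] \<tau>(2)])
    have "continuous_on \<tau> (\<lambda>x. G \<tau> \<bullet> x + c \<tau>)" by (intro continuous_intros)
    then show "continuous_on \<tau> vt" by (simp add: vt_element[OF \<tau>(1)] cong: continuous_on_cong)
  qed
  have lim_outside: "(\<lambda>n. w (\<delta> n) x) \<longlonglongrightarrow> vt x" if "x \<in> - closure \<Omega>" for x
  proof (rule w_lim[OF _ that])
    have "vt y = 0" if "y \<in> - closure \<Omega>" for y using that closure_subset vt_outside by blast
    then show "continuous_on (- closure \<Omega>) vt"
      by (intro continuous_on_eq[OF continuous_on_const[of _ 0]]) simp
  qed auto
  have cont: "continuous_on UNIV (\<lambda>x. G \<tau> \<bullet> x + c \<tau>)" for \<tau> by (intro continuous_intros)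
  have "\<exists>u. piecewise_affine \<Omega> \<T> u \<and> (\<forall>\<tau>\<in>\<T>. \<forall>x\<in>closure \<tau>. u x = G \<tau> \<bullet> x + c \<tau>)"
  proof (rule piecewise_affine_glue)
    fix \<tau> \<tau>' x assume \<tau>: "\<tau> \<in> \<T>" "\<tau>' \<in> \<T>" and x: "x \<in> closure \<tau>" "x \<in> closure \<tau>'"
    show "G \<tau> \<bullet> x + c \<tau> = G \<tau>' \<bullet> x + c \<tau>'"
    proof (rule eq_on_common_closure[OF cont cont _ x])
      fix y z assume "y \<in> \<tau>" "z \<in> \<tau>'"
      then show "\<bar>G \<tau> \<bullet> y + c \<tau> - (G \<tau>' \<bullet> z + c \<tau>')\<bar> \<le> (real DIM('a) * M) * norm (y - z)"
        using vt_lip[OF lim_element lim_element] \<tau> vt_element by metis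
    qed
  next
    fix \<tau> x assume \<tau>: "\<tau> \<in> \<T>" and x: "x \<in> closure \<tau>" "x \<notin> \<Omega>"
    show "G \<tau> \<bullet> x + c \<tau> = 0"
    proof (rule eq_on_common_closure[OF cont continuous_on_const _ x(1)])
      \<comment> \<open>The domain is the interior of its closure, so every point outside it is a
        limit of exterior points.\<close>
      show "x \<in> closure (- closure \<Omega>)" using x(2) by (simp add: closure_complement interior_closure_domain)
      fix y z assume yz: "y \<in> \<tau>" "z \<in> - closure \<Omega>"
      then have "vt z = 0" using closure_subset vt_outside by blast
      then show "\<bar>G \<tau> \<bullet> y + c \<tau> - 0\<bar> \<le> (real DIM('a) * M) * norm (y - z)"
        using vt_lip[OF lim_element[OF \<tau> yz(1)] lim_outside[OF yz(2)]] vt_element[OF \<tau> yz(1)] by simp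
    qed
  qed
  then obtain u where u: "piecewise_affine \<Omega> \<T> u" "\<And>\<tau> x. \<tau> \<in> \<T> \<Longrightarrow> x \<in> closure \<tau> \<Longrightarrow> u x = G \<tau> \<bullet> x + c \<tau>"
    by blast
  have "eq_ae \<Omega> v u"
    unfolding eq_ae_def
  proof (rule AE_on_elements)
    fix \<tau> assume \<tau>: "\<tau> \<in> \<T>"
    have "AE x in lebesgue_on \<tau>. x \<in> \<tau>" by (rule AE_I2) (simp add: space_restrict_space)
    then show "AE x in lebesgue_on \<tau>. v x = u x"
      using Gc[OF \<tau>, unfolded eq_ae_def]
      by eventually_elim (use u(2)[OF \<tau>] closure_subset[of \<tau>] in \<open>auto simp: subset_iff\<close>)
  qed
  with u(1) that show ?thesis by blast
qed

end

subsection \<open>Moments of barycentric coordinates\<close>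

lemma linear_functional_inner:
  fixes f :: "'a::euclidean_space \<Rightarrow> real"
  assumes "linear f"
  obtains g where "\<And>x. f x = g \<bullet> x"
proof -
  have "f x = (\<Sum>b\<in>Basis. f b *\<^sub>R b) \<bullet> x" for x
  proof -
    have "f x = f (\<Sum>b\<in>Basis. (x \<bullet> b) *\<^sub>R b)" by (simp add: euclidean_representation)
    also have "\<dots> = (\<Sum>b\<in>Basis. (x \<bullet> b) * f b)"
      by (simp add: linear_sum[OF assms] linear_cmul[OF assms])
    finally show ?thesis by (simp add: inner_sum_left inner_commute[of x] mult.commute)
  qed
  then show ?thesis by (rule that)
qed

text \<open>Translated by \<open>- a\<close>, the other nodes are linearly independent, so some
  linear functional is \<open>-1\<close> on all of them; adding \<open>1\<close> makes it the
  coordinate at \<open>a\<close>.\<close>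

lemma barycentric_exists:
  fixes C :: "'a::euclidean_space set"
  assumes "\<not> affine_dependent C" "a \<in> C"
  shows "\<exists>g c. \<forall>b\<in>C. g \<bullet> b + c = (if b = a then 1 else 0 :: real)"
proof -
  have "independent ((\<lambda>x. - a + x) ` (C - {a}))"
    using affine_dependent_iff_dependent2[OF assms(2)] assms(1) by simp
  then obtain f :: "'a \<Rightarrow> real" where f: "linear f" "\<forall>x\<in>(\<lambda>x. - a + x) ` (C - {a}). f x = -1"
    using linear_independent_extend[of "(\<lambda>x. - a + x) ` (C - {a})" "\<lambda>_. -1"] by auto
  obtain g where g: "\<And>x. f x = g \<bullet> x" using linear_functional_inner[OF f(1)] by blast
  have "g \<bullet> b + (1 - g \<bullet> a) = (if b = a then 1 else 0)" if "b \<in> C" for b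
  proof (cases "b = a")
    case False
    then have "g \<bullet> (- a + b) = -1" using f(2) that g by auto
    then show ?thesis using False by (simp add: inner_diff_right)
  qed simp
  then show ?thesis by blast
qed

lemma integral_homothety:
  fixes f :: "'a::euclidean_space \<Rightarrow> real"
  assumes [measurable]: "f \<in> borel_measurable borel" and s: "s > 0"
  shows "(LINT x|lebesgue. f x) = s ^ DIM('a) * (LINT x|lebesgue. f (t + s *\<^sub>R x))"
proof -
  have "(LINT x|lborel. f x) = (LINT x|density (distr lborel borel (\<lambda>x. t + s *\<^sub>R x)) (\<lambda>_. \<bar>s\<bar> ^ DIM('a)). f x)"
    using lborel_affine[of s t] s by simp
  also have "\<dots> = s ^ DIM('a) * (LINT x|lborel. f (t + s *\<^sub>R x))"
    using s by (subst integral_density) (auto simp: integral_distr)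
  finally show ?thesis by (simp add: integral_completion)
qed

locale simplex_nodes =
  fixes C :: "'a::euclidean_space set"
  assumes affine_independent: "\<not> affine_dependent C" and card_nodes: "card C = Suc DIM('a)"
begin

text \<open>Gradient and constant of a barycentric coordinate are kept apart because the hat
  functions are glued from such coefficients.\<close>

definition bary_grad where
  "bary_grad a = (SOME g. \<exists>c. \<forall>b\<in>C. g \<bullet> b + c = (if b = a then 1 else 0 :: real))"

definition bary_const where
  "bary_const a = (SOME c. \<forall>b\<in>C. bary_grad a \<bullet> b + c = (if b = a then 1 else 0 :: real))"

definition bary where "bary a x = bary_grad a \<bullet> x + bary_const a"

lemma finite_nodes: "finite C"
  using affine_independent aff_independent_finite by blast

lemma bary_node: "a \<in> C \<Longrightarrow> b \<in> C \<Longrightarrow> bary a b = (if b = a then 1 else 0)"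
proof -
  assume a: "a \<in> C" and b: "b \<in> C"
  have "\<exists>c. \<forall>b\<in>C. bary_grad a \<bullet> b + c = (if b = a then 1 else 0)"
    unfolding bary_grad_def by (rule someI_ex[OF barycentric_exists[OF affine_independent a]])
  then have "\<forall>b\<in>C. bary_grad a \<bullet> b + bary_const a = (if b = a then 1 else 0)"
    unfolding bary_const_def by (rule someI_ex)
  then show ?thesis using b by (simp add: bary_def)
qed

lemma affine_combination:
  fixes g :: 'a and c :: real
  assumes "sum t D = 1"
  shows "g \<bullet> (\<Sum>b\<in>D. t b *\<^sub>R b) + c = (\<Sum>b\<in>D. t b * (g \<bullet> b + c))"
  using assms by (simp add: inner_sum_right distrib_left sum.distrib flip: sum_distrib_right)

lemma bary_combination:
  assumes "sum t C = 1" "a \<in> C"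
  shows "bary a (\<Sum>b\<in>C. t b *\<^sub>R b) = t a"
proof -
  have "bary a (\<Sum>b\<in>C. t b *\<^sub>R b) = (\<Sum>b\<in>C. t b * bary a b)"
    unfolding bary_def by (rule affine_combination[OF assms(1)])
  also have "\<dots> = (\<Sum>b\<in>C. if b = a then t a else 0)"
    using assms(2) by (intro sum.cong) (auto simp: bary_node)
  finally show ?thesis using assms(2) finite_nodes by simp
qed

text \<open>The \<open>d + 1\<close> affinely independent nodes span the whole space, so both
  identities hold at every point and not only inside the simplex.\<close>

lemma bary_sum: "(\<Sum>a\<in>C. bary a x) = 1" and bary_point: "(\<Sum>a\<in>C. bary a x *\<^sub>R a) = x"
proof -
  have "aff_dim C = int DIM('a)"
    using aff_dim_affine_independent[OF affine_independent] card_nodes by simp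
  then have "x \<in> affine hull C" by (simp add: aff_dim_eq_full)
  then obtain t where t: "sum t C = 1" "(\<Sum>v\<in>C. t v *\<^sub>R v) = x"
    by (auto simp: affine_hull_finite[OF finite_nodes])
  then have "bary a x = t a" if "a \<in> C" for a using bary_combination[OF t(1) that] by simp
  with t show "(\<Sum>a\<in>C. bary a x) = 1" "(\<Sum>a\<in>C. bary a x *\<^sub>R a) = x" by simp_all
qed

lemma affine_bary: "g \<bullet> x + c = (\<Sum>a\<in>C. bary a x * (g \<bullet> a + c))"
  using affine_combination[OF bary_sum, of g x c] by (simp add: bary_point)

lemma simplex_iff: "x \<in> convex hull C \<longleftrightarrow> (\<forall>a\<in>C. 0 \<le> bary a x)"
proof
  assume "x \<in> convex hull C"
  then obtain t where t: "\<forall>v\<in>C. 0 \<le> t v" "sum t C = 1" "(\<Sum>v\<in>C. t v *\<^sub>R v) = x"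
    by (auto simp: convex_hull_finite[OF finite_nodes])
  then show "\<forall>a\<in>C. 0 \<le> bary a x" using bary_combination[OF t(2)] by auto
next
  assume "\<forall>a\<in>C. 0 \<le> bary a x"
  then show "x \<in> convex hull C"
    using bary_sum[of x] bary_point[of x] by (auto simp: convex_hull_finite[OF finite_nodes] intro!: exI[of _ "\<lambda>a. bary a x"])
qed

lemma bary_le_1: "x \<in> convex hull C \<Longrightarrow> a \<in> C \<Longrightarrow> bary a x \<le> 1"
  using bary_sum[of x] member_le_sum[of a C "\<lambda>a. bary a x"] finite_nodes by (auto simp: simplex_iff)

lemma bary_continuous: "continuous_on S (bary a)"
  unfolding bary_def by (intro continuous_intros)

lemma bary_homothety:
  assumes "a \<in> C" "b \<in> C"
  shows "bary b (t *\<^sub>R a + (1 - t) *\<^sub>R y) = (if b = a then t else 0) + (1 - t) * bary b y"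
proof -
  have "bary b (t *\<^sub>R a + (1 - t) *\<^sub>R y) = t * bary b a + (1 - t) * bary b y"
    by (simp add: bary_def inner_simps algebra_simps)
  then show ?thesis using assms by (simp add: bary_node)
qed

lemma compact_simplex: "compact (convex hull C)"
  using finite_nodes by (rule finite_imp_compact_convex_hull)

lemma integrable_simplex:
  fixes f :: "'a \<Rightarrow> real"
  assumes "continuous_on UNIV f"
  shows "integrable lebesgue (\<lambda>x. indicator (convex hull C) x * f x)"
proof -
  have "integrable lborel (\<lambda>x. indicator (convex hull C) x *\<^sub>R f x)"
    using assms by (intro borel_integrable_compact compact_simplex) (auto intro: continuous_on_subset)
  moreover have "(\<lambda>x. indicator (convex hull C) x * f x) \<in> borel_measurable lborel"
    using assms compact_simplex
    by (intro borel_measurable_times borel_measurable_indicator) (auto simp: borel_measurable_continuous_onI borel_compact)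
  ultimately show ?thesis by (simp add: integrable_completion)
qed

text \<open>The set where a barycentric coordinate exceeds \<open>t\<close> is a homothetic copy of the simplex.
  This scales the integral of \<open>max (bary a x - t) 0 * q x\<close> by a power of \<open>1 - t\<close>, and the moment
  identity is the derivative at \<open>t = 0\<close>.\<close>

lemma homothety_moment:
  fixes q :: "'a \<Rightarrow> real"
  assumes a: "a \<in> C" and q: "continuous_on UNIV q"
    and hom: "\<And>t y. 0 < t \<Longrightarrow> t < 1 \<Longrightarrow> q (t *\<^sub>R a + (1 - t) *\<^sub>R y) = (1 - t) ^ j * q y"
  shows "real (DIM('a) + 1 + j) * (LINT x|lebesgue. indicator (convex hull C) x * (bary a x * q x)) =
    (LINT x|lebesgue. indicator (convex hull C) x * q x)"
proof -
  define S where "S = convex hull C"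
  \<comment> \<open>The scaling exponent: \<open>DIM('a)\<close> from the change of variables, one
    from the truncated coordinate, \<open>j\<close> from the homogeneity of
    \<open>q\<close>.\<close>
  define k where "k = DIM('a) + 1 + j"
  define F where "F = (\<lambda>t. LINT x|lebesgue. indicator S x * (max (bary a x - t) 0 * q x))"
  have S [measurable]: "S \<in> sets borel" unfolding S_def using compact_simplex by (rule borel_compact)
  have q_meas [measurable]: "q \<in> borel_measurable borel" using q by (rule borel_measurable_continuous_onI)
  have bary_meas [measurable]: "bary a \<in> borel_measurable borel" by (rule borel_measurable_continuous_onI[OF bary_continuous])
  have S_nonneg: "0 \<le> bary b x" if "x \<in> S" "b \<in> C" for x b using that by (simp add: S_def simplex_iff)
  have F_int: "integrable lebesgue (\<lambda>x. indicator S x * (max (bary a x - t) 0 * q x))" for t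
    unfolding S_def by (intro integrable_simplex continuous_intros bary_continuous q)
  have F_scale: "F t = (1 - t) ^ k * F 0" if t: "0 < t" "t < 1" for t
  proof -
    have eq: "indicator S (t *\<^sub>R a + (1 - t) *\<^sub>R y) * (max (bary a (t *\<^sub>R a + (1 - t) *\<^sub>R y) - t) 0 * q (t *\<^sub>R a + (1 - t) *\<^sub>R y))
      = (1 - t) ^ (j + 1) * (indicator S y * (max (bary a y - 0) 0 * q y))" for y
    proof -
      let ?y = "t *\<^sub>R a + (1 - t) *\<^sub>R y"
      have m: "max (bary a ?y - t) 0 = (1 - t) * max (bary a y) 0"
        using t by (simp add: bary_homothety[OF a a] max_def zero_le_mult_iff mult_le_0_iff)
      have "indicator S ?y * max (bary a y) 0 = (indicator S y * max (bary a y) 0 :: real)"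
      \<comment> \<open>That \<open>?y\<close> in \<open>S\<close> implies \<open>y\<close> in
        \<open>S\<close> can fail where the coordinate at \<open>a\<close> is negative; there the
        truncation makes both sides zero.\<close>
      proof (cases "bary a y > 0")
        case True
        have "?y \<in> S \<longleftrightarrow> y \<in> S"
        proof
          assume "?y \<in> S"
          have "0 \<le> bary b y" if b: "b \<in> C" for b
          proof (cases "b = a")
            case False
            then have "0 \<le> (1 - t) * bary b y"
              using S_nonneg[OF \<open>?y \<in> S\<close> b] bary_homothety[OF a b, of t y] by simp
            then show ?thesis using t by (simp add: zero_le_mult_iff)
          qed (use \<open>bary a y > 0\<close> in simp)
          then show "y \<in> S" by (simp add: S_def simplex_iff)
        next
          assume "y \<in> S"
          then have "0 \<le> bary b ?y" if "b \<in> C" for b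
            using t S_nonneg[OF \<open>y \<in> S\<close> that] by (simp add: bary_homothety[OF a that])
          then show "?y \<in> S" by (simp add: S_def simplex_iff)
        qed
        then show ?thesis by (simp add: indicator_def)
      qed (simp add: max_def)
      then have "indicator S ?y * ((1 - t) * max (bary a y) 0 * ((1 - t) ^ j * q y)) =
          (1 - t) ^ (j + 1) * (indicator S y * (max (bary a y) 0 * q y))"
        by (simp add: mult_ac)
      then show ?thesis by (simp add: m hom[OF t])
    qed
    have "F t = (1 - t) ^ DIM('a) * (LINT y|lebesgue. indicator S (t *\<^sub>R a + (1 - t) *\<^sub>R y) *
        (max (bary a (t *\<^sub>R a + (1 - t) *\<^sub>R y) - t) 0 * q (t *\<^sub>R a + (1 - t) *\<^sub>R y)))"
      unfolding F_def by (rule integral_homothety) (use t in auto)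
    also have "\<dots> = (1 - t) ^ k * F 0"
      unfolding eq by (simp add: F_def k_def power_add)
    finally show ?thesis .
  qed
  \<comment> \<open>The double successor keeps \<open>s n\<close> strictly below one, as the scaling
    law requires.\<close>
  define s where "s = (\<lambda>n. inverse (real (Suc (Suc n))))"
  have s: "0 < s n" "s n < 1" for n by (auto simp: s_def field_simps)
  have s0: "s \<longlonglongrightarrow> 0" unfolding s_def using LIMSEQ_inverse_real_of_nat by (rule LIMSEQ_Suc)
  have s_at: "filterlim s (at 0) sequentially" using s0 s by (simp add: filterlim_at less_imp_neq[symmetric])
  \<comment> \<open>The same difference quotient is evaluated twice, here by the scaling law and
    below under the integral sign.\<close>
  have 1: "(\<lambda>n. (F 0 - F (s n)) / s n) \<longlonglongrightarrow> real k * F 0"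
  proof -
    have "((\<lambda>t. (1 - t) ^ k) has_real_derivative - real k) (at 0)"
      by (auto intro!: derivative_eq_intros)
    then have "((\<lambda>t. ((1 - t) ^ k - 1) / t) \<longlongrightarrow> - real k) (at 0)" by (simp add: DERIV_def)
    then have "(\<lambda>n. ((1 - s n) ^ k - 1) / s n) \<longlonglongrightarrow> - real k" using s_at by (rule filterlim_compose)
    then have "(\<lambda>n. - (((1 - s n) ^ k - 1) / s n) * F 0) \<longlonglongrightarrow> - (- real k) * F 0" by (intro tendsto_intros)
    moreover have "- (((1 - s n) ^ k - 1) / s n) * F 0 = (F 0 - F (s n)) / s n" for n
      using s[of n] by (simp add: F_scale field_simps)
    ultimately show ?thesis by simp
  qed
  have 2: "(\<lambda>n. (F 0 - F (s n)) / s n) \<longlonglongrightarrow> (LINT x|lebesgue. indicator S x * q x)"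
  proof -
    have quot: "(F 0 - F (s n)) / s n = (LINT x|lebesgue. indicator S x * ((max (bary a x - 0) 0 - max (bary a x - s n) 0) / s n * q x))" for n
    proof -
      have "(F 0 - F (s n)) / s n = (LINT x|lebesgue. (indicator S x * (max (bary a x - 0) 0 * q x) - indicator S x * (max (bary a x - s n) 0 * q x)) / s n)"
        unfolding F_def using F_int[of 0] F_int[of "s n"] by simp
      then show ?thesis by (simp add: algebra_simps diff_divide_distrib)
    qed
    have "(\<lambda>n. LINT x|lebesgue. indicator S x * ((max (bary a x - 0) 0 - max (bary a x - s n) 0) / s n * q x))
        \<longlonglongrightarrow> (LINT x|lebesgue. indicator S x * q x)"
    proof (rule integral_dominated_convergence[where w = "\<lambda>x. indicator S x * \<bar>q x\<bar>"])
      show "integrable lebesgue (\<lambda>x. indicator S x * \<bar>q x\<bar>)"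
        unfolding S_def by (intro integrable_simplex continuous_intros q)
      show "(\<lambda>x. indicator S x * q x) \<in> borel_measurable lebesgue"
        unfolding S_def by (rule borel_measurable_integrable[OF integrable_simplex[OF q]])
      show "(\<lambda>x. indicator S x * ((max (bary a x - 0) 0 - max (bary a x - s n) 0) / s n * q x)) \<in> borel_measurable lebesgue" for n
        unfolding S_def using s[of n]
        by (intro borel_measurable_integrable integrable_simplex continuous_intros bary_continuous q) auto
      show "AE x in lebesgue. norm (indicator S x * ((max (bary a x - 0) 0 - max (bary a x - s n) 0) / s n * q x)) \<le> indicator S x * \<bar>q x\<bar>" for n
      proof (rule AE_I2)
        fix x
        define r where "r = (max (bary a x - 0) 0 - max (bary a x - s n) 0) / s n"
        have "\<bar>r\<bar> \<le> 1"
          unfolding r_def using s[of n] by (auto simp: divide_le_eq max_def)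
        then show "norm (indicator S x * ((max (bary a x - 0) 0 - max (bary a x - s n) 0) / s n * q x)) \<le> indicator S x * \<bar>q x\<bar>"
          unfolding r_def[symmetric] using mult_right_mono[of "\<bar>r\<bar>" 1 "\<bar>q x\<bar>"] by (auto simp: indicator_def abs_mult)
      qed
      \<comment> \<open>Where the coordinate vanishes the truncated quotient tends to zero instead
        of one. These points form a hyperplane: in positive dimension there is a second node, so the
        coordinate is not constant.\<close>
      have "negligible {x. bary_grad a \<bullet> x = - bary_const a}"
      proof (rule negligible_hyperplane)
        have "bary_grad a \<noteq> 0"
        proof
          assume z: "bary_grad a = 0"
          obtain b where "b \<in> C" "b \<noteq> a"
            using card_nodes a DIM_positive[where 'a='a] finite_nodes
            by (metis card_1_singleton_iff is_singletonI' is_singleton_def n_not_Suc_n One_nat_def empty_iff nat.inject neq0_conv)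
          then show False using bary_node[OF a a] bary_node[OF a, of b] z by (auto simp: bary_def)
        qed
        then show "bary_grad a \<noteq> 0 \<or> - bary_const a \<noteq> 0" by simp
      qed
      then have "AE x in lebesgue. x \<notin> {x. bary_grad a \<bullet> x = - bary_const a}"
        unfolding negligible_iff_null_sets by (rule AE_not_in)
      then show "AE x in lebesgue. (\<lambda>n. indicator S x * ((max (bary a x - 0) 0 - max (bary a x - s n) 0) / s n * q x)) \<longlonglongrightarrow> indicator S x * q x"
      proof eventually_elim
        fix x assume "x \<notin> {x. bary_grad a \<bullet> x = - bary_const a}"
        then have nz: "bary a x \<noteq> 0" by (auto simp: bary_def)
        show "(\<lambda>n. indicator S x * ((max (bary a x - 0) 0 - max (bary a x - s n) 0) / s n * q x)) \<longlonglongrightarrow> indicator S x * q x"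
        proof (cases "x \<in> S")
          case True
          then have pos: "bary a x > 0" using S_nonneg[OF _ a, of x] nz by simp
          have "\<forall>\<^sub>F n in sequentially. s n < bary a x" using s0 pos by (rule order_tendstoD)
          then have "\<forall>\<^sub>F n in sequentially. indicator S x * q x = indicator S x * ((max (bary a x - 0) 0 - max (bary a x - s n) 0) / s n * q x)"
          proof eventually_elim
            fix n assume "s n < bary a x"
            then have "(max (bary a x - 0) 0 - max (bary a x - s n) 0) / s n = 1" using s[of n] pos by simp
            then show "indicator S x * q x = indicator S x * ((max (bary a x - 0) 0 - max (bary a x - s n) 0) / s n * q x)" by simp
          qed
          then show ?thesis by (rule Lim_transform_eventually[OF tendsto_const])
        qed simp
      qed
    qed
    then show ?thesis by (simp only: quot)
  qed
  have "F 0 = (LINT x|lebesgue. indicator S x * (bary a x * q x))"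
    unfolding F_def by (rule Bochner_Integration.integral_cong) (use S_nonneg[OF _ a] in \<open>auto simp: indicator_def\<close>)
  with LIMSEQ_unique[OF 1 2] show ?thesis by (simp add: k_def S_def)
qed

abbreviation vol where "vol \<equiv> measure lebesgue (convex hull C)"

abbreviation moment where "moment f \<equiv> (LINT x|lebesgue. indicator (convex hull C) x * f x)"

text \<open>The case \<open>q = 1\<close> of degree \<open>j = 0\<close>.\<close>

lemma moment_bary: "a \<in> C \<Longrightarrow> moment (bary a) = vol / (real DIM('a) + 1)"
  using homothety_moment[of a "\<lambda>x. 1" 0] compact_simplex by (simp add: field_simps)

text \<open>The case \<open>q = bary b\<close>, which is homogeneous of degree one under contraction
  towards the other node \<open>a\<close>.\<close>

lemma moment_bary_bary_neq:
  assumes "a \<in> C" "b \<in> C" "b \<noteq> a"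
  shows "moment (\<lambda>x. bary a x * bary b x) = vol / ((real DIM('a) + 1) * (real DIM('a) + 2))"
proof -
  have "real (DIM('a) + 1 + 1) * moment (\<lambda>x. bary a x * bary b x) = moment (bary b)"
    by (rule homothety_moment[OF assms(1) bary_continuous]) (use assms in \<open>simp add: bary_homothety\<close>)
  then have "moment (\<lambda>x. bary a x * bary b x) = moment (bary b) / (real DIM('a) + 2)"
    by (simp add: eq_divide_eq mult.commute add.commute)
  then show ?thesis using moment_bary[OF assms(2)] by simp
qed

text \<open>\<open>bary a\<close> is not homogeneous under contraction towards \<open>a\<close>
  itself. The square is found from the partition of unity instead: the moment of
  \<open>bary a\<close> minus its \<open>d\<close> mixed moments.\<close>

lemma moment_bary_square:
  assumes a: "a \<in> C"
  shows "moment (\<lambda>x. bary a x * bary a x) = 2 * vol / ((real DIM('a) + 1) * (real DIM('a) + 2))"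
proof -
  have i: "integrable lebesgue (\<lambda>x. indicator (convex hull C) x * (bary a x * bary b x))" for b
    by (intro integrable_simplex continuous_intros bary_continuous)
  have "moment (bary a) = moment (\<lambda>x. \<Sum>b\<in>C. bary a x * bary b x)"
    by (simp add: bary_sum flip: sum_distrib_left)
  also have "\<dots> = (\<Sum>b\<in>C. moment (\<lambda>x. bary a x * bary b x))"
    using i by (simp add: sum_distrib_left)
  also have "\<dots> = moment (\<lambda>x. bary a x * bary a x) + (\<Sum>b\<in>C - {a}. moment (\<lambda>x. bary a x * bary b x))"
    by (rule sum.remove[OF finite_nodes a])
  also have "(\<Sum>b\<in>C - {a}. moment (\<lambda>x. bary a x * bary b x)) = (\<Sum>b\<in>C - {a}. vol / ((real DIM('a) + 1) * (real DIM('a) + 2)))"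
    using a by (intro sum.cong) (auto simp: moment_bary_bary_neq)
  also have "\<dots> = real DIM('a) * vol / ((real DIM('a) + 1) * (real DIM('a) + 2))"
    using a card_nodes finite_nodes by simp
  finally have "moment (\<lambda>x. bary a x * bary a x) = vol / (real DIM('a) + 1) - real DIM('a) * vol / ((real DIM('a) + 1) * (real DIM('a) + 2))"
    using moment_bary[OF a] by simp
  also have "\<dots> = 2 * vol / ((real DIM('a) + 1) * (real DIM('a) + 2))"
    by (simp add: divide_simps) (simp add: algebra_simps)
  finally show ?thesis .
qed

text \<open>Each diagonal moment \<open>2 * K\<close> is split as \<open>K + K\<close>; one half
  completes the double sum to a full square, the other gives the sum of squares.\<close>

lemma moment_affine_square:
  assumes p: "p = (\<lambda>x. g \<bullet> x + c)"
  shows "moment (\<lambda>x. p x * p x) = vol / ((real DIM('a) + 1) * (real DIM('a) + 2)) * ((\<Sum>a\<in>C. (p a)\<^sup>2) + (\<Sum>a\<in>C. p a)\<^sup>2)"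
proof -
  define K where "K = vol / ((real DIM('a) + 1) * (real DIM('a) + 2))"
  have i: "integrable lebesgue (\<lambda>x. indicator (convex hull C) x * (bary a x * bary b x))" for a b
    by (intro integrable_simplex continuous_intros bary_continuous)
  have px: "p x = (\<Sum>a\<in>C. p a * bary a x)" for x
    unfolding p by (subst affine_bary) (simp add: mult.commute)
  have "moment (\<lambda>x. p x * p x) = (LINT x|lebesgue. (\<Sum>a\<in>C. \<Sum>b\<in>C. (p a * p b) * (indicator (convex hull C) x * (bary a x * bary b x))))"
    by (subst (1 2) px) (simp add: sum_product sum_distrib_left mult_ac)
  also have "\<dots> = (\<Sum>a\<in>C. \<Sum>b\<in>C. (p a * p b) * moment (\<lambda>x. bary a x * bary b x))"
    using i by simp
  also have "\<dots> = (\<Sum>a\<in>C. \<Sum>b\<in>C. K * (p a * p b) + (if b = a then K * (p a * p a) else 0))"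
    by (intro sum.cong refl) (auto simp: moment_bary_bary_neq moment_bary_square K_def)
  also have "\<dots> = K * ((\<Sum>a\<in>C. (p a)\<^sup>2) + (\<Sum>a\<in>C. p a)\<^sup>2)"
  proof -
    have "(\<Sum>a\<in>C. p a)\<^sup>2 = (\<Sum>a\<in>C. \<Sum>b\<in>C. p a * p b)" by (simp add: power2_eq_square sum_product)
    then show ?thesis
      using finite_nodes by (simp add: sum.distrib power2_eq_square[of "p _"] sum_distrib_left distrib_left)
  qed
  finally show ?thesis by (simp add: K_def)
qed

end

subsection \<open>Nodal basis functions and the mass matrix\<close>

text \<open>The set of disagreement in \<open>S\<close> is open and null, hence empty. This recovers
  nodal values, which are point values, from equality almost everywhere.\<close>

lemma AE_eq_continuous_imp_eq:
  fixes f g :: "'a::euclidean_space \<Rightarrow> real"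
  assumes S: "open S" and f: "continuous_on (closure S) f" and g: "continuous_on (closure S) g"
    and ae: "AE x in lebesgue_on S. f x = g x" and x: "x \<in> closure S"
  shows "f x = g x"
proof -
  define U where "U = S \<inter> (\<lambda>x. f x - g x) -` (- {0})"
  have oU: "open U"
    unfolding U_def using f g closure_subset[of S] S
    by (intro continuous_open_preimage continuous_on_diff) (auto intro: continuous_on_subset)
  have "AE x in lebesgue. x \<in> S \<longrightarrow> f x = g x"
    using ae S by (simp add: AE_lebesgue_on_iff)
  then have "AE x in lebesgue. x \<notin> U"
    by eventually_elim (auto simp: U_def)
  then have "negligible U"
    using oU by (simp add: AE_iff_null_sets negligible_iff_null_sets)
  then have "U = {}"
    using oU open_not_negligible by blast
  then have "f y - g y = 0" if "y \<in> S" for y using that by (auto simp: U_def)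
  then have "f x - g x = 0"
    using f g x by (intro continuous_constant_on_closure[of S "\<lambda>x. f x - g x" 0 x] continuous_intros) auto
  then show ?thesis by simp
qed

context mesh
begin

lemma simplex_nodes: "\<tau> \<in> \<T> \<Longrightarrow> simplex_nodes (vertices \<tau>)"
  using element_simplex by unfold_locales

lemma finite_mesh_vertices: "finite (mesh_vertices \<T>)"
  using finite_mesh finite_vertices by (auto simp: mesh_vertices_def)

lemma finite_interior_vertices: "finite (interior_vertices \<Omega> \<T>)"
  using finite_mesh_vertices by (simp add: interior_vertices_def)

lemma vertex_closure: "\<tau> \<in> \<T> \<Longrightarrow> b \<in> vertices \<tau> \<Longrightarrow> b \<in> closure \<tau>"
  using element_simplex(1)[of \<tau>] hull_subset[of "vertices \<tau>" convex] by auto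

abbreviation lam where "lam \<tau> \<equiv> simplex_nodes.bary (vertices \<tau>)"

text \<open>By conformity the intersection is a face of both simplices, hence spanned by a subset of
  the vertices of each. The two subsets agree, as both are the extreme points of the
  intersection.\<close>

lemma common_face_vertices:
  assumes "\<tau> \<in> \<T>" "\<tau>' \<in> \<T>"
  obtains D where "D \<subseteq> vertices \<tau>" "D \<subseteq> vertices \<tau>'" "closure \<tau> \<inter> closure \<tau>' = convex hull D"
proof -
  have tri: "triangulation (closure ` \<T>)" using mesh by (simp add: triangulation_of_def)
  have face: "(S \<inter> S') face_of S" if "S \<in> closure ` \<T>" "S' \<in> closure ` \<T>" for S S'
    using tri that by (simp add: triangulation_def)
  have "(closure \<tau> \<inter> closure \<tau>') face_of (convex hull (vertices \<tau>))"
    using face[of "closure \<tau>" "closure \<tau>'"] assms by (simp flip: element_simplex(1))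
  then obtain D where D: "D \<subseteq> vertices \<tau>" "closure \<tau> \<inter> closure \<tau>' = convex hull D"
    unfolding face_of_convex_hull_affine_independent[OF element_simplex(2)[OF assms(1)]] by blast
  have "(closure \<tau> \<inter> closure \<tau>') face_of (convex hull (vertices \<tau>'))"
    using face[of "closure \<tau>'" "closure \<tau>"] assms by (simp add: Int_commute flip: element_simplex(1))
  then obtain D' where D': "D' \<subseteq> vertices \<tau>'" "closure \<tau> \<inter> closure \<tau>' = convex hull D'"
    unfolding face_of_convex_hull_affine_independent[OF element_simplex(2)[OF assms(2)]] by blast
  have "\<not> affine_dependent D" "\<not> affine_dependent D'"
    using D(1) D'(1) element_simplex(2) assms affine_independent_subset by blast+
  then have "D = D'"
    using extreme_point_of_convex_hull_affine_independent D(2) D'(2) by (metis subsetI subset_antisym)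
  with D D' show ?thesis using that by blast
qed

text \<open>A point of the common face is a combination of the common vertices \<open>D\<close>. Its
  coordinate at \<open>a\<close> is the weight of \<open>a\<close> in that combination, or zero if
  \<open>a\<close> is not in \<open>D\<close>, and so does not depend on the element.\<close>

lemma lam_compatible:
  assumes \<tau>: "\<tau> \<in> \<T>" "\<tau>' \<in> \<T>" and x: "x \<in> closure \<tau>" "x \<in> closure \<tau>'" and a: "a \<in> vertices \<tau>"
  shows "lam \<tau> a x = (if a \<in> vertices \<tau>' then lam \<tau>' a x else 0)"
proof -
  obtain D where D: "D \<subseteq> vertices \<tau>" "D \<subseteq> vertices \<tau>'" "closure \<tau> \<inter> closure \<tau>' = convex hull D"
    using common_face_vertices[OF \<tau>] by blast
  have fin: "finite D" using D(1) finite_vertices[OF \<tau>(1)] finite_subset by blast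
  obtain t where t: "sum t D = 1" "(\<Sum>b\<in>D. t b *\<^sub>R b) = x"
    using x D(3) by (auto simp: convex_hull_finite[OF fin] set_eq_iff)
  have ev: "lam \<upsilon> a x = (if a \<in> D then t a else 0)" if \<upsilon>: "\<upsilon> \<in> \<T>" "D \<subseteq> vertices \<upsilon>" "a \<in> vertices \<upsilon>" for \<upsilon>
  proof -
    interpret simplex_nodes "vertices \<upsilon>" by (rule simplex_nodes[OF \<upsilon>(1)])
    have "bary a x = (\<Sum>b\<in>D. t b * bary a b)"
      unfolding t(2)[symmetric] bary_def by (rule affine_combination[OF t(1)])
    also have "\<dots> = (\<Sum>b\<in>D. if b = a then t a else 0)"
      using \<upsilon> by (intro sum.cong) (auto simp: bary_node)
    finally show ?thesis using fin by simp
  qed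
  show ?thesis using ev[OF \<tau>(1) D(1) a] ev[OF \<tau>(2) D(2)] D(2) by auto
qed

text \<open>With a nonzero coordinate at the interior vertex \<open>a\<close>, the point would lie
  on a segment from \<open>a\<close> to a point of the closed domain, short of the far end, and so
  in the interior by convexity.\<close>

lemma lam_interior_vertex_outside:
  assumes \<tau>: "\<tau> \<in> \<T>" and x: "x \<in> closure \<tau>" "x \<notin> \<Omega>" and a: "a \<in> vertices \<tau>" "a \<in> \<Omega>"
  shows "lam \<tau> a x = 0"
proof (rule ccontr)
  interpret simplex_nodes "vertices \<tau>" by (rule simplex_nodes[OF \<tau>])
  note hull = element_simplex(1)[OF \<tau>]
  assume nz: "bary a x \<noteq> 0"
  have nonneg: "0 \<le> bary b x" if "b \<in> vertices \<tau>" for b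
    using x(1) that by (simp add: hull simplex_iff)
  define e where "e = bary a x"
  have e: "0 < e" "e \<le> 1" using nz nonneg[OF a(1)] bary_le_1[of x a] x(1) a(1) by (auto simp: e_def hull)
  show False
  proof (cases "e = 1")
    case True
    have "(\<Sum>b\<in>vertices \<tau> - {a}. bary b x) = 0"
      using bary_sum[of x] sum.remove[OF finite_nodes a(1), of "\<lambda>b. bary b x"] True by (simp add: e_def)
    then have "bary b x = 0" if "b \<in> vertices \<tau> - {a}" for b
      using that nonneg finite_nodes by (subst (asm) sum_nonneg_eq_0_iff) auto
    then have "x = a"
      using bary_point[of x] sum.remove[OF finite_nodes a(1), of "\<lambda>b. bary b x *\<^sub>R b"] True by (simp add: e_def)
    then show False using a x by simp
  next
    case False
    \<comment> \<open>The far end of that segment, solved from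
      \<open>x = e *\<^sub>R a + (1 - e) *\<^sub>R y\<close>; for \<open>e = 1\<close>, treated
      above, \<open>x\<close> is \<open>a\<close>.\<close>
    define y where "y = (1 / (1 - e)) *\<^sub>R (x - e *\<^sub>R a)"
    have e1: "e < 1" using e False by simp
    have xy: "x = e *\<^sub>R a + (1 - e) *\<^sub>R y" using e1 by (simp add: y_def)
    have "0 \<le> bary b y" if b: "b \<in> vertices \<tau>" for b
    proof -
      have "bary b x = (if b = a then e else 0) + (1 - e) * bary b y"
        using bary_homothety[OF a(1) b, of e y] xy by simp
      then have "0 \<le> (1 - e) * bary b y" using nonneg[OF b] by (cases "b = a") (auto simp: e_def)
      then show ?thesis using e1 by (simp add: zero_le_mult_iff)
    qed
    then have "y \<in> closure \<tau>" by (simp add: hull simplex_iff)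
    then have "y \<in> closure \<Omega>" using closure_element_subset[OF \<tau>] by blast
    then have "y - e *\<^sub>R (y - a) \<in> interior \<Omega>"
      using a e open_domain by (intro mem_interior_closure_convex_shrink convex_domain) (auto simp: interior_open)
    moreover have "y - e *\<^sub>R (y - a) = x" by (simp add: xy algebra_simps)
    ultimately show False using x(2) interior_subset by blast
  qed
qed

lemma piecewise_affine_vertex_eqI:
  assumes u: "piecewise_affine \<Omega> \<T> u" and v: "piecewise_affine \<Omega> \<T> v"
    and eq: "\<And>b. b \<in> mesh_vertices \<T> \<Longrightarrow> u b = v b"
  shows "u = v"
proof (rule piecewise_affine_eqI[OF u v])
  fix \<tau> x assume \<tau>: "\<tau> \<in> \<T>" and x: "x \<in> closure \<tau>"
  interpret simplex_nodes "vertices \<tau>" by (rule simplex_nodes[OF \<tau>])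
  have val: "w x = (\<Sum>a\<in>vertices \<tau>. bary a x * w a)" if w: "piecewise_affine \<Omega> \<T> w" for w
  proof -
    obtain g c where gc: "\<forall>x\<in>closure \<tau>. w x = g \<bullet> x + c"
      using w \<tau> unfolding piecewise_affine_def by blast
    have "w x = (\<Sum>a\<in>vertices \<tau>. bary a x * (g \<bullet> a + c))"
      using gc x affine_bary[of g x c] by simp
    also have "\<dots> = (\<Sum>a\<in>vertices \<tau>. bary a x * w a)"
      using gc vertex_closure[OF \<tau>] by (intro sum.cong) auto
    finally show ?thesis .
  qed
  have "u a = v a" if "a \<in> vertices \<tau>" for a using eq \<tau> that by (auto simp: mesh_vertices_def)
  then show "u x = v x" by (simp add: val[OF u] val[OF v] cong: sum.cong)
qed

lemma piecewise_affine_scale: "piecewise_affine \<Omega> \<T> u \<Longrightarrow> piecewise_affine \<Omega> \<T> (\<lambda>x. k * u x)"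
  unfolding piecewise_affine_def
  by (force simp: distrib_left intro: exI[of _ "k *\<^sub>R g" for g])

lemma piecewise_affine_add:
  assumes "piecewise_affine \<Omega> \<T> u" "piecewise_affine \<Omega> \<T> v"
  shows "piecewise_affine \<Omega> \<T> (\<lambda>x. u x + v x)"
  unfolding piecewise_affine_def
proof (intro conjI ballI allI impI)
  fix \<tau> assume "\<tau> \<in> \<T>"
  then obtain g c g' c' where "\<forall>x\<in>closure \<tau>. u x = g \<bullet> x + c" "\<forall>x\<in>closure \<tau>. v x = g' \<bullet> x + c'"
    using assms unfolding piecewise_affine_def by blast
  then show "\<exists>g c. \<forall>x\<in>closure \<tau>. u x + v x = g \<bullet> x + c"
    by (intro exI[of _ "g + g'"] exI[of _ "c + c'"]) (simp add: inner_add_left)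
qed (use assms in \<open>simp add: piecewise_affine_def\<close>)

lemma piecewise_affine_zero: "piecewise_affine \<Omega> \<T> (\<lambda>x. 0)"
  unfolding piecewise_affine_def by (auto intro: exI[of _ 0])

lemma piecewise_affine_sum:
  "(\<And>i. i \<in> I \<Longrightarrow> piecewise_affine \<Omega> \<T> (f i)) \<Longrightarrow> piecewise_affine \<Omega> \<T> (\<lambda>x. \<Sum>i\<in>I. z i * f i x)"
proof (induction I rule: infinite_finite_induct)
  case (insert i I)
  have "piecewise_affine \<Omega> \<T> (\<lambda>x. z i * f i x + (\<Sum>i\<in>I. z i * f i x))"
    by (rule piecewise_affine_add[OF piecewise_affine_scale insert.IH]) (use insert.prems in auto)
  then show ?case using insert.hyps by simp
qed (simp_all add: piecewise_affine_zero)

definition hat where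
  "hat a = (SOME u. piecewise_affine \<Omega> \<T> u \<and> (\<forall>b\<in>mesh_vertices \<T>. u b = (if b = a then 1 else 0)))"

text \<open>Glued from the coordinate at \<open>a\<close> on the elements with vertex
  \<open>a\<close> and zero on the others. That \<open>a\<close> is an interior vertex is what gives
  zero boundary values.\<close>

lemma hat_spec:
  assumes a: "a \<in> interior_vertices \<Omega> \<T>"
  shows "piecewise_affine \<Omega> \<T> (hat a) \<and> (\<forall>b\<in>mesh_vertices \<T>. hat a b = (if b = a then 1 else 0))"
proof -
  have a\<Omega>: "a \<in> \<Omega>" using a by (simp add: interior_vertices_def)
  define G where "G = (\<lambda>\<tau>. if a \<in> vertices \<tau> then simplex_nodes.bary_grad (vertices \<tau>) a else 0)"
  define c where "c = (\<lambda>\<tau>. if a \<in> vertices \<tau> then simplex_nodes.bary_const (vertices \<tau>) a else 0)"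
  have Gc: "G \<tau> \<bullet> x + c \<tau> = (if a \<in> vertices \<tau> then lam \<tau> a x else 0)" if "\<tau> \<in> \<T>" for \<tau> x
    using simplex_nodes.bary_def[OF simplex_nodes[OF that]] by (simp add: G_def c_def)
  have "\<exists>u. piecewise_affine \<Omega> \<T> u \<and> (\<forall>\<tau>\<in>\<T>. \<forall>x\<in>closure \<tau>. u x = G \<tau> \<bullet> x + c \<tau>)"
  proof (rule piecewise_affine_glue)
    fix \<tau> \<tau>' x assume "\<tau> \<in> \<T>" "\<tau>' \<in> \<T>" "x \<in> closure \<tau>" "x \<in> closure \<tau>'"
    then show "G \<tau> \<bullet> x + c \<tau> = G \<tau>' \<bullet> x + c \<tau>'"
      using lam_compatible[of \<tau> \<tau>' x a] lam_compatible[of \<tau>' \<tau> x a] by (auto simp: Gc)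
  next
    fix \<tau> x assume "\<tau> \<in> \<T>" "x \<in> closure \<tau>" "x \<notin> \<Omega>"
    then show "G \<tau> \<bullet> x + c \<tau> = 0" using lam_interior_vertex_outside a\<Omega> by (auto simp: Gc)
  qed
  then obtain u where u: "piecewise_affine \<Omega> \<T> u" "\<And>\<tau> x. \<tau> \<in> \<T> \<Longrightarrow> x \<in> closure \<tau> \<Longrightarrow> u x = G \<tau> \<bullet> x + c \<tau>"
    by blast
  have "u b = (if b = a then 1 else 0)" if b: "b \<in> mesh_vertices \<T>" for b
  proof -
    obtain \<tau> where \<tau>: "\<tau> \<in> \<T>" "b \<in> vertices \<tau>" using b by (auto simp: mesh_vertices_def)
    then have "u b = (if a \<in> vertices \<tau> then lam \<tau> a b else 0)"
      using u(2)[OF \<tau>(1) vertex_closure[OF \<tau>]] by (simp add: Gc)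
    then show ?thesis
      using simplex_nodes.bary_node[OF simplex_nodes[OF \<tau>(1)] _ \<tau>(2), of a] \<tau>(2) by auto
  qed
  with u(1) have "\<exists>u. piecewise_affine \<Omega> \<T> u \<and> (\<forall>b\<in>mesh_vertices \<T>. u b = (if b = a then 1 else 0))" by blast
  then show ?thesis unfolding hat_def by (rule someI_ex)
qed

lemma hat_piecewise_affine: "a \<in> interior_vertices \<Omega> \<T> \<Longrightarrow> piecewise_affine \<Omega> \<T> (hat a)"
  using hat_spec by blast

lemma hat_vertex: "a \<in> interior_vertices \<Omega> \<T> \<Longrightarrow> b \<in> mesh_vertices \<T> \<Longrightarrow> hat a b = (if b = a then 1 else 0)"
  using hat_spec by blast

text \<open>Vertices that are not interior lie outside the open domain, where \<open>u\<close> is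
  zero, so the hats at interior vertices suffice.\<close>

lemma piecewise_affine_expansion:
  assumes u: "piecewise_affine \<Omega> \<T> u"
  shows "u = (\<lambda>x. \<Sum>a\<in>interior_vertices \<Omega> \<T>. u a * hat a x)"
proof (rule piecewise_affine_vertex_eqI[OF u piecewise_affine_sum[OF hat_piecewise_affine]])
  fix b assume b: "b \<in> mesh_vertices \<T>"
  have "(\<Sum>a\<in>interior_vertices \<Omega> \<T>. u a * hat a b) = (\<Sum>a\<in>interior_vertices \<Omega> \<T>. if a = b then u b else 0)"
    using b by (intro sum.cong) (auto simp: hat_vertex)
  also have "\<dots> = (if b \<in> interior_vertices \<Omega> \<T> then u b else 0)"
    using finite_interior_vertices by simp
  also have "\<dots> = u b" using b u by (auto simp: interior_vertices_def piecewise_affine_def)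
  finally show "u b = (\<Sum>a\<in>interior_vertices \<Omega> \<T>. u a * hat a b)" ..
qed

text \<open>\<open>hat a\<close> shows that the choice defining the nodal function is realised.
  Conversely, any admissible choice has a piecewise affine representative, equals it on the closed
  domain by continuity, and is then fixed by its vertex values.\<close>

lemma nodal_basis_fun_eq_hat:
  assumes a: "a \<in> interior_vertices \<Omega> \<T>" and x: "x \<in> closure \<Omega>"
  shows "nodal_basis_fun \<Omega> \<T> a x = hat a x"
proof -
  define \<phi> where "\<phi> = nodal_basis_fun \<Omega> \<T> a"
  have aV: "a \<in> mesh_vertices \<T>" using a by (simp add: interior_vertices_def)
  have "\<exists>\<phi>. \<phi> \<in> fe_space \<Omega> \<T> \<and> continuous_on (closure \<Omega>) \<phi> \<and> \<phi> a = 1 \<and> (\<forall>b\<in>mesh_vertices \<T> - {a}. \<phi> b = 0)"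
    using piecewise_affine_fe_space[OF hat_piecewise_affine[OF a]] aV
      continuous_on_subset[OF piecewise_affine_continuous[OF hat_piecewise_affine[OF a]] subset_UNIV]
    by (intro exI[of _ "hat a"]) (simp add: hat_vertex[OF a])
  then have \<phi>: "\<phi> \<in> fe_space \<Omega> \<T>" "continuous_on (closure \<Omega>) \<phi>" "\<phi> a = 1" "\<forall>b\<in>mesh_vertices \<T> - {a}. \<phi> b = 0"
    unfolding \<phi>_def nodal_basis_fun_def by (rule someI2_ex, blast)+
  obtain u where u: "piecewise_affine \<Omega> \<T> u" "eq_ae \<Omega> \<phi> u" using fe_space_piecewise_affine[OF \<phi>(1)] by blast
  have eq: "\<phi> y = u y" if "y \<in> closure \<Omega>" for y
    by (rule AE_eq_continuous_imp_eq[OF open_domain \<phi>(2) _ u(2)[unfolded eq_ae_def] that])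
       (rule continuous_on_subset[OF piecewise_affine_continuous[OF u(1)] subset_UNIV])
  have "u = hat a"
  proof (rule piecewise_affine_vertex_eqI[OF u(1) hat_piecewise_affine[OF a]])
    fix b assume b: "b \<in> mesh_vertices \<T>"
    then have "b \<in> closure \<Omega>" using vertex_closure closure_element_subset by (auto simp: mesh_vertices_def)
    then show "u b = hat a b" using eq[of b] \<phi>(3,4) b hat_vertex[OF a b] by auto
  qed
  then show ?thesis using eq[OF x] by (simp add: \<phi>_def)
qed

section \<open>Norms of hat functions and the mass matrix\<close>

lemma integral_elements:
  fixes f :: "'a \<Rightarrow> real"
  assumes "integrable (lebesgue_on \<Omega>) f"
  shows "(LINT x|lebesgue_on \<Omega>. f x) = (\<Sum>\<tau>\<in>\<T>. LINT x|lebesgue. indicator (closure \<tau>) x * f x)"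
proof -
  have int: "integrable lebesgue (\<lambda>x. indicator \<Omega> x * f x)"
    using assms by (simp add: lebesgue_on_integrable_iff[OF sets_domain])
  have int\<tau>: "integrable lebesgue (\<lambda>x. indicator \<tau> x * f x)" if \<tau>: "\<tau> \<in> \<T>" for \<tau>
  proof -
    have "integrable lebesgue (\<lambda>x. (indicator \<Omega> x * f x) * indicator \<tau> x)"
      by (rule integrable_real_mult_indicator[OF sets_element[OF \<tau>] int])
    moreover have "(\<lambda>x. (indicator \<Omega> x * f x) * indicator \<tau> x) = (\<lambda>x. indicator \<tau> x * f x)"
      using element_subset[OF \<tau>] by (auto simp: indicator_def fun_eq_iff)
    ultimately show ?thesis by simp
  qed
  have "AE x in lebesgue. indicator \<Omega> x * f x = (\<Sum>\<tau>\<in>\<T>. indicator \<tau> x * f x)"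
    using AE_element
  proof eventually_elim
    fix x assume x: "x \<in> closure \<Omega> \<longrightarrow> (\<exists>\<tau>\<in>\<T>. x \<in> \<tau>)"
    show "indicator \<Omega> x * f x = (\<Sum>\<tau>\<in>\<T>. indicator \<tau> x * f x)"
    proof (cases "x \<in> \<Omega>")
      case True
      then obtain \<tau> where \<tau>: "\<tau> \<in> \<T>" "x \<in> \<tau>" using x closure_subset by blast
      have "indicator \<tau>' x * f x = (if \<tau>' = \<tau> then f x else 0)" if "\<tau>' \<in> \<T>" for \<tau>'
        using disjoint_elements[OF \<tau>(1) that \<tau>(2)] \<tau>(2) by (cases "x \<in> \<tau>'") auto
      then have "(\<Sum>\<tau>\<in>\<T>. indicator \<tau> x * f x) = (\<Sum>\<tau>'\<in>\<T>. if \<tau>' = \<tau> then f x else 0)" by (intro sum.cong) auto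
      then show ?thesis using True \<tau> finite_mesh by simp
    next
      case False
      then show ?thesis by (auto simp: indicator_def intro!: sum.neutral dest: element_subset[THEN subsetD])
    qed
  qed
  then have "(LINT x|lebesgue_on \<Omega>. f x) = (LINT x|lebesgue. (\<Sum>\<tau>\<in>\<T>. indicator \<tau> x * f x))"
    unfolding lebesgue_on_integral_eq[OF sets_domain]
    using int int\<tau> by (intro integral_cong_AE borel_measurable_integrable Bochner_Integration.integrable_sum)
  also have "\<dots> = (\<Sum>\<tau>\<in>\<T>. LINT x|lebesgue. indicator \<tau> x * f x)"
    using int\<tau> by (rule Bochner_Integration.integral_sum)
  \<comment> \<open>The moments are computed over closed simplices; the boundaries added here are
    null.\<close>
  also have "\<dots> = (\<Sum>\<tau>\<in>\<T>. LINT x|lebesgue. indicator (closure \<tau>) x * f x)"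
  proof (intro sum.cong refl)
    fix \<tau> assume \<tau>: "\<tau> \<in> \<T>"
    have "AE x in lebesgue. x \<notin> closure \<tau> - \<tau>"
      using negligible_element_boundary[OF \<tau>] unfolding negligible_iff_null_sets by (rule AE_not_in)
    then have ae: "AE x in lebesgue. indicator \<tau> x * f x = indicator (closure \<tau>) x * f x"
      by eventually_elim (use closure_subset[of \<tau>] in \<open>auto simp: indicator_def\<close>)
    show "(LINT x|lebesgue. indicator \<tau> x * f x) = (LINT x|lebesgue. indicator (closure \<tau>) x * f x)"
      using ae borel_measurable_integrable[OF int\<tau>[OF \<tau>]]
      by (intro integral_cong_AE) (auto intro: borel_measurable_AE)
  qed
  finally show ?thesis .
qed

text \<open>The integral over the element of a product of two different barycentric
  coordinates.\<close>

definition weight where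
  "weight \<tau> = measure lebesgue (closure \<tau>) / ((real DIM('a) + 1) * (real DIM('a) + 2))"

lemma weight_pos: assumes "\<tau> \<in> \<T>" shows "weight \<tau> > 0"
proof -
  have "\<not> negligible \<tau>" using open_not_negligible[OF open_element[OF assms]] element_simplex(5)[OF assms] by blast
  then have "\<not> negligible (closure \<tau>)" using closure_subset negligible_subset by blast
  moreover have "closure \<tau> \<in> lmeasurable"
    using bounded_element[OF assms] by (simp add: lmeasurable_compact compact_closure)
  ultimately have "measure lebesgue (closure \<tau>) > 0"
    by (simp add: negligible_iff_measure zero_less_measure_iff less_le)
  then show ?thesis by (simp add: weight_def)
qed

lemma L2_piecewise_affine:
  assumes u: "piecewise_affine \<Omega> \<T> u"
  shows "L2_inner \<Omega> u u = (\<Sum>\<tau>\<in>\<T>. weight \<tau> * ((\<Sum>b\<in>vertices \<tau>. (u b)\<^sup>2) + (\<Sum>b\<in>vertices \<tau>. u b)\<^sup>2))"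
proof -
  have s: "square_integrable \<Omega> u" by (rule piecewise_affine_square_integrable[OF u])
  have "L2_inner \<Omega> u u = (\<Sum>\<tau>\<in>\<T>. LINT x|lebesgue. indicator (closure \<tau>) x * (u x * u x))"
    unfolding L2_inner_def using integral_elements[OF square_integrable_inner[OF s s]] by simp
  also have "\<dots> = (\<Sum>\<tau>\<in>\<T>. weight \<tau> * ((\<Sum>b\<in>vertices \<tau>. (u b)\<^sup>2) + (\<Sum>b\<in>vertices \<tau>. u b)\<^sup>2))"
  proof (intro sum.cong refl)
    fix \<tau> assume \<tau>: "\<tau> \<in> \<T>"
    interpret simplex_nodes "vertices \<tau>" by (rule simplex_nodes[OF \<tau>])
    obtain g c where gc: "\<forall>x\<in>closure \<tau>. u x = g \<bullet> x + c" using u \<tau> unfolding piecewise_affine_def by blast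
    have "(LINT x|lebesgue. indicator (closure \<tau>) x * (u x * u x)) =
        (LINT x|lebesgue. indicator (closure \<tau>) x * ((g \<bullet> x + c) * (g \<bullet> x + c)))"
      by (rule Bochner_Integration.integral_cong) (use gc in \<open>auto simp: indicator_def\<close>)
    also have "\<dots> = weight \<tau> * ((\<Sum>b\<in>vertices \<tau>. (g \<bullet> b + c)\<^sup>2) + (\<Sum>b\<in>vertices \<tau>. g \<bullet> b + c)\<^sup>2)"
      using moment_affine_square[OF refl, of g c] by (simp add: weight_def element_simplex(1)[OF \<tau>, symmetric])
    also have "\<dots> = weight \<tau> * ((\<Sum>b\<in>vertices \<tau>. (u b)\<^sup>2) + (\<Sum>b\<in>vertices \<tau>. u b)\<^sup>2)"
      using gc vertex_closure[OF \<tau>] by (simp cong: sum.cong)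
    finally show "(LINT x|lebesgue. indicator (closure \<tau>) x * (u x * u x)) =
      weight \<tau> * ((\<Sum>b\<in>vertices \<tau>. (u b)\<^sup>2) + (\<Sum>b\<in>vertices \<tau>. u b)\<^sup>2)" .
  qed
  finally show ?thesis .
qed

text \<open>A single nodal value one contributes once to the sum of squares and once to the squared
  sum, whence the factor \<open>2\<close>.\<close>

lemma L2_hat:
  assumes a: "a \<in> interior_vertices \<Omega> \<T>"
  shows "L2_inner \<Omega> (hat a) (hat a) = (\<Sum>\<tau>\<in>{\<tau> \<in> \<T>. a \<in> vertices \<tau>}. 2 * weight \<tau>)"
proof -
  have "(\<Sum>b\<in>vertices \<tau>. (hat a b)\<^sup>2) + (\<Sum>b\<in>vertices \<tau>. hat a b)\<^sup>2 = (if a \<in> vertices \<tau> then 2 else 0)"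
    if \<tau>: "\<tau> \<in> \<T>" for \<tau>
  proof -
    have v: "hat a b = (if b = a then 1 else 0)" if "b \<in> vertices \<tau>" for b
      by (rule hat_vertex[OF a]) (use \<tau> that in \<open>auto simp: mesh_vertices_def\<close>)
    have "(\<Sum>b\<in>vertices \<tau>. (hat a b)\<^sup>2) = (\<Sum>b\<in>vertices \<tau>. if b = a then 1 else 0)"
      "(\<Sum>b\<in>vertices \<tau>. hat a b) = (\<Sum>b\<in>vertices \<tau>. if b = a then 1 else 0)"
      using v by (auto intro!: sum.cong)
    then show ?thesis using finite_vertices[OF \<tau>] by simp
  qed
  then have "L2_inner \<Omega> (hat a) (hat a) = (\<Sum>\<tau>\<in>\<T>. if a \<in> vertices \<tau> then 2 * weight \<tau> else 0)"
    unfolding L2_piecewise_affine[OF hat_piecewise_affine[OF a]] by (intro sum.cong) auto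
  then show ?thesis using finite_mesh by (simp add: sum.inter_filter)
qed

lemma L2_hat_pos: assumes a: "a \<in> interior_vertices \<Omega> \<T>" shows "L2_inner \<Omega> (hat a) (hat a) > 0"
proof -
  have "{\<tau> \<in> \<T>. a \<in> vertices \<tau>} \<noteq> {}" using a by (auto simp: interior_vertices_def mesh_vertices_def)
  then show ?thesis unfolding L2_hat[OF a] using weight_pos finite_mesh by (intro sum_pos) auto
qed

text \<open>Taking the interior in \<open>vertex_patch\<close> loses only part of the element
  boundaries, and distinct closed elements overlap in a null set; so the measures add up.\<close>

lemma measure_vertex_patch:
  "2 * measure lebesgue (vertex_patch \<T> a) / ((real DIM('a) + 1) * (real DIM('a) + 2)) =
    (\<Sum>\<tau>\<in>{\<tau> \<in> \<T>. a \<in> vertices \<tau>}. 2 * weight \<tau>)"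
proof -
  define P where "P = {\<tau> \<in> \<T>. a \<in> vertices \<tau>}"
  have finP: "finite P" and PT: "\<And>\<tau>. \<tau> \<in> P \<Longrightarrow> \<tau> \<in> \<T>" using finite_mesh by (auto simp: P_def)
  have cl: "closure \<tau> \<in> lmeasurable" if "\<tau> \<in> P" for \<tau>
    using bounded_element[OF PT[OF that]] by (simp add: lmeasurable_compact compact_closure)
  have disj: "negligible (closure \<tau> \<inter> closure \<tau>')" if "\<tau> \<in> P" "\<tau>' \<in> P" "\<tau> \<noteq> \<tau>'" for \<tau> \<tau>'
  proof -
    have "closure \<tau> \<inter> closure \<tau>' \<subseteq> (closure \<tau> - \<tau>) \<union> (closure \<tau>' - \<tau>')"
      using disjoint_elements[OF PT PT] that by blast
    then show ?thesis
      using negligible_element_boundary PT that negligible_Un negligible_subset by meson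
  qed
  have "negligible (\<Union>\<tau>\<in>P. closure \<tau> - \<tau>)"
    using finP negligible_element_boundary PT by (intro negligible_Union) auto
  then have "AE x in lebesgue. x \<notin> (\<Union>\<tau>\<in>P. closure \<tau> - \<tau>)"
    unfolding negligible_iff_null_sets by (rule AE_not_in)
  then have ae: "AE x in lebesgue. x \<in> vertex_patch \<T> a \<longleftrightarrow> x \<in> (\<Union>\<tau>\<in>P. closure \<tau>)"
  proof eventually_elim
    fix x assume x: "x \<notin> (\<Union>\<tau>\<in>P. closure \<tau> - \<tau>)"
    have "(\<Union>\<tau>\<in>P. \<tau>) \<subseteq> vertex_patch \<T> a"
      unfolding vertex_patch_def P_def[symmetric]
      by (rule interior_maximal) (use closure_subset open_element PT in \<open>auto intro!: open_Union\<close>)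
    moreover have "vertex_patch \<T> a \<subseteq> (\<Union>\<tau>\<in>P. closure \<tau>)"
      unfolding vertex_patch_def P_def[symmetric] by (rule interior_subset)
    ultimately show "x \<in> vertex_patch \<T> a \<longleftrightarrow> x \<in> (\<Union>\<tau>\<in>P. closure \<tau>)" using x by blast
  qed
  have "measure lebesgue (vertex_patch \<T> a) = measure lebesgue (\<Union>\<tau>\<in>P. closure \<tau>)"
    by (rule measure_eq_AE[OF ae]) (use cl finP in \<open>auto simp: vertex_patch_def borel_open intro!: sets.finite_UN fmeasurableD\<close>)
  also have "\<dots> = (\<Sum>\<tau>\<in>P. measure lebesgue (closure \<tau>))"
    by (rule measure_negligible_finite_Union_image[OF finP cl]) (use disj in \<open>auto simp: pairwise_def\<close>)
  finally show ?thesis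
    by (simp add: P_def weight_def sum_distrib_left sum_divide_distrib)
qed

text \<open>The reason for the normalisation of \<open>eta\<close>: it is the squared norm of the
  hat function in units of the mesh size to the power \<open>d\<close>.\<close>

lemma L2_hat_eta:
  assumes "a \<in> interior_vertices \<Omega> \<T>" "mesh_size \<T> > 0"
  shows "L2_inner \<Omega> (hat a) (hat a) = eta \<T> a * mesh_size \<T> ^ DIM('a)"
  using assms(2) by (simp add: L2_hat[OF assms(1)] measure_vertex_patch[symmetric] eta_def)

text \<open>Exchange of the sums over vertices and elements; vertices that are not interior may be
  added since \<open>u\<close> vanishes there.\<close>

lemma sum_hat_norms:
  assumes u: "piecewise_affine \<Omega> \<T> u"
  shows "(\<Sum>a\<in>interior_vertices \<Omega> \<T>. (u a)\<^sup>2 * L2_inner \<Omega> (hat a) (hat a)) =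
    (\<Sum>\<tau>\<in>\<T>. 2 * weight \<tau> * (\<Sum>b\<in>vertices \<tau>. (u b)\<^sup>2))"
proof -
  let ?I = "interior_vertices \<Omega> \<T>"
  have "(\<Sum>a\<in>?I. (u a)\<^sup>2 * L2_inner \<Omega> (hat a) (hat a)) = (\<Sum>a\<in>?I. \<Sum>\<tau>\<in>\<T>. if a \<in> vertices \<tau> then 2 * weight \<tau> * (u a)\<^sup>2 else 0)"
  proof (intro sum.cong refl)
    fix a assume "a \<in> ?I"
    then show "(u a)\<^sup>2 * L2_inner \<Omega> (hat a) (hat a) = (\<Sum>\<tau>\<in>\<T>. if a \<in> vertices \<tau> then 2 * weight \<tau> * (u a)\<^sup>2 else 0)"
      using finite_mesh by (auto simp: L2_hat sum.inter_filter sum_distrib_left intro!: sum.cong)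
  qed
  also have "\<dots> = (\<Sum>\<tau>\<in>\<T>. \<Sum>a\<in>?I. if a \<in> vertices \<tau> then 2 * weight \<tau> * (u a)\<^sup>2 else 0)"
    by (rule sum.swap)
  also have "\<dots> = (\<Sum>\<tau>\<in>\<T>. 2 * weight \<tau> * (\<Sum>b\<in>vertices \<tau>. (u b)\<^sup>2))"
  proof (intro sum.cong refl)
    fix \<tau> assume \<tau>: "\<tau> \<in> \<T>"
    have "(\<Sum>a\<in>?I. if a \<in> vertices \<tau> then 2 * weight \<tau> * (u a)\<^sup>2 else 0) = (\<Sum>a\<in>{a \<in> ?I. a \<in> vertices \<tau>}. 2 * weight \<tau> * (u a)\<^sup>2)"
      using finite_interior_vertices by (simp add: sum.inter_filter)
    also have "\<dots> = (\<Sum>a\<in>vertices \<tau>. 2 * weight \<tau> * (u a)\<^sup>2)"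
      by (rule sum.mono_neutral_left)
         (use finite_vertices[OF \<tau>] u \<tau> in \<open>auto simp: interior_vertices_def mesh_vertices_def piecewise_affine_def\<close>)
    finally show "(\<Sum>a\<in>?I. if a \<in> vertices \<tau> then 2 * weight \<tau> * (u a)\<^sup>2 else 0) = 2 * weight \<tau> * (\<Sum>b\<in>vertices \<tau>. (u b)\<^sup>2)"
      by (simp add: sum_distrib_left)
  qed
  finally show ?thesis .
qed

text \<open>On each element the mass matrix is \<open>weight \<tau>\<close> times the identity plus the matrix of ones,
  so relative to its diagonal its eigenvalues are \<open>1/2\<close> and \<open>(d + 2)/2\<close>.\<close>

lemma mass_bounds:
  assumes u: "piecewise_affine \<Omega> \<T> u"
  defines "N \<equiv> (\<Sum>a\<in>interior_vertices \<Omega> \<T>. (u a)\<^sup>2 * L2_inner \<Omega> (hat a) (hat a))"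
  shows "N \<le> 2 * L2_inner \<Omega> u u" "L2_inner \<Omega> u u \<le> (real DIM('a) + 2) / 2 * N"
proof -
  \<comment> \<open>Elementwise, the square of the sum of nodal values is dropped.\<close>
  show "N \<le> 2 * L2_inner \<Omega> u u"
    unfolding N_def sum_hat_norms[OF u] L2_piecewise_affine[OF u] sum_distrib_left
    using weight_pos by (intro sum_mono) (simp add: less_imp_le flip: sum_distrib_left)
  show "L2_inner \<Omega> u u \<le> (real DIM('a) + 2) / 2 * N"
    unfolding N_def sum_hat_norms[OF u] L2_piecewise_affine[OF u] sum_distrib_left[of "(real DIM('a) + 2) / 2"]
  proof (rule sum_mono)
    fix \<tau> assume \<tau>: "\<tau> \<in> \<T>"
    \<comment> \<open>Cauchy-Schwarz over the \<open>d + 1\<close> vertices. With the sum of squares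
      this gives \<open>d + 2\<close>, halved because the diagonal entries are twice
      \<open>weight \<tau>\<close>.\<close>
    have "(\<Sum>b\<in>vertices \<tau>. u b)\<^sup>2 \<le> (real DIM('a) + 1) * (\<Sum>b\<in>vertices \<tau>. (u b)\<^sup>2)"
      using sum_squared_le_sum_of_squares[of u "vertices \<tau>"] element_simplex(3)[OF \<tau>] finite_vertices[OF \<tau>]
      by (simp add: mult.commute add.commute)
    then have "(\<Sum>b\<in>vertices \<tau>. (u b)\<^sup>2) + (\<Sum>b\<in>vertices \<tau>. u b)\<^sup>2 \<le> (real DIM('a) + 2) * (\<Sum>b\<in>vertices \<tau>. (u b)\<^sup>2)"
      by (simp add: algebra_simps)
    from mult_left_mono[OF this, of "weight \<tau>"]
    show "weight \<tau> * ((\<Sum>b\<in>vertices \<tau>. (u b)\<^sup>2) + (\<Sum>b\<in>vertices \<tau>. u b)\<^sup>2) \<le>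
        (real DIM('a) + 2) / 2 * (2 * weight \<tau> * (\<Sum>b\<in>vertices \<tau>. (u b)\<^sup>2))"
      using weight_pos[OF \<tau>] by (simp add: mult_ac)
  qed
qed

end

subsection \<open>Operators on finite-dimensional subspaces\<close>

text \<open>One unknown \<open>s\<close> is eliminated per induction step; positivity of the form
  makes the resulting pivot, the Schur complement \<open>\<pi>\<close>, positive.\<close>

lemma positive_definite_system_solvable:
  fixes M :: "'i \<Rightarrow> 'i \<Rightarrow> real"
  assumes "finite I" "\<And>c. \<exists>i\<in>I. c i \<noteq> 0 \<Longrightarrow> 0 < (\<Sum>i\<in>I. \<Sum>j\<in>I. c i * (M i j * c j))"
  shows "\<exists>c. \<forall>i\<in>I. (\<Sum>j\<in>I. M i j * c j) = b i"
  using assms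
proof (induction I arbitrary: b rule: finite_induct)
  case (insert s I)
  have pd: "0 < (\<Sum>i\<in>I. \<Sum>j\<in>I. c i * (M i j * c j))" if "\<exists>i\<in>I. c i \<noteq> 0" for c :: "'i \<Rightarrow> real"
  proof -
    define c' where "c' = c(s := 0)"
    have c': "c' s = 0" "\<And>i. i \<in> I \<Longrightarrow> c' i = c i" using insert.hyps by (auto simp: c'_def)
    have "0 < (\<Sum>i\<in>insert s I. \<Sum>j\<in>insert s I. c' i * (M i j * c' j))"
      by (rule insert.prems) (use that c' in auto)
    then show ?thesis using insert.hyps c' by (simp cong: sum.cong)
  qed
  have IH: "\<exists>c. \<forall>i\<in>I. (\<Sum>j\<in>I. M i j * c j) = b i" for b
    by (rule insert.IH) (rule pd)
  obtain p where p: "\<forall>i\<in>I. (\<Sum>j\<in>I. M i j * p j) = M i s" using IH[of "\<lambda>i. M i s"] by blast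
  obtain u where u: "\<forall>i\<in>I. (\<Sum>j\<in>I. M i j * u j) = b i" using IH[of b] by blast
  \<comment> \<open>All rows of the matrix except row \<open>s\<close> annihilate \<open>e\<close>.
    Hence the form at \<open>e\<close> equals \<open>\<pi>\<close>, and multiples of
    \<open>e\<close> correct row \<open>s\<close> without disturbing the others.\<close>
  define e where "e = (\<lambda>j. if j = s then 1 else - p j)"
  have row: "(\<Sum>j\<in>insert s I. M i j * e j) = M i s - (\<Sum>j\<in>I. M i j * p j)" for i
  proof -
    have "(\<Sum>j\<in>I. M i j * e j) = - (\<Sum>j\<in>I. M i j * p j)"
      unfolding sum_negf[symmetric] using insert.hyps by (intro sum.cong) (auto simp: e_def)
    then show ?thesis using insert.hyps by (simp add: e_def)
  qed
  define \<pi> where "\<pi> = M s s - (\<Sum>j\<in>I. M s j * p j)"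
  have "0 < (\<Sum>i\<in>insert s I. \<Sum>j\<in>insert s I. e i * (M i j * e j))"
    by (rule insert.prems) (auto simp: e_def)
  also have "\<dots> = (\<Sum>i\<in>insert s I. e i * (\<Sum>j\<in>insert s I. M i j * e j))"
    by (simp only: sum_distrib_left)
  also have "\<dots> = (\<Sum>i\<in>insert s I. e i * (M i s - (\<Sum>j\<in>I. M i j * p j)))"
    by (simp only: row)
  also have "\<dots> = \<pi>"
    using insert.hyps p by (simp add: e_def \<pi>_def)
  finally have \<pi>: "\<pi> > 0" .
  \<comment> \<open>The residual of \<open>u\<close> in row \<open>s\<close>, divided by the
    pivot.\<close>
  define t where "t = (b s - (\<Sum>j\<in>I. M s j * u j)) / \<pi>"
  define c where "c = (\<lambda>j. (if j = s then 0 else u j) + t * e j)"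
  have "(\<Sum>j\<in>insert s I. M i j * c j) = (\<Sum>j\<in>I. M i j * u j) + t * (M i s - (\<Sum>j\<in>I. M i j * p j))" for i
  proof -
    have "(\<Sum>j\<in>insert s I. M i j * c j) = (\<Sum>j\<in>insert s I. M i j * (if j = s then 0 else u j)) + t * (\<Sum>j\<in>insert s I. M i j * e j)"
      by (simp only: c_def distrib_left sum.distrib sum_distrib_left mult.left_commute[of t])
    also have "(\<Sum>j\<in>insert s I. M i j * (if j = s then 0 else u j)) = (\<Sum>j\<in>I. M i j * u j)"
      using insert.hyps by (auto intro!: sum.cong)
    finally show ?thesis by (simp only: row)
  qed
  then have "(\<Sum>j\<in>insert s I. M i j * c j) = b i" if "i \<in> insert s I" for i
    using that p u \<pi> by (auto simp: t_def \<pi>_def)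
  then show ?case by blast
qed simp

text \<open>Finite-dimensional only modulo null sets: expansions hold almost everywhere, so
  \<open>V\<close> may contain every function equal to a combination off a null set.
  \<open>coeff_bound\<close> is linear independence of the basis in quantitative form.\<close>

locale fin_subspace =
  fixes \<Omega> :: "'a::euclidean_space set" and V :: "('a \<Rightarrow> real) set" and \<phi> :: "'i \<Rightarrow> 'a \<Rightarrow> real"
    and I :: "'i set" and \<kappa> :: "'i \<Rightarrow> real"
  assumes sq: "v \<in> V \<Longrightarrow> square_integrable \<Omega> v"
    and add: "u \<in> V \<Longrightarrow> v \<in> V \<Longrightarrow> (\<lambda>x. u x + v x) \<in> V"
    and scale: "v \<in> V \<Longrightarrow> (\<lambda>x. k * v x) \<in> V"
    and finI: "finite I" and \<phi>: "i \<in> I \<Longrightarrow> \<phi> i \<in> V"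
    and zero: "(\<lambda>x. 0) \<in> V"
    and expand: "v \<in> V \<Longrightarrow> \<exists>c. AE x in lebesgue_on \<Omega>. v x = (\<Sum>i\<in>I. c i * \<phi> i x)"
    and coeff_bound: "i \<in> I \<Longrightarrow> (c i)\<^sup>2 \<le> \<kappa> i * L2_inner \<Omega> (\<lambda>x. \<Sum>i\<in>I. c i * \<phi> i x) (\<lambda>x. \<Sum>i\<in>I. c i * \<phi> i x)"
begin

abbreviation ip where "ip \<equiv> L2_inner \<Omega>"

lemma combination: "(\<And>i. i \<in> J \<Longrightarrow> f i \<in> V) \<Longrightarrow> (\<lambda>x. \<Sum>i\<in>J. c i * f i x) \<in> V"
proof (induction J rule: infinite_finite_induct)
  case (insert i J)
  have "(\<lambda>x. c i * f i x + (\<Sum>i\<in>J. c i * f i x)) \<in> V"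
    by (rule add[OF scale insert.IH]) (use insert.prems in auto)
  then show ?case using insert.hyps by simp
qed (simp_all add: zero)

lemma diff: "u \<in> V \<Longrightarrow> v \<in> V \<Longrightarrow> (\<lambda>x. u x - v x) \<in> V"
  using add[OF _ scale[of v "-1"]] by simp

lemma ip_combination:
  assumes "\<And>i. i \<in> J \<Longrightarrow> f i \<in> V" "w \<in> V"
  shows "ip (\<lambda>x. \<Sum>i\<in>J. c i * f i x) w = (\<Sum>i\<in>J. c i * ip (f i) w)"
proof -
  have "ip (\<lambda>x. \<Sum>i\<in>J. c i * f i x) w = (\<Sum>i\<in>J. ip (\<lambda>x. c i * f i x) w)"
    using assms by (intro L2_inner_sum_left sq scale)
  then show ?thesis by (simp add: L2_inner_mult_left)
qed

lemma ip_expand: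
  assumes "v \<in> V" "w \<in> V" "AE x in lebesgue_on \<Omega>. w x = (\<Sum>i\<in>I. c i * \<phi> i x)"
  shows "ip v w = (\<Sum>i\<in>I. c i * ip v (\<phi> i))"
proof -
  have "ip v w = ip v (\<lambda>x. \<Sum>i\<in>I. c i * \<phi> i x)"
    using assms by (intro L2_inner_cong_AE sq combination \<phi>) auto
  then show ?thesis
    using ip_combination[OF \<phi> assms(1), where J = I] by (simp add: L2_inner_commute[of \<Omega> v])
qed

text \<open>The difference is orthogonal to the basis, hence to itself.\<close>

lemma eq_ae_if_orthogonal:
  assumes "u \<in> V" "v \<in> V" "\<And>i. i \<in> I \<Longrightarrow> ip u (\<phi> i) = ip v (\<phi> i)"
  shows "AE x in lebesgue_on \<Omega>. u x = v x"
proof -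
  define w where "w = (\<lambda>x. u x - v x)"
  have w: "w \<in> V" unfolding w_def by (rule diff[OF assms(1,2)])
  have "ip w (\<phi> i) = 0" if "i \<in> I" for i
    unfolding w_def using L2_inner_diff_left[OF sq[OF assms(1)] sq[OF assms(2)] sq[OF \<phi>[OF that]]] assms(3)[OF that] by simp
  moreover obtain c where "AE x in lebesgue_on \<Omega>. w x = (\<Sum>i\<in>I. c i * \<phi> i x)" using expand[OF w] by blast
  ultimately have "ip w w = 0" using ip_expand[OF w w] by simp
  then have "AE x in lebesgue_on \<Omega>. w x = 0" using L2_inner_eq_0_iff[OF sq[OF w]] by simp
  then show ?thesis by eventually_elim (simp add: w_def)
qed

text \<open>Stated through the form, since operators built from \<open>L2_proj\<close> return chosen
  representatives and are linear only modulo null sets. Symmetry implies linearity in the weak sense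
  of \<open>spd_combination\<close>.\<close>

definition spd where
  "spd M \<longleftrightarrow> (\<forall>u\<in>V. M u \<in> V) \<and> (\<forall>u\<in>V. \<forall>w\<in>V. ip (M u) w = ip (M w) u) \<and>
     (\<exists>\<mu>>0. \<forall>u\<in>V. \<mu> * ip u u \<le> ip (M u) u)"

text \<open>Symmetry moves \<open>M\<close> to the other argument; the combination then stands in an
  inner product, which is linear.\<close>

lemma spd_combination:
  assumes "spd M" "\<And>i. i \<in> J \<Longrightarrow> f i \<in> V" "w \<in> V"
  shows "ip (M (\<lambda>x. \<Sum>i\<in>J. c i * f i x)) w = (\<Sum>i\<in>J. c i * ip (M (f i)) w)"
proof -
  have "ip (M (\<lambda>x. \<Sum>i\<in>J. c i * f i x)) w = ip (M w) (\<lambda>x. \<Sum>i\<in>J. c i * f i x)"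
    using assms combination[of J f c] by (simp add: spd_def)
  also have "\<dots> = (\<Sum>i\<in>J. c i * ip (f i) (M w))"
    unfolding L2_inner_commute[of \<Omega> "M w"] using assms by (intro ip_combination) (auto simp: spd_def)
  also have "\<dots> = (\<Sum>i\<in>J. c i * ip (M (f i)) w)"
    using assms by (intro sum.cong refl) (simp add: spd_def L2_inner_commute[of \<Omega> "f _"])
  finally show ?thesis .
qed

lemma spd_nonneg: "spd M \<Longrightarrow> u \<in> V \<Longrightarrow> 0 \<le> ip (M u) u"
  unfolding spd_def using L2_inner_nonneg[of \<Omega> u] by (meson dual_order.trans less_imp_le mult_nonneg_nonneg)

text \<open>The Galerkin system for the coefficients. It is positive definite because
  \<open>M\<close> is coercive and \<open>coeff_bound\<close> excludes a null combination with a
  nonzero coefficient.\<close>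

lemma spd_solvable:
  assumes M: "spd M"
  obtains u where "u \<in> V" "\<And>i. i \<in> I \<Longrightarrow> ip (M u) (\<phi> i) = b i"
proof -
  obtain \<mu> where \<mu>: "\<mu> > 0" "\<And>u. u \<in> V \<Longrightarrow> \<mu> * ip u u \<le> ip (M u) u" using M unfolding spd_def by blast
  have "\<exists>c. \<forall>i\<in>I. (\<Sum>j\<in>I. ip (M (\<phi> j)) (\<phi> i) * c j) = b i"
  proof (rule positive_definite_system_solvable[OF finI])
    fix c :: "'i \<Rightarrow> real" assume "\<exists>i\<in>I. c i \<noteq> 0"
    then obtain k where k: "k \<in> I" "c k \<noteq> 0" by blast
    define u where "u = (\<lambda>x. \<Sum>i\<in>I. c i * \<phi> i x)"
    have u: "u \<in> V" unfolding u_def by (intro combination \<phi>)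
    have "0 < (c k)\<^sup>2" using k by simp
    also have "\<dots> \<le> \<kappa> k * ip u u" unfolding u_def by (rule coeff_bound[OF k(1)])
    finally have "ip u u > 0" using L2_inner_nonneg[of \<Omega> u] by (cases "ip u u = 0") auto
    then have "0 < \<mu> * ip u u" using \<mu>(1) by simp
    also have "\<dots> \<le> ip (M u) u" by (rule \<mu>(2)[OF u])
    also have "\<dots> = (\<Sum>j\<in>I. c j * ip (M (\<phi> j)) u)"
      unfolding u_def by (rule spd_combination[OF M \<phi> u[unfolded u_def]])
    also have "\<dots> = (\<Sum>j\<in>I. c j * (\<Sum>i\<in>I. c i * ip (M (\<phi> j)) (\<phi> i)))"
    proof (intro sum.cong refl)
      fix j assume "j \<in> I"
      then have "M (\<phi> j) \<in> V" using M \<phi> by (simp add: spd_def)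
      then show "c j * ip (M (\<phi> j)) u = c j * (\<Sum>i\<in>I. c i * ip (M (\<phi> j)) (\<phi> i))"
        using ip_expand[OF _ u, of "M (\<phi> j)" c] by (simp add: u_def)
    qed
    also have "\<dots> = (\<Sum>j\<in>I. \<Sum>i\<in>I. c i * (ip (M (\<phi> j)) (\<phi> i) * c j))"
      by (simp add: sum_distrib_left mult_ac)
    also have "\<dots> = (\<Sum>i\<in>I. \<Sum>j\<in>I. c i * (ip (M (\<phi> j)) (\<phi> i) * c j))" by (rule sum.swap)
    finally show "0 < (\<Sum>i\<in>I. \<Sum>j\<in>I. c i * (ip (M (\<phi> j)) (\<phi> i) * c j))" .
  qed
  then obtain c where c: "\<And>i. i \<in> I \<Longrightarrow> (\<Sum>j\<in>I. ip (M (\<phi> j)) (\<phi> i) * c j) = b i" by blast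
  define u where "u = (\<lambda>x. \<Sum>i\<in>I. c i * \<phi> i x)"
  have "u \<in> V" unfolding u_def by (intro combination \<phi>)
  moreover have "ip (M u) (\<phi> i) = b i" if "i \<in> I" for i
  proof -
    have "ip (M u) (\<phi> i) = (\<Sum>j\<in>I. c j * ip (M (\<phi> j)) (\<phi> i))"
      unfolding u_def by (rule spd_combination[OF M \<phi> \<phi>[OF that]])
    then show ?thesis using c[OF that] by (simp add: mult.commute)
  qed
  ultimately show ?thesis by (rule that)
qed

lemma spd_id: "spd (\<lambda>u. u)"
  unfolding spd_def by (auto simp: L2_inner_commute intro: exI[of _ 1])

lemma riesz:
  obtains u where "u \<in> V" "\<And>i. i \<in> I \<Longrightarrow> ip u (\<phi> i) = b i"
proof -
  obtain u where "u \<in> V" "\<And>i. i \<in> I \<Longrightarrow> ip u (\<phi> i) = b i"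
    by (rule spd_solvable[OF spd_id, of b]) blast
  then show ?thesis by (rule that)
qed

text \<open>The Gram system shows that the choice in \<open>L2_proj\<close> is realised;
  \<open>v\<close> itself need not lie in \<open>V\<close>.\<close>

lemma L2_proj_spec:
  assumes "square_integrable \<Omega> v"
  shows "L2_proj \<Omega> V v \<in> V" "w \<in> V \<Longrightarrow> ip (L2_proj \<Omega> V v) w = ip v w"
proof -
  obtain u where u: "u \<in> V" "\<And>i. i \<in> I \<Longrightarrow> ip u (\<phi> i) = ip v (\<phi> i)"
    using riesz[of "\<lambda>i. ip v (\<phi> i)"] by blast
  have "ip (\<lambda>x. v x - u x) w = 0" if w: "w \<in> V" for w
  proof -
    obtain c where c: "AE x in lebesgue_on \<Omega>. w x = (\<Sum>i\<in>I. c i * \<phi> i x)" using expand[OF w] by blast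
    have s: "square_integrable \<Omega> (\<lambda>x. v x - u x)" by (rule square_integrable_diff[OF assms sq[OF u(1)]])
    have "ip (\<lambda>x. v x - u x) w = ip (\<lambda>x. v x - u x) (\<lambda>x. \<Sum>i\<in>I. c i * \<phi> i x)"
      by (rule L2_inner_cong_AE[OF s s sq[OF w] sq[OF combination[OF \<phi>]] _ c]) auto
    also have "\<dots> = (\<Sum>i\<in>I. ip (\<lambda>x. v x - u x) (\<lambda>x. c i * \<phi> i x))"
      by (rule L2_inner_sum_right[OF sq[OF scale[OF \<phi>]] s])
    also have "\<dots> = 0"
      using u by (intro sum.neutral ballI)
        (simp add: L2_inner_mult_right L2_inner_diff_left[OF assms sq[OF u(1)] sq[OF \<phi>]])
    finally show ?thesis .
  qed
  with u(1) have "\<exists>u. u \<in> V \<and> (\<forall>w\<in>V. ip (\<lambda>x. v x - u x) w = 0)" by blast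
  then have P: "L2_proj \<Omega> V v \<in> V \<and> (\<forall>w\<in>V. ip (\<lambda>x. v x - L2_proj \<Omega> V v x) w = 0)"
    unfolding L2_proj_def by (rule someI_ex)
  then show "L2_proj \<Omega> V v \<in> V" by blast
  show "ip (L2_proj \<Omega> V v) w = ip v w" if w: "w \<in> V"
    using P w L2_inner_diff_left[OF assms sq sq[OF w], of "L2_proj \<Omega> V v"] by simp
qed

text \<open>The Galerkin solution solves the equation almost everywhere, because \<open>M u\<close>
  and \<open>v\<close> both lie in \<open>V\<close> and agree when tested with the basis.\<close>

lemma inverse_op_spec:
  assumes M: "spd M" and v: "v \<in> V"
  shows "inverse_op \<Omega> V M v \<in> V" "AE x in lebesgue_on \<Omega>. M (inverse_op \<Omega> V M v) x = v x"
    "w \<in> V \<Longrightarrow> ip (M (inverse_op \<Omega> V M v)) w = ip v w"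
proof -
  obtain u where u: "u \<in> V" "\<And>i. i \<in> I \<Longrightarrow> ip (M u) (\<phi> i) = ip v (\<phi> i)"
    using spd_solvable[OF M, of "\<lambda>i. ip v (\<phi> i)"] by blast
  have "M u \<in> V" using M u by (simp add: spd_def)
  then have "eq_ae \<Omega> (M u) v" unfolding eq_ae_def using u v by (intro eq_ae_if_orthogonal)
  then have "\<exists>u. u \<in> V \<and> eq_ae \<Omega> (M u) v" using u(1) by blast
  then have P: "inverse_op \<Omega> V M v \<in> V \<and> eq_ae \<Omega> (M (inverse_op \<Omega> V M v)) v"
    unfolding inverse_op_def by (rule someI_ex)
  then show *: "inverse_op \<Omega> V M v \<in> V" "AE x in lebesgue_on \<Omega>. M (inverse_op \<Omega> V M v) x = v x"
    by (simp_all add: eq_ae_def)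
  show "ip (M (inverse_op \<Omega> V M v)) w = ip v w" if "w \<in> V"
    using M * v that by (intro L2_inner_cong_AE sq) (auto simp: spd_def)
qed

text \<open>With \<open>u\<^sub>i\<close> the solution of \<open>M\<^sub>i u\<^sub>i = v\<close>, the estimate is the nonnegativity of the form of
  \<open>M\<^sub>1\<close> at \<open>u\<^sub>1 - u\<^sub>2 / \<beta>\<close>.\<close>

lemma inverse_op_antimono:
  assumes M: "spd M1" "spd M2" and v: "v \<in> V" and \<beta>: "\<beta> > 0"
    and le: "\<And>u. u \<in> V \<Longrightarrow> ip (M1 u) u \<le> \<beta> * ip (M2 u) u"
  shows "ip (inverse_op \<Omega> V M2 v) v \<le> \<beta> * ip (inverse_op \<Omega> V M1 v) v"
proof -
  define u1 where "u1 = inverse_op \<Omega> V M1 v"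
  define u2 where "u2 = inverse_op \<Omega> V M2 v"
  have u1: "u1 \<in> V" "\<And>w. w \<in> V \<Longrightarrow> ip (M1 u1) w = ip v w"
    unfolding u1_def using inverse_op_spec[OF M(1) v] by blast+
  have u2: "u2 \<in> V" "\<And>w. w \<in> V \<Longrightarrow> ip (M2 u2) w = ip v w"
    unfolding u2_def using inverse_op_spec[OF M(2) v] by blast+
  \<comment> \<open>A combination indexed by \<open>bool\<close>, so that
    \<open>spd_combination\<close> applies to \<open>u1 - u2 / \<beta>\<close>.\<close>
  define c where "c = (\<lambda>b. if b then 1 else - (1 / \<beta>))"
  define f where "f = (\<lambda>b. if b then u1 else u2)"
  have fV: "f b \<in> V" for b using u1(1) u2(1) by (simp add: f_def)
  define w where "w = (\<lambda>x. \<Sum>b\<in>UNIV. c b * f b x)"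
  have w: "w \<in> V" unfolding w_def by (intro combination fV)
  have form: "ip (M1 w) z = ip (M1 u1) z - (1 / \<beta>) * ip (M1 u2) z" if "z \<in> V" for z
  proof -
    have "ip (M1 w) z = (\<Sum>b\<in>UNIV. c b * ip (M1 (f b)) z)"
      unfolding w_def by (rule spd_combination[OF M(1) fV that])
    then show ?thesis by (simp add: UNIV_bool c_def f_def)
  qed
  have "0 \<le> ip (M1 w) w" by (rule spd_nonneg[OF M(1) w])
  also have "\<dots> = ip (M1 u1) w - (1 / \<beta>) * ip (M1 u2) w" by (rule form[OF w])
  also have "ip (M1 u1) w = ip (M1 u1) u1 - (1 / \<beta>) * ip (M1 u2) u1"
    using form[OF u1(1)] M(1) w u1(1) by (simp add: spd_def)
  also have "ip (M1 u2) w = ip (M1 u1) u2 - (1 / \<beta>) * ip (M1 u2) u2"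
    using form[OF u2(1)] M(1) w u2(1) by (simp add: spd_def)
  also have "ip (M1 u2) u1 = ip (M1 u1) u2" using M(1) u1(1) u2(1) by (simp add: spd_def)
  also have "ip (M1 u1) u1 - 1 / \<beta> * ip (M1 u1) u2 - 1 / \<beta> * (ip (M1 u1) u2 - 1 / \<beta> * ip (M1 u2) u2)
      = ip v u1 - 2 / \<beta> * ip v u2 + 1 / \<beta>\<^sup>2 * ip (M1 u2) u2"
    using u1(2)[OF u1(1)] u1(2)[OF u2(1)] by (simp add: algebra_simps power2_eq_square)
  \<comment> \<open>The comparison of the forms is used only at \<open>u2\<close>, where the form of
    \<open>M2\<close> equals \<open>ip v u2\<close>.\<close>
  also have "1 / \<beta>\<^sup>2 * ip (M1 u2) u2 \<le> 1 / \<beta>\<^sup>2 * (\<beta> * ip v u2)"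
    using le[OF u2(1)] u2(2)[OF u2(1)] by (intro mult_left_mono) auto
  also have "ip v u1 - 2 / \<beta> * ip v u2 + 1 / \<beta>\<^sup>2 * (\<beta> * ip v u2) = ip v u1 - ip v u2 / \<beta>"
    using \<beta> by (simp add: power2_eq_square field_simps)
  finally have "ip v u2 \<le> \<beta> * ip v u1" using \<beta> by (simp add: field_simps)
  then show ?thesis by (simp add: u1_def u2_def L2_inner_commute[of \<Omega> v])
qed

text \<open>\<open>inverse_op_antimono\<close> with the identity as second operator, whose inverse
  is the identity almost everywhere.\<close>

lemma inverse_op_lower:
  assumes M: "spd M" and v: "v \<in> V" and C: "C > 0" "\<And>u. u \<in> V \<Longrightarrow> ip (M u) u \<le> C * ip u u"
  shows "ip v v \<le> C * ip (inverse_op \<Omega> V M v) v"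
proof -
  have "AE x in lebesgue_on \<Omega>. inverse_op \<Omega> V (\<lambda>u. u) v x = v x" by (rule inverse_op_spec(2)[OF spd_id v])
  then have "ip (inverse_op \<Omega> V (\<lambda>u. u) v) v = ip v v"
    using v inverse_op_spec(1)[OF spd_id v] by (intro L2_inner_cong_AE sq) auto
  then show ?thesis using inverse_op_antimono[OF M spd_id v C] by simp
qed

lemma inverse_op_pos:
  assumes M: "spd M" and v: "v \<in> nonzero_elements \<Omega> V"
    and C: "C > 0" "\<And>u. u \<in> V \<Longrightarrow> ip (M u) u \<le> C * ip u u"
  shows "0 < ip (inverse_op \<Omega> V M v) v"
proof -
  have vV: "v \<in> V" and "\<not> eq_ae \<Omega> v (\<lambda>x. 0)" using v by (auto simp: nonzero_elements_def)
  then have "ip v v > 0"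
    using L2_inner_eq_0_iff[OF sq[OF vV]] L2_inner_nonneg[of \<Omega> v] by (auto simp: eq_ae_def less_le)
  then have "0 < C * ip (inverse_op \<Omega> V M v) v"
    using inverse_op_lower[OF M vV C] by linarith
  then show ?thesis using C(1) by (simp add: zero_less_mult_iff)
qed

text \<open>The form inequalities reverse for the inverses, so the two Rayleigh quotients bound each
  other with factors \<open>\<beta>\<close> and \<open>\<alpha>\<close>. The constants
  \<open>C\<close> and \<open>K\<close> make the quotients of \<open>M2\<close> bounded above, which
  a real supremum requires.\<close>

lemma cond_number_mono:
  assumes M: "spd M1" "spd M2" and \<beta>: "\<beta> > 0" and \<alpha>: "\<alpha> > 0"
    and le1: "\<And>u. u \<in> V \<Longrightarrow> ip (M1 u) u \<le> \<beta> * ip (M2 u) u"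
    and le2: "\<And>u. u \<in> V \<Longrightarrow> ip (M2 u) u \<le> \<alpha> * ip (M1 u) u"
    and C: "C > 0" "\<And>u. u \<in> V \<Longrightarrow> ip (M2 u) u \<le> C * ip u u"
    and A: "\<And>v. v \<in> V \<Longrightarrow> 0 \<le> ip (A v) v" "\<And>v. v \<in> V \<Longrightarrow> ip (A v) v \<le> K * ip v v"
    and ne: "nonzero_elements \<Omega> V \<noteq> {}"
  shows "cond_number \<Omega> V A M1 \<le> \<alpha> * \<beta> * cond_number \<Omega> V A M2"
proof -
  define X where "X = nonzero_elements \<Omega> V"
  define r1 where "r1 = (\<lambda>v. ip (A v) v / ip (inverse_op \<Omega> V M1 v) v)"
  define r2 where "r2 = (\<lambda>v. ip (A v) v / ip (inverse_op \<Omega> V M2 v) v)"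
  have XV: "v \<in> V" if "v \<in> X" for v using that by (simp add: X_def nonzero_elements_def)
  have C1: "ip (M1 u) u \<le> (\<beta> * C) * ip u u" if "u \<in> V" for u
    using order_trans[OF le1[OF that] mult_left_mono[OF C(2)[OF that] less_imp_le[OF \<beta>]]]
    by (simp only: mult.assoc)
  have p2: "0 < ip (inverse_op \<Omega> V M2 v) v" if "v \<in> X" for v
    using inverse_op_pos[OF M(2) _ C] that by (simp add: X_def)
  have p1: "0 < ip (inverse_op \<Omega> V M1 v) v" if "v \<in> X" for v
    using inverse_op_pos[OF M(1) _ _ C1] that \<beta> C(1) by (simp add: X_def)
  have r1_le: "r1 v \<le> \<beta> * r2 v" if v: "v \<in> X" for v
  proof -
    have "ip (A v) v * ip (inverse_op \<Omega> V M2 v) v \<le> ip (A v) v * (\<beta> * ip (inverse_op \<Omega> V M1 v) v)"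
      using inverse_op_antimono[OF M XV[OF v] \<beta> le1] A(1)[OF XV[OF v]] by (intro mult_left_mono)
    then show ?thesis using p1[OF v] p2[OF v] by (simp add: r1_def r2_def field_simps)
  qed
  have r2_le: "r2 v \<le> \<alpha> * r1 v" if v: "v \<in> X" for v
  proof -
    have "ip (A v) v * ip (inverse_op \<Omega> V M1 v) v \<le> ip (A v) v * (\<alpha> * ip (inverse_op \<Omega> V M2 v) v)"
      using inverse_op_antimono[OF M(2,1) XV[OF v] \<alpha> le2] A(1)[OF XV[OF v]] by (intro mult_left_mono)
    then show ?thesis using p1[OF v] p2[OF v] by (simp add: r1_def r2_def field_simps)
  qed
  have r1_nonneg: "0 \<le> r1 v" if "v \<in> X" for v
    using A(1)[OF XV[OF that]] p1[OF that] by (simp add: r1_def)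
  have r2_nonneg: "0 \<le> r2 v" if "v \<in> X" for v
    using A(1)[OF XV[OF that]] p2[OF that] by (simp add: r2_def)
  have r2_bound: "r2 v \<le> \<bar>K\<bar> * C" if v: "v \<in> X" for v
  proof -
    have "ip (A v) v \<le> \<bar>K\<bar> * ip v v"
      using A(2)[OF XV[OF v]] mult_right_mono[OF abs_ge_self[of K] L2_inner_nonneg[of \<Omega> v]] by linarith
    also have "\<dots> \<le> \<bar>K\<bar> * (C * ip (inverse_op \<Omega> V M2 v) v)"
      by (intro mult_left_mono inverse_op_lower[OF M(2) XV[OF v] C]) auto
    finally show ?thesis using p2[OF v] by (simp add: r2_def divide_le_eq mult.assoc)
  qed
  have Xne: "X \<noteq> {}" using ne by (simp add: X_def)
  have bdd2: "bdd_above (r2 ` X)" using r2_bound by (auto intro!: bdd_aboveI)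
  have below: "bdd_below (r1 ` X)" "bdd_below (r2 ` X)"
    using r1_nonneg r2_nonneg by (auto intro!: bdd_belowI[of _ 0])
  define s1 where "s1 = (SUP v\<in>X. r1 v)"
  define s2 where "s2 = (SUP v\<in>X. r2 v)"
  define i1 where "i1 = (INF v\<in>X. r1 v)"
  define i2 where "i2 = (INF v\<in>X. r2 v)"
  have s12: "s1 \<le> \<beta> * s2"
    unfolding s1_def
  proof (rule cSUP_least[OF Xne])
    fix v assume v: "v \<in> X"
    have "r2 v \<le> s2" unfolding s2_def by (rule cSUP_upper[OF v bdd2])
    from mult_left_mono[OF this less_imp_le[OF \<beta>]] show "r1 v \<le> \<beta> * s2" using r1_le[OF v] by linarith
  qed
  have i21: "i2 \<le> \<alpha> * i1"
  proof -
    have "i2 / \<alpha> \<le> i1"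
      unfolding i1_def
    proof (rule cINF_greatest[OF Xne])
      fix v assume v: "v \<in> X"
      have "i2 \<le> r2 v" unfolding i2_def by (rule cINF_lower[OF below(2) v])
      then have "i2 \<le> \<alpha> * r1 v" using r2_le[OF v] by linarith
      then show "i2 / \<alpha> \<le> r1 v" using \<alpha> by (simp add: divide_le_eq mult.commute)
    qed
    then show ?thesis using \<alpha> by (simp add: divide_le_eq mult.commute)
  qed
  have i12: "i1 \<le> \<beta> * i2"
  proof -
    have "i1 / \<beta> \<le> i2"
      unfolding i2_def
    proof (rule cINF_greatest[OF Xne])
      fix v assume v: "v \<in> X"
      have "i1 \<le> r1 v" unfolding i1_def by (rule cINF_lower[OF below(1) v])
      then have "i1 \<le> \<beta> * r2 v" using r1_le[OF v] by linarith
      then show "i1 / \<beta> \<le> r2 v" using \<beta> by (simp add: divide_le_eq mult.commute)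
    qed
    then show ?thesis using \<beta> by (simp add: divide_le_eq mult.commute)
  qed
  have i_nonneg: "0 \<le> i1" "0 \<le> i2"
    unfolding i1_def i2_def using r1_nonneg r2_nonneg Xne by (auto intro!: cINF_greatest)
  have s2_nonneg: "0 \<le> s2"
  proof -
    obtain v where v: "v \<in> X" using Xne by blast
    have "r2 v \<le> s2" unfolding s2_def by (rule cSUP_upper[OF v bdd2])
    then show ?thesis using r2_nonneg[OF v] by linarith
  qed
  \<comment> \<open>If \<open>i2\<close> is zero then so is \<open>i1\<close>, and both quotients
    are zero by the convention for division.\<close>
  have "s1 / i1 \<le> \<alpha> * \<beta> * (s2 / i2)"
  proof (cases "i2 = 0")
    case True
    then have "i1 = 0" using i12 i_nonneg by simp
    then show ?thesis using True by simp
  next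
    case False
    then have i2: "i2 > 0" using i_nonneg by simp
    then have i1: "i1 > 0" using i21 \<alpha> i_nonneg by (cases "i1 = 0") auto
    have "s1 * i2 \<le> \<beta> * s2 * i2" using s12 i2 by (intro mult_right_mono) auto
    also have "\<dots> \<le> \<beta> * s2 * (\<alpha> * i1)" using i21 \<beta> s2_nonneg by (intro mult_left_mono) auto
    finally show ?thesis using i1 i2 by (simp add: field_simps)
  qed
  then show ?thesis
    by (simp add: cond_number_def s1_def s2_def i1_def i2_def r1_def r2_def X_def)
qed

end

lemma L2_inner_diff_square:
  fixes u v :: "'a::euclidean_space \<Rightarrow> real"
  assumes u: "square_integrable \<Omega> u" and v: "square_integrable \<Omega> v"
  shows "L2_inner \<Omega> (\<lambda>x. u x - c * v x) (\<lambda>x. u x - c * v x) =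
    L2_inner \<Omega> u u - 2 * c * L2_inner \<Omega> u v + c\<^sup>2 * L2_inner \<Omega> v v"
proof -
  let ?w = "\<lambda>x. u x - c * v x"
  have w: "square_integrable \<Omega> ?w" by (rule square_integrable_diff[OF u square_integrable_mult[OF v]])
  have d: "L2_inner \<Omega> ?w y = L2_inner \<Omega> u y - c * L2_inner \<Omega> v y" if "square_integrable \<Omega> y" for y
    using L2_inner_diff_left[OF u square_integrable_mult[OF v] that] by (simp only: L2_inner_mult_left)
  have "L2_inner \<Omega> ?w ?w = L2_inner \<Omega> ?w u - c * L2_inner \<Omega> ?w v"
    by (simp only: d[OF w] L2_inner_commute[of \<Omega> u ?w] L2_inner_commute[of \<Omega> v ?w])
  then show ?thesis
    unfolding d[OF u] d[OF v] L2_inner_commute[of \<Omega> v u] by (simp add: algebra_simps power2_eq_square)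
qed

subsection \<open>Finite element spaces\<close>

context mesh
begin

text \<open>Weak gradients and \<open>H1\<close> distances to test functions depend only on the
  class modulo null sets, so membership transfers from the representative.\<close>

lemma fe_space_eq_ae:
  assumes u: "piecewise_affine \<Omega> \<T> u" and v: "square_integrable \<Omega> v" and ae: "AE x in lebesgue_on \<Omega>. v x = u x"
  shows "v \<in> fe_space \<Omega> \<T>"
proof -
  have uV: "u \<in> fe_space \<Omega> \<T>" by (rule piecewise_affine_fe_space[OF u])
  have su: "square_integrable \<Omega> u" by (rule piecewise_affine_square_integrable[OF u])
  obtain g where g: "has_L2_gradient \<Omega> u g" using uV by (auto simp: fe_space_def H1_0_def H1_def)
  have gv: "has_L2_gradient \<Omega> v g"
    by (rule has_L2_gradient_cong_AE[OF g su v _ lmeasurable_domain]) (use ae in \<open>auto elim: eventually_mono\<close>)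
  have eq: "H1_norm \<Omega> (\<lambda>x. v x - \<psi> x) = H1_norm \<Omega> (\<lambda>x. u x - \<psi> x)" if \<psi>: "\<psi> \<in> test_functions \<Omega>" for \<psi>
  proof -
    note s\<psi> = test_function_square_integrable[OF \<psi> lmeasurable_domain]
    have "AE x in lebesgue_on \<Omega>. v x - \<psi> x = u x - \<psi> x" using ae by eventually_elim simp
    then have "L2_inner \<Omega> (\<lambda>x. v x - \<psi> x) (\<lambda>x. v x - \<psi> x) = L2_inner \<Omega> (\<lambda>x. u x - \<psi> x) (\<lambda>x. u x - \<psi> x)"
      using square_integrable_diff[OF v s\<psi>] square_integrable_diff[OF su s\<psi>] by (intro L2_inner_cong_AE)
    then show ?thesis
      using H1_norm_eq[OF open_domain bounded_domain has_L2_gradient_diff_test_function[OF lmeasurable_domain v gv \<psi>]]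
        H1_norm_eq[OF open_domain bounded_domain has_L2_gradient_diff_test_function[OF lmeasurable_domain su g \<psi>]]
      by simp
  qed
  have "v \<in> H1_0 \<Omega>" using uV v gv eq by (auto simp: fe_space_def H1_0_def H1_def)
  moreover have "\<exists>g c. eq_ae \<tau> v (\<lambda>x. g \<bullet> x + c)" if \<tau>: "\<tau> \<in> \<T>" for \<tau>
  proof -
    obtain g c where gc: "\<forall>x\<in>closure \<tau>. u x = g \<bullet> x + c" using u \<tau> unfolding piecewise_affine_def by blast
    have "AE x in lebesgue. x \<in> \<tau> \<longrightarrow> v x = g \<bullet> x + c"
      using ae unfolding AE_lebesgue_on_iff[OF sets_domain]
      by eventually_elim (use gc closure_subset[of \<tau>] element_subset[OF \<tau>] in auto)
    then show ?thesis by (auto simp: eq_ae_def AE_lebesgue_on_iff[OF sets_element[OF \<tau>]])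
  qed
  ultimately show ?thesis by (simp add: fe_space_def)
qed

lemma fe_space_square_integrable: "v \<in> fe_space \<Omega> \<T> \<Longrightarrow> square_integrable \<Omega> v"
  by (simp add: fe_space_def H1_0_def H1_def)

lemma eq_ae_expansion:
  assumes u: "piecewise_affine \<Omega> \<T> u" and "eq_ae \<Omega> v u"
  shows "AE x in lebesgue_on \<Omega>. v x = (\<Sum>i\<in>interior_vertices \<Omega> \<T>. u i * hat i x)"
  using assms(2) unfolding eq_ae_def
proof eventually_elim
  fix x assume "v x = u x"
  also have "u x = (\<Sum>i\<in>interior_vertices \<Omega> \<T>. u i * hat i x)"
    by (rule fun_cong[OF piecewise_affine_expansion[OF u]])
  finally show "v x = (\<Sum>i\<in>interior_vertices \<Omega> \<T>. u i * hat i x)" .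
qed

lemma hat_combination_node:
  assumes "a \<in> interior_vertices \<Omega> \<T>"
  shows "(\<Sum>i\<in>interior_vertices \<Omega> \<T>. c i * hat i a) = c a"
proof -
  have "(\<Sum>i\<in>interior_vertices \<Omega> \<T>. c i * hat i a) = (\<Sum>i\<in>interior_vertices \<Omega> \<T>. if i = a then c a else 0)"
    using assms by (intro sum.cong refl) (auto simp: hat_vertex interior_vertices_def)
  then show ?thesis using assms finite_interior_vertices by simp
qed

end

text \<open>The coefficient constant comes from the lower mass bound: the sum of weighted squared
  coefficients is at most twice the squared norm, and one term is kept.\<close>

sublocale mesh \<subseteq> fe: fin_subspace \<Omega> "fe_space \<Omega> \<T>" hat "interior_vertices \<Omega> \<T>"
  "\<lambda>a. 2 / L2_inner \<Omega> (hat a) (hat a)"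
proof
  show "square_integrable \<Omega> v" if "v \<in> fe_space \<Omega> \<T>" for v
    by (rule fe_space_square_integrable[OF that])
  show "(\<lambda>x. u x + v x) \<in> fe_space \<Omega> \<T>" if uv: "u \<in> fe_space \<Omega> \<T>" "v \<in> fe_space \<Omega> \<T>" for u v
  proof -
    obtain u' where u': "piecewise_affine \<Omega> \<T> u'" "eq_ae \<Omega> u u'" using fe_space_piecewise_affine[OF uv(1)] by blast
    obtain v' where v': "piecewise_affine \<Omega> \<T> v'" "eq_ae \<Omega> v v'" using fe_space_piecewise_affine[OF uv(2)] by blast
    show ?thesis
    proof (rule fe_space_eq_ae[OF piecewise_affine_add[OF u'(1) v'(1)]])
      show "square_integrable \<Omega> (\<lambda>x. u x + v x)"
        by (rule square_integrable_add[OF uv[THEN fe_space_square_integrable]])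
      show "AE x in lebesgue_on \<Omega>. u x + v x = u' x + v' x"
        using u'(2) v'(2) unfolding eq_ae_def by eventually_elim simp
    qed
  qed
  show "(\<lambda>x. k * v x) \<in> fe_space \<Omega> \<T>" if v: "v \<in> fe_space \<Omega> \<T>" for v k
  proof -
    obtain v' where v': "piecewise_affine \<Omega> \<T> v'" "eq_ae \<Omega> v v'" using fe_space_piecewise_affine[OF v] by blast
    show ?thesis
    proof (rule fe_space_eq_ae[OF piecewise_affine_scale[OF v'(1)]])
      show "square_integrable \<Omega> (\<lambda>x. k * v x)"
        by (rule square_integrable_mult[OF fe_space_square_integrable[OF v]])
      show "AE x in lebesgue_on \<Omega>. k * v x = k * v' x"
        using v'(2) unfolding eq_ae_def by eventually_elim simp
    qed
  qed
  show "finite (interior_vertices \<Omega> \<T>)" by (rule finite_interior_vertices)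
  show "hat i \<in> fe_space \<Omega> \<T>" if "i \<in> interior_vertices \<Omega> \<T>" for i
    by (rule piecewise_affine_fe_space[OF hat_piecewise_affine[OF that]])
  show "(\<lambda>x. 0) \<in> fe_space \<Omega> \<T>" by (rule piecewise_affine_fe_space[OF piecewise_affine_zero])
  show "\<exists>c. AE x in lebesgue_on \<Omega>. v x = (\<Sum>i\<in>interior_vertices \<Omega> \<T>. c i * hat i x)"
    if v: "v \<in> fe_space \<Omega> \<T>" for v
  proof -
    obtain u where u: "piecewise_affine \<Omega> \<T> u" "eq_ae \<Omega> v u" using fe_space_piecewise_affine[OF v] by blast
    have "AE x in lebesgue_on \<Omega>. v x = (\<Sum>i\<in>interior_vertices \<Omega> \<T>. u i * hat i x)"
      by (rule eq_ae_expansion[OF u])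
    then show ?thesis by blast
  qed
  fix a c assume a: "a \<in> interior_vertices \<Omega> \<T>"
  let ?u = "\<lambda>x. \<Sum>i\<in>interior_vertices \<Omega> \<T>. c i * hat i x"
  have u: "piecewise_affine \<Omega> \<T> ?u" by (rule piecewise_affine_sum[OF hat_piecewise_affine])
  have "(c a)\<^sup>2 * L2_inner \<Omega> (hat a) (hat a) = (?u a)\<^sup>2 * L2_inner \<Omega> (hat a) (hat a)"
    using a by (simp add: hat_combination_node)
  also have "\<dots> \<le> (\<Sum>a\<in>interior_vertices \<Omega> \<T>. (?u a)\<^sup>2 * L2_inner \<Omega> (hat a) (hat a))"
    by (rule member_le_sum[OF a _ finite_interior_vertices]) (simp add: L2_inner_nonneg)
  also have "\<dots> \<le> 2 * L2_inner \<Omega> ?u ?u" by (rule mass_bounds(1)[OF u])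
  finally show "(c a)\<^sup>2 \<le> 2 / L2_inner \<Omega> (hat a) (hat a) * L2_inner \<Omega> ?u ?u"
    using L2_hat_pos[OF a] by (simp add: field_simps)
qed

context mesh
begin

abbreviation ip where "ip \<equiv> L2_inner \<Omega>"

abbreviation energy where "energy v w \<equiv> L2_inner \<Omega> (weak_grad \<Omega> v) (weak_grad \<Omega> w)"

lemma fe_space_weak_grad:
  "v \<in> fe_space \<Omega> \<T> \<Longrightarrow> has_L2_gradient \<Omega> v (weak_grad \<Omega> v)"
  using weak_grad_has_L2_gradient by (auto simp: fe_space_def H1_0_def H1_def)

lemma fe_space_weak_grad_square_integrable:
  "v \<in> fe_space \<Omega> \<T> \<Longrightarrow> square_integrable \<Omega> (weak_grad \<Omega> v)"
  using fe_space_weak_grad by (simp add: has_L2_gradient_def)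

lemma has_L2_gradient_combination:
  "(\<And>i. i \<in> I \<Longrightarrow> f i \<in> fe_space \<Omega> \<T>) \<Longrightarrow>
    has_L2_gradient \<Omega> (\<lambda>x. \<Sum>i\<in>I. c i * f i x) (\<lambda>x. \<Sum>i\<in>I. c i *\<^sub>R weak_grad \<Omega> (f i) x)"
proof (induction I rule: infinite_finite_induct)
  case (insert i I)
  have "has_L2_gradient \<Omega> (\<lambda>x. c i * f i x + (\<Sum>i\<in>I. c i * f i x))
      (\<lambda>x. c i *\<^sub>R weak_grad \<Omega> (f i) x + (\<Sum>i\<in>I. c i *\<^sub>R weak_grad \<Omega> (f i) x))"
    by (rule has_L2_gradient_add[OF lmeasurable_domain fe.sq[OF fe.scale] fe.sq[OF fe.combination]
          has_L2_gradient_mult[OF fe_space_weak_grad] insert.IH]) (use insert.prems in auto)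
  then show ?case using insert.hyps by simp
qed (simp_all add: has_L2_gradient_def square_integrable_zero)

text \<open>The combination of the weak gradients of the hats is a weak gradient of
  \<open>w\<close>, so uniqueness lets it replace \<open>weak_grad \<Omega> w\<close> under the
  integral.\<close>

lemma energy_expand:
  assumes v: "v \<in> fe_space \<Omega> \<T>" and w: "w \<in> fe_space \<Omega> \<T>"
    and c: "AE x in lebesgue_on \<Omega>. w x = (\<Sum>i\<in>interior_vertices \<Omega> \<T>. c i * hat i x)"
  shows "energy v w = (\<Sum>i\<in>interior_vertices \<Omega> \<T>. c i * energy v (hat i))"
proof -
  let ?I = "interior_vertices \<Omega> \<T>"
  let ?g = "\<lambda>x. \<Sum>i\<in>?I. c i *\<^sub>R weak_grad \<Omega> (hat i) x"
  have g: "has_L2_gradient \<Omega> (\<lambda>x. \<Sum>i\<in>?I. c i * hat i x) ?g"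
    by (rule has_L2_gradient_combination[OF fe.\<phi>])
  have gw: "has_L2_gradient \<Omega> w ?g"
    by (rule has_L2_gradient_cong_AE[OF g fe.sq[OF fe.combination[OF fe.\<phi>]] fe.sq[OF w] _ lmeasurable_domain])
       (use c in \<open>auto elim: eventually_mono\<close>)
  have "energy v w = L2_inner \<Omega> (weak_grad \<Omega> v) ?g"
    using gw by (intro L2_inner_cong_AE fe_space_weak_grad_square_integrable v w
        weak_grad_AE[OF open_domain bounded_domain gw]) (auto simp: has_L2_gradient_def)
  also have "\<dots> = (\<Sum>i\<in>?I. L2_inner \<Omega> (weak_grad \<Omega> v) (\<lambda>x. c i *\<^sub>R weak_grad \<Omega> (hat i) x))"
    by (rule L2_inner_sum_right[OF square_integrable_scaleR[OF fe_space_weak_grad_square_integrable[OF fe.\<phi>]]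
          fe_space_weak_grad_square_integrable[OF v]])
  also have "\<dots> = (\<Sum>i\<in>?I. c i * energy v (hat i))"
    by (simp add: L2_inner_def)
  finally show ?thesis .
qed

lemma stiffness_op_spec:
  assumes v: "v \<in> fe_space \<Omega> \<T>"
  shows "w \<in> fe_space \<Omega> \<T> \<Longrightarrow> ip (stiffness_op \<Omega> (fe_space \<Omega> \<T>) v) w = energy v w"
proof -
  obtain u where u: "u \<in> fe_space \<Omega> \<T>" "\<And>i. i \<in> interior_vertices \<Omega> \<T> \<Longrightarrow> ip u (hat i) = energy v (hat i)"
    using fe.riesz[of "\<lambda>i. energy v (hat i)"] by blast
  have "ip u w = energy v w" if w: "w \<in> fe_space \<Omega> \<T>" for w
  proof -
    obtain c where c: "AE x in lebesgue_on \<Omega>. w x = (\<Sum>i\<in>interior_vertices \<Omega> \<T>. c i * hat i x)"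
      using fe.expand[OF w] by blast
    show ?thesis unfolding fe.ip_expand[OF u(1) w c] energy_expand[OF v w c] using u(2) by simp
  qed
  with u(1) have "\<exists>u. u \<in> fe_space \<Omega> \<T> \<and> (\<forall>w\<in>fe_space \<Omega> \<T>. ip u w = energy v w)" by blast
  then have "stiffness_op \<Omega> (fe_space \<Omega> \<T>) v \<in> fe_space \<Omega> \<T> \<and>
      (\<forall>w\<in>fe_space \<Omega> \<T>. ip (stiffness_op \<Omega> (fe_space \<Omega> \<T>) v) w = energy v w)"
    unfolding stiffness_op_def by (rule someI_ex)
  then show "w \<in> fe_space \<Omega> \<T> \<Longrightarrow> ip (stiffness_op \<Omega> (fe_space \<Omega> \<T>) v) w = energy v w" by blast
qed

text \<open>An inverse inequality whose constant may depend on the mesh: it is needed only to keep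
  the Rayleigh quotients bounded, so summing absolute matrix entries is enough.\<close>

lemma energy_bound:
  obtains K where "\<And>v. v \<in> fe_space \<Omega> \<T> \<Longrightarrow> energy v v \<le> K * ip v v"
proof -
  let ?I = "interior_vertices \<Omega> \<T>"
  define \<kappa> where "\<kappa> = (\<lambda>a. 2 / ip (hat a) (hat a))"
  define K where "K = (\<Sum>a\<in>?I. \<Sum>b\<in>?I. \<bar>energy (hat b) (hat a)\<bar> * (\<kappa> a + \<kappa> b))"
  have "energy v v \<le> K * ip v v" if v: "v \<in> fe_space \<Omega> \<T>" for v
  proof -
    obtain c where c: "AE x in lebesgue_on \<Omega>. v x = (\<Sum>i\<in>?I. c i * hat i x)"
      using fe.expand[OF v] by blast
    let ?w = "\<lambda>x. \<Sum>i\<in>?I. c i * hat i x"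
    have ipv: "ip v v = ip ?w ?w"
      by (rule L2_inner_cong_AE[OF fe.sq[OF v] fe.sq[OF fe.combination[OF fe.\<phi>]] fe.sq[OF v] fe.sq[OF fe.combination[OF fe.\<phi>]] c c])
    have cb: "(c a)\<^sup>2 \<le> \<kappa> a * ip v v" if "a \<in> ?I" for a
      unfolding ipv \<kappa>_def by (rule fe.coeff_bound[OF that])
    have "energy v v = (\<Sum>a\<in>?I. c a * energy v (hat a))" by (rule energy_expand[OF v v c])
    also have "\<dots> = (\<Sum>a\<in>?I. \<Sum>b\<in>?I. c a * (c b * energy (hat a) (hat b)))"
    proof (intro sum.cong refl)
      fix a assume a: "a \<in> ?I"
      have "energy v (hat a) = energy (hat a) v" by (rule L2_inner_commute)
      also have "\<dots> = (\<Sum>b\<in>?I. c b * energy (hat a) (hat b))" by (rule energy_expand[OF fe.\<phi>[OF a] v c])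
      finally show "c a * energy v (hat a) = (\<Sum>b\<in>?I. c a * (c b * energy (hat a) (hat b)))"
        by (simp add: sum_distrib_left)
    qed
    also have "\<dots> \<le> (\<Sum>a\<in>?I. \<Sum>b\<in>?I. \<bar>energy (hat b) (hat a)\<bar> * (\<kappa> a + \<kappa> b) * ip v v)"
    proof (intro sum_mono)
      fix a b assume ab: "a \<in> ?I" "b \<in> ?I"
      have "\<bar>c a * c b\<bar> \<le> (c a)\<^sup>2 + (c b)\<^sup>2"
        using sum_squares_bound[of "\<bar>c a\<bar>" "\<bar>c b\<bar>"] mult_nonneg_nonneg[OF abs_ge_zero abs_ge_zero, of "c a" "c b"]
        unfolding abs_mult power2_abs by linarith
      also have "\<dots> \<le> (\<kappa> a + \<kappa> b) * ip v v" using cb[OF ab(1)] cb[OF ab(2)] by (simp add: distrib_right)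
      finally have "\<bar>energy (hat b) (hat a)\<bar> * \<bar>c a * c b\<bar> \<le> \<bar>energy (hat b) (hat a)\<bar> * ((\<kappa> a + \<kappa> b) * ip v v)"
        by (intro mult_left_mono) auto
      moreover have "c a * (c b * energy (hat a) (hat b)) \<le> \<bar>energy (hat b) (hat a)\<bar> * \<bar>c a * c b\<bar>"
        using abs_ge_self[of "c a * (c b * energy (hat a) (hat b))"]
        by (simp add: abs_mult mult_ac L2_inner_commute[of \<Omega> "weak_grad \<Omega> (hat a)"])
      ultimately show "c a * (c b * energy (hat a) (hat b)) \<le> \<bar>energy (hat b) (hat a)\<bar> * (\<kappa> a + \<kappa> b) * ip v v"
        by (simp add: mult.assoc)
    qed
    also have "\<dots> = K * ip v v" by (simp add: K_def sum_distrib_right)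
    finally show ?thesis .
  qed
  then show ?thesis by (rule that)
qed

section \<open>The \<open>L2\<close> projection against the Jacobi smoother on one level\<close>

abbreviation proj where "proj \<equiv> L2_proj \<Omega> (fe_space \<Omega> \<T>)"

text \<open>The bilinear form of the sum of the orthogonal projections onto the lines spanned by the
  hat functions.\<close>

abbreviation jacobi_form where
  "jacobi_form v w \<equiv> (\<Sum>a\<in>interior_vertices \<Omega> \<T>. ip v (hat a) * ip w (hat a) / ip (hat a) (hat a))"

lemma proj_le:
  assumes v: "square_integrable \<Omega> v"
  shows "ip (proj v) (proj v) \<le> ip v v"
proof -
  note q = fe.L2_proj_spec[OF v]
  have "0 \<le> ip (\<lambda>x. v x - proj v x) (\<lambda>x. v x - proj v x)" by (rule L2_inner_nonneg)
  also have "\<dots> = ip v v - 2 * ip v (proj v) + ip (proj v) (proj v)"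
    using L2_inner_diff_square[OF v fe.sq[OF q(1)], of 1] by simp
  finally show ?thesis using q(2)[OF q(1)] by simp
qed

text \<open>Both estimates are dual to the bounds for the mass matrix.\<close>

lemma proj_jacobi_bounds:
  assumes v: "square_integrable \<Omega> v"
  shows "ip (proj v) (proj v) \<le> 2 * jacobi_form v v"
    "jacobi_form v v \<le> (real DIM('a) + 2) / 2 * ip (proj v) (proj v)"
proof -
  let ?I = "interior_vertices \<Omega> \<T>"
  define q where "q = proj v"
  define D where "D = (\<lambda>a. ip (hat a) (hat a))"
  define b where "b = (\<lambda>a. ip v (hat a))"
  define S where "S = (\<Sum>a\<in>?I. (b a)\<^sup>2 / D a)"
  have S: "jacobi_form v v = S" by (simp add: S_def b_def D_def power2_eq_square)
  have D: "D a > 0" if "a \<in> ?I" for a using L2_hat_pos[OF that] by (simp add: D_def)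
  have q: "q \<in> fe_space \<Omega> \<T>" "\<And>w. w \<in> fe_space \<Omega> \<T> \<Longrightarrow> ip q w = ip v w"
    unfolding q_def by (rule fe.L2_proj_spec[OF v])+
  have qb: "ip q (hat a) = b a" if "a \<in> ?I" for a using q(2)[OF fe.\<phi>[OF that]] by (simp add: b_def)
  obtain u where u: "piecewise_affine \<Omega> \<T> u" "eq_ae \<Omega> q u" using fe_space_piecewise_affine[OF q(1)] by blast
  have uV: "u \<in> fe_space \<Omega> \<T>" by (rule piecewise_affine_fe_space[OF u(1)])
  have qq: "ip q q = ip u u"
    using u(2) by (intro L2_inner_cong_AE fe.sq q(1) uV) (auto simp: eq_ae_def)
  have "AE x in lebesgue_on \<Omega>. q x = (\<Sum>i\<in>?I. u i * hat i x)"
    by (rule eq_ae_expansion[OF u])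
  from fe.ip_expand[OF q(1) q(1) this] have "ip q q = (\<Sum>a\<in>?I. u a * b a)" using qb by simp
  \<comment> \<open>Young's inequality, weighted so that by the lower mass bound the first part is
    at most half of \<open>ip q q\<close> and can be absorbed.\<close>
  also have "\<dots> \<le> (\<Sum>a\<in>?I. (u a)\<^sup>2 * D a / 4 + (b a)\<^sup>2 / D a)"
  proof (rule sum_mono)
    fix a assume a: "a \<in> ?I"
    have "0 \<le> (u a * D a / 2 - b a)\<^sup>2" by simp
    then have "u a * b a * D a \<le> ((u a)\<^sup>2 * D a / 4) * D a + (b a)\<^sup>2"
      by (simp add: power2_eq_square algebra_simps)
    then show "u a * b a \<le> (u a)\<^sup>2 * D a / 4 + (b a)\<^sup>2 / D a"
      using D[OF a] by (simp add: field_simps)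
  qed
  also have "\<dots> = (\<Sum>a\<in>?I. (u a)\<^sup>2 * D a) / 4 + S"
    by (simp add: sum.distrib S_def sum_divide_distrib)
  also have "(\<Sum>a\<in>?I. (u a)\<^sup>2 * D a) \<le> 2 * ip u u"
    unfolding D_def by (rule mass_bounds(1)[OF u(1)])
  finally show "ip (proj v) (proj v) \<le> 2 * jacobi_form v v"
    using qq by (simp add: S q_def)
  \<comment> \<open>The coefficients of one Jacobi sweep. With them both \<open>ip q w\<close> and
    the weighted sum of squared nodal values of \<open>w\<close> equal \<open>S\<close>.\<close>
  define z where "z = (\<lambda>a. b a / D a)"
  define w where "w = (\<lambda>x. \<Sum>a\<in>?I. z a * hat a x)"
  have wp: "piecewise_affine \<Omega> \<T> w" unfolding w_def by (rule piecewise_affine_sum[OF hat_piecewise_affine])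
  have wV: "w \<in> fe_space \<Omega> \<T>" by (rule piecewise_affine_fe_space[OF wp])
  have wz: "w a = z a" if "a \<in> ?I" for a unfolding w_def by (rule hat_combination_node[OF that])
  define k where "k = (real DIM('a) + 2) / 2"
  have k: "k > 0" by (simp add: k_def)
  have "ip w w \<le> k * (\<Sum>a\<in>?I. (w a)\<^sup>2 * D a)"
    unfolding k_def D_def by (rule mass_bounds(2)[OF wp])
  also have "(\<Sum>a\<in>?I. (w a)\<^sup>2 * D a) = S"
    unfolding S_def using D by (intro sum.cong refl) (force simp: wz z_def power2_eq_square)
  finally have ww: "ip w w \<le> k * S" .
  have qw: "ip q w = S"
  proof -
    have "ip q w = (\<Sum>a\<in>?I. z a * ip q (hat a))" by (rule fe.ip_expand[OF q(1) wV]) (simp add: w_def)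
    then show ?thesis unfolding S_def by (simp add: qb z_def power2_eq_square)
  qed
  \<comment> \<open>The Cauchy-Schwarz argument for \<open>q\<close> and \<open>w\<close>, with the
    multiplier \<open>1 / k\<close> that is optimal for the bound
    \<open>ip w w \<le> k * S\<close>.\<close>
  have "0 \<le> ip (\<lambda>x. q x - (1 / k) * w x) (\<lambda>x. q x - (1 / k) * w x)" by (rule L2_inner_nonneg)
  also have "\<dots> = ip q q - 2 / k * ip q w + 1 / k\<^sup>2 * ip w w"
    using L2_inner_diff_square[OF fe.sq[OF q(1)] fe.sq[OF wV], of "1 / k"] by (simp add: power_divide)
  also have "\<dots> \<le> ip q q - 2 / k * S + 1 / k\<^sup>2 * (k * S)"
    using mult_left_mono[OF ww, of "1 / k\<^sup>2"] by (simp add: qw)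
  also have "\<dots> = ip q q - S / k" using k by (simp add: power2_eq_square field_simps)
  finally show "jacobi_form v v \<le> (real DIM('a) + 2) / 2 * ip (proj v) (proj v)"
    using k by (simp add: S q_def[symmetric] k_def[symmetric] field_simps)
qed

lemma L2_inner_cong_domain:
  assumes "\<And>x. x \<in> \<Omega> \<Longrightarrow> u x = u' x" "\<And>x. x \<in> \<Omega> \<Longrightarrow> v x = v' x"
  shows "L2_inner \<Omega> u v = L2_inner \<Omega> u' v'"
  unfolding L2_inner_def using assms by (intro Bochner_Integration.integral_cong) (auto simp: space_restrict_space)

lemma nodal_basis_fun_domain: "a \<in> interior_vertices \<Omega> \<T> \<Longrightarrow> x \<in> \<Omega> \<Longrightarrow> nodal_basis_fun \<Omega> \<T> a x = hat a x"
  using nodal_basis_fun_eq_hat closure_subset by blast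

lemma ip_nodal_basis_fun:
  "a \<in> interior_vertices \<Omega> \<T> \<Longrightarrow> ip v (nodal_basis_fun \<Omega> \<T> a) = ip v (hat a)"
  by (rule L2_inner_cong_domain) (auto simp: nodal_basis_fun_domain)

lemma nodal_basis_fun_fe_space:
  assumes a: "a \<in> interior_vertices \<Omega> \<T>"
  shows "nodal_basis_fun \<Omega> \<T> a \<in> fe_space \<Omega> \<T>"
proof (rule fe_space_eq_ae[OF hat_piecewise_affine[OF a]])
  show "AE x in lebesgue_on \<Omega>. nodal_basis_fun \<Omega> \<T> a x = hat a x"
    by (rule AE_I2) (use nodal_basis_fun_domain[OF a] in \<open>simp add: space_restrict_space\<close>)
  show "square_integrable \<Omega> (nodal_basis_fun \<Omega> \<T> a)"
  proof -
    have "nodal_basis_fun \<Omega> \<T> a \<in> borel_measurable (lebesgue_on \<Omega>) \<longleftrightarrow> hat a \<in> borel_measurable (lebesgue_on \<Omega>)"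
      by (rule measurable_cong) (simp add: space_restrict_space nodal_basis_fun_domain[OF a])
    moreover have "integrable (lebesgue_on \<Omega>) (\<lambda>x. (norm (nodal_basis_fun \<Omega> \<T> a x))\<^sup>2) \<longleftrightarrow>
        integrable (lebesgue_on \<Omega>) (\<lambda>x. (norm (hat a x))\<^sup>2)"
      by (rule Bochner_Integration.integrable_cong[OF refl])
         (simp add: space_restrict_space nodal_basis_fun_domain[OF a])
    ultimately show ?thesis
      using fe.sq[OF fe.\<phi>[OF a]] by (simp add: square_integrable_def)
  qed
qed

text \<open>An equality of functions and not only almost everywhere: the subspace consists of exact
  multiples of one nonzero function, so the choice in \<open>L2_proj\<close> is unique.\<close>

lemma nodal_proj_eq:
  assumes a: "a \<in> interior_vertices \<Omega> \<T>" and v: "square_integrable \<Omega> v"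
  shows "nodal_proj \<Omega> \<T> a v = (\<lambda>x. (ip v (hat a) / ip (hat a) (hat a)) * nodal_basis_fun \<Omega> \<T> a x)"
proof -
  define \<phi> where "\<phi> = nodal_basis_fun \<Omega> \<T> a"
  have \<phi>: "square_integrable \<Omega> \<phi>" unfolding \<phi>_def by (rule fe.sq[OF nodal_basis_fun_fe_space[OF a]])
  have e: "ip (\<lambda>x. v x - c * \<phi> x) (\<lambda>x. k * \<phi> x) = k * (ip v (hat a) - c * ip (hat a) (hat a))" for c k
  proof -
    have "ip (\<lambda>x. v x - c * \<phi> x) (\<lambda>x. k * \<phi> x) = k * (ip v \<phi> - c * ip \<phi> \<phi>)"
      by (simp add: L2_inner_mult_right L2_inner_diff_left[OF v square_integrable_mult[OF \<phi>] \<phi>] L2_inner_mult_left)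
    moreover have "ip v \<phi> = ip v (hat a)" unfolding \<phi>_def by (rule ip_nodal_basis_fun[OF a])
    moreover have "ip \<phi> \<phi> = ip (hat a) (hat a)"
      unfolding \<phi>_def by (rule L2_inner_cong_domain) (simp_all add: nodal_basis_fun_domain[OF a])
    ultimately show ?thesis by simp
  qed
  \<comment> \<open>The predicate under the choice operator, shown to have exactly one
    solution.\<close>
  define P where "P = (\<lambda>u. u \<in> range (\<lambda>c x. c * \<phi> x) \<and> (\<forall>w\<in>range (\<lambda>c x. c * \<phi> x). ip (\<lambda>x. v x - u x) w = 0))"
  define c\<^sub>0 where "c\<^sub>0 = ip v (hat a) / ip (hat a) (hat a)"
  have c0: "c\<^sub>0 * ip (hat a) (hat a) = ip v (hat a)" using L2_hat_pos[OF a] by (simp add: c\<^sub>0_def)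
  have P: "P u \<longleftrightarrow> u = (\<lambda>x. c\<^sub>0 * \<phi> x)" for u
  proof
    assume "P u"
    then obtain c where c: "u = (\<lambda>x. c * \<phi> x)" by (auto simp: P_def)
    have "ip (\<lambda>x. v x - u x) (\<lambda>x. 1 * \<phi> x) = 0" using \<open>P u\<close> unfolding P_def by blast
    then have "ip v (hat a) - c * ip (hat a) (hat a) = 0" unfolding c e by simp
    then have "c = c\<^sub>0" using L2_hat_pos[OF a] by (simp add: c\<^sub>0_def field_simps)
    then show "u = (\<lambda>x. c\<^sub>0 * \<phi> x)" by (simp add: c)
  next
    assume "u = (\<lambda>x. c\<^sub>0 * \<phi> x)"
    then show "P u" unfolding P_def by (auto simp: e c0)
  qed
  have "nodal_proj \<Omega> \<T> a v = (SOME u. P u)"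
    by (simp add: nodal_proj_def L2_proj_def P_def \<phi>_def)
  also have "\<dots> = (\<lambda>x. c\<^sub>0 * \<phi> x)" by (simp add: P)
  finally show ?thesis by (simp add: \<phi>_def c\<^sub>0_def)
qed

end

subsection \<open>Mesh hierarchies\<close>

text \<open>\<open>H1_0\<close> does not involve the mesh, so only the affinity on elements has to
  be inherited.\<close>

lemma fe_space_refinement:
  assumes "mesh \<Omega> \<T>" "mesh \<Omega> \<T>'" "refinement_of \<T>' \<T>"
  shows "fe_space \<Omega> \<T> \<subseteq> fe_space \<Omega> \<T>'"
proof
  interpret c: mesh \<Omega> \<T> by fact
  interpret f: mesh \<Omega> \<T>' by fact
  fix v assume v: "v \<in> fe_space \<Omega> \<T>"
  have "\<exists>g c. eq_ae \<tau>' v (\<lambda>x. g \<bullet> x + c)" if \<tau>': "\<tau>' \<in> \<T>'" for \<tau>'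
  proof -
    obtain \<tau> where \<tau>: "\<tau> \<in> \<T>" "\<tau>' \<subseteq> \<tau>" using assms(3) \<tau>' by (auto simp: refinement_of_def)
    then obtain g c where gc: "eq_ae \<tau> v (\<lambda>x. g \<bullet> x + c)" using v by (auto simp: fe_space_def)
    have "AE x in lebesgue. x \<in> \<tau>' \<longrightarrow> v x = g \<bullet> x + c"
      using gc unfolding eq_ae_def AE_lebesgue_on_iff[OF c.sets_element[OF \<tau>(1)]]
      by eventually_elim (use \<tau>(2) in auto)
    then show ?thesis by (auto simp: eq_ae_def AE_lebesgue_on_iff[OF f.sets_element[OF \<tau>']])
  qed
  then show "v \<in> fe_space \<Omega> \<T>'" using v by (simp add: fe_space_def)
qed

locale mesh_hierarchy =
  fixes \<Omega> :: "'a::euclidean_space set" and \<T> :: "nat \<Rightarrow> 'a set set" and J :: nat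
  assumes J: "1 \<le> J"
    and level: "\<And>l. l \<in> {1..J} \<Longrightarrow> mesh \<Omega> (\<T> l)"
    and refine: "\<And>l. l \<in> {2..J} \<Longrightarrow> refinement_of (\<T> l) (\<T> (l - 1))"
    and size_pos: "\<And>l. l \<in> {1..J} \<Longrightarrow> 0 < mesh_size (\<T> l)"
begin

lemma top_level: "mesh \<Omega> (\<T> J)"
  using level J by simp

end

sublocale mesh_hierarchy \<subseteq> top: mesh \<Omega> "\<T> J"
  by (rule top_level)

context mesh_hierarchy
begin

abbreviation ip where "ip \<equiv> L2_inner \<Omega>"
abbreviation V where "V l \<equiv> fe_space \<Omega> (\<T> l)"
abbreviation IV where "IV l \<equiv> interior_vertices \<Omega> (\<T> l)"
abbreviation h where "h l \<equiv> mesh_size (\<T> l)"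
abbreviation hat where "hat l \<equiv> mesh.hat \<Omega> (\<T> l)"
abbreviation nodal where "nodal l \<equiv> nodal_basis_fun \<Omega> (\<T> l)"
abbreviation proj where "proj l \<equiv> L2_proj \<Omega> (V l)"
abbreviation D where "D l a \<equiv> ip (hat l a) (hat l a)"

definition jacobi where
  "jacobi l v w = (\<Sum>a\<in>IV l. ip v (hat l a) * ip w (hat l a) / D l a)"

lemma nested: assumes "l \<in> {1..J}" shows "V l \<subseteq> V J"
proof -
  have "V l \<subseteq> V m" if "l \<le> m" "m \<le> J" for m
    using that
  proof (induction m rule: dec_induct)
    case (step m)
    have "V m \<subseteq> V (Suc m)"
      using refine[of "Suc m"] level[of m] level[of "Suc m"] step assms by (intro fe_space_refinement) auto
    then show ?case using step by auto
  qed simp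
  then show ?thesis using assms by auto
qed

lemma level_sq: "l \<in> {1..J} \<Longrightarrow> v \<in> V l \<Longrightarrow> square_integrable \<Omega> v"
  using nested top.fe.sq by blast

lemma nodal_V: "l \<in> {1..J} \<Longrightarrow> a \<in> IV l \<Longrightarrow> nodal l a \<in> V l"
  by (rule mesh.nodal_basis_fun_fe_space[OF level])

lemma D_pos: "l \<in> {1..J} \<Longrightarrow> a \<in> IV l \<Longrightarrow> 0 < D l a"
  by (rule mesh.L2_hat_pos[OF level])

lemma D_eta: "l \<in> {1..J} \<Longrightarrow> a \<in> IV l \<Longrightarrow> D l a = eta (\<T> l) a * h l ^ DIM('a)"
  by (rule mesh.L2_hat_eta[OF level _ size_pos])

lemma eta_pos: "l \<in> {1..J} \<Longrightarrow> a \<in> IV l \<Longrightarrow> 0 < eta (\<T> l) a"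
  using D_pos[of l a] D_eta[of l a] size_pos[of l] by (simp add: zero_less_mult_iff)

text \<open>Since \<open>D l a\<close> is \<open>eta\<close> times the mesh size to the power
  \<open>d\<close>, the weight in \<open>B_Ric\<close> is \<open>eta\<close> times the weight
  \<open>(h l)\<^sup>2 / D l a\<close> of the same term in \<open>B_Jac\<close>. The comparison of
  the two operators rests on this.\<close>

lemma scaling:
  assumes l: "l \<in> {1..J}" and a: "a \<in> IV l"
  shows "h l powi (2 - int DIM('a)) = eta (\<T> l) a * ((h l)\<^sup>2 / D l a)"
  using size_pos[OF l] eta_pos[OF assms]
  by (simp add: D_eta[OF assms] power_int_diff)

text \<open>With free weights, this covers both \<open>B_Jac\<close> and
  \<open>B_Ric\<close>.\<close>

lemma nodal_combination:
  "(\<lambda>x. \<Sum>l=1..J. \<alpha> l * (\<Sum>a\<in>IV l. \<beta> l a * nodal l a x)) \<in> V J"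
  using nodal_V nested by (intro top.fe.combination) blast

lemma ip_nodal_combination:
  assumes w: "square_integrable \<Omega> w"
  shows "ip (\<lambda>x. \<Sum>l=1..J. \<alpha> l * (\<Sum>a\<in>IV l. \<beta> l a * nodal l a x)) w = (\<Sum>l=1..J. \<alpha> l * (\<Sum>a\<in>IV l. \<beta> l a * ip w (hat l a)))"
proof -
  have sn: "square_integrable \<Omega> (\<lambda>x. \<beta> l a * nodal l a x)" if "l \<in> {1..J}" "a \<in> IV l" for l a
    by (rule square_integrable_mult[OF level_sq[OF that(1) nodal_V[OF that]]])
  have "ip (\<lambda>x. \<Sum>l=1..J. \<alpha> l * (\<Sum>a\<in>IV l. \<beta> l a * nodal l a x)) w =
      (\<Sum>l=1..J. ip (\<lambda>x. \<alpha> l * (\<Sum>a\<in>IV l. \<beta> l a * nodal l a x)) w)"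
    by (rule L2_inner_sum_left[OF square_integrable_mult[OF square_integrable_sum[OF sn]] w])
  also have "\<dots> = (\<Sum>l=1..J. \<alpha> l * (\<Sum>a\<in>IV l. \<beta> l a * ip w (hat l a)))"
  proof (intro sum.cong refl)
    fix l assume l: "l \<in> {1..J}"
    have "ip (\<lambda>x. \<Sum>a\<in>IV l. \<beta> l a * nodal l a x) w = (\<Sum>a\<in>IV l. ip (\<lambda>x. \<beta> l a * nodal l a x) w)"
      by (rule L2_inner_sum_left[OF sn[OF l] w])
    also have "\<dots> = (\<Sum>a\<in>IV l. \<beta> l a * ip w (hat l a))"
      by (intro sum.cong refl)
         (simp only: L2_inner_mult_left L2_inner_commute[of \<Omega> "nodal l _" w] mesh.ip_nodal_basis_fun[OF level[OF l]])
    finally show "ip (\<lambda>x. \<alpha> l * (\<Sum>a\<in>IV l. \<beta> l a * nodal l a x)) w = \<alpha> l * (\<Sum>a\<in>IV l. \<beta> l a * ip w (hat l a))"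
      by (simp only: L2_inner_mult_left)
  qed
  finally show ?thesis .
qed

lemma B_Jac_eq:
  assumes "v \<in> V J"
  shows "B_Jac \<Omega> \<T> J v = (\<lambda>x. \<Sum>l=1..J. (h l)\<^sup>2 * (\<Sum>a\<in>IV l. ip v (hat l a) / D l a * nodal l a x))"
  unfolding B_Jac_def
proof (intro ext sum.cong refl)
  fix x l assume l: "l \<in> {1..J}"
  have "(\<Sum>a\<in>IV l. nodal_proj \<Omega> (\<T> l) a v x) = (\<Sum>a\<in>IV l. ip v (hat l a) / D l a * nodal l a x)"
    by (intro sum.cong refl) (simp only: mesh.nodal_proj_eq[OF level[OF l] _ top.fe.sq[OF assms]])
  then show "(h l)\<^sup>2 * (\<Sum>a\<in>IV l. nodal_proj \<Omega> (\<T> l) a v x) = (h l)\<^sup>2 * (\<Sum>a\<in>IV l. ip v (hat l a) / D l a * nodal l a x)"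
    by simp
qed

lemma B_Ric_eq:
  "B_Ric \<Omega> \<T> J v = (\<lambda>x. \<Sum>l=1..J. h l powi (2 - int DIM('a)) * (\<Sum>a\<in>IV l. ip v (hat l a) * nodal l a x))"
  unfolding B_Ric_def
proof (intro ext sum.cong refl)
  fix x l assume l: "l \<in> {1..J}"
  have "(\<Sum>a\<in>IV l. ip v (nodal l a) * nodal l a x) = (\<Sum>a\<in>IV l. ip v (hat l a) * nodal l a x)"
    by (intro sum.cong refl) (simp only: mesh.ip_nodal_basis_fun[OF level[OF l]])
  then show "h l powi (2 - int DIM('a)) * (\<Sum>a\<in>IV l. ip v (nodal l a) * nodal l a x) =
      h l powi (2 - int DIM('a)) * (\<Sum>a\<in>IV l. ip v (hat l a) * nodal l a x)"
    by simp
qed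

lemma ip_B_Jac:
  assumes "v \<in> V J" "w \<in> V J"
  shows "ip (B_Jac \<Omega> \<T> J v) w = (\<Sum>l=1..J. (h l)\<^sup>2 * jacobi l v w)"
  unfolding B_Jac_eq[OF assms(1)] ip_nodal_combination[OF top.fe.sq[OF assms(2)]] by (simp add: jacobi_def)

lemma ip_B_Ric:
  assumes "v \<in> V J"
  shows "ip (B_Ric \<Omega> \<T> J v) v = (\<Sum>l=1..J. (h l)\<^sup>2 * (\<Sum>a\<in>IV l. eta (\<T> l) a * ((ip v (hat l a))\<^sup>2 / D l a)))"
proof -
  have "ip (B_Ric \<Omega> \<T> J v) v = (\<Sum>l=1..J. h l powi (2 - int DIM('a)) * (\<Sum>a\<in>IV l. ip v (hat l a) * ip v (hat l a)))"
    unfolding B_Ric_eq by (rule ip_nodal_combination[OF top.fe.sq[OF assms]])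
  also have "\<dots> = (\<Sum>l=1..J. (h l)\<^sup>2 * (\<Sum>a\<in>IV l. eta (\<T> l) a * ((ip v (hat l a))\<^sup>2 / D l a)))"
    unfolding sum_distrib_left by (intro sum.cong refl) (simp add: scaling power2_eq_square)
  finally show ?thesis .
qed

lemma ip_B_Jac_self:
  assumes "v \<in> V J"
  shows "ip (B_Jac \<Omega> \<T> J v) v = (\<Sum>l=1..J. (h l)\<^sup>2 * (\<Sum>a\<in>IV l. (ip v (hat l a))\<^sup>2 / D l a))"
  by (simp add: ip_B_Jac[OF assms assms] jacobi_def power2_eq_square)

lemma finite_eta_values: "finite (eta_values \<Omega> \<T> J)"
proof -
  have "eta_values \<Omega> \<T> J = (\<Union>l\<in>{1..J}. eta (\<T> l) ` IV l)"
    unfolding eta_values_def by blast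
  then show ?thesis using mesh.finite_interior_vertices[OF level] by simp
qed

text \<open>Termwise comparison of nonnegative sums. Without interior vertices both sums are empty,
  and the unspecified extrema of the empty set are multiplied by zero.\<close>

lemma Jac_Ric_bounds:
  assumes v: "v \<in> V J"
  shows "Min (eta_values \<Omega> \<T> J) * ip (B_Jac \<Omega> \<T> J v) v \<le> ip (B_Ric \<Omega> \<T> J v) v"
    "ip (B_Ric \<Omega> \<T> J v) v \<le> Max (eta_values \<Omega> \<T> J) * ip (B_Jac \<Omega> \<T> J v) v"
proof -
  have mem: "eta (\<T> l) a \<in> eta_values \<Omega> \<T> J" if "l \<in> {1..J}" "a \<in> IV l" for l a
    using that by (auto simp: eta_values_def)
  have nonneg: "0 \<le> (ip v (hat l a))\<^sup>2 / D l a" for l a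
    by (simp add: L2_inner_nonneg)
  have eq: "k * ip (B_Jac \<Omega> \<T> J v) v = (\<Sum>l=1..J. (h l)\<^sup>2 * (\<Sum>a\<in>IV l. k * ((ip v (hat l a))\<^sup>2 / D l a)))" for k
    unfolding ip_B_Jac_self[OF v] by (simp add: sum_distrib_left mult.left_commute)
  show "Min (eta_values \<Omega> \<T> J) * ip (B_Jac \<Omega> \<T> J v) v \<le> ip (B_Ric \<Omega> \<T> J v) v"
    unfolding eq ip_B_Ric[OF v]
    by (intro sum_mono mult_left_mono mult_right_mono nonneg Min_le finite_eta_values mem) auto
  show "ip (B_Ric \<Omega> \<T> J v) v \<le> Max (eta_values \<Omega> \<T> J) * ip (B_Jac \<Omega> \<T> J v) v"
    unfolding eq ip_B_Ric[OF v]
    by (intro sum_mono mult_left_mono mult_right_mono nonneg Max_ge finite_eta_values mem) auto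
qed

lemma B_Ric_eq_scaled_B_Jac:
  assumes v: "v \<in> V J" and c: "\<And>l a. l \<in> {1..J} \<Longrightarrow> a \<in> IV l \<Longrightarrow> eta (\<T> l) a = c"
  shows "B_Ric \<Omega> \<T> J v = (\<lambda>x. c * B_Jac \<Omega> \<T> J v x)"
  unfolding B_Ric_eq B_Jac_eq[OF v] sum_distrib_left
  by (intro ext sum.cong refl) (simp add: scaling c)

section \<open>Comparison with the multilevel projection and the condition numbers\<close>

lemma proj_spec:
  assumes "l \<in> {1..J}" "square_integrable \<Omega> v"
  shows "proj l v \<in> V l" "w \<in> V l \<Longrightarrow> ip (proj l v) w = ip v w"
proof -
  interpret m: mesh \<Omega> "\<T> l" by (rule level[OF assms(1)])
  show "proj l v \<in> V l" "w \<in> V l \<Longrightarrow> ip (proj l v) w = ip v w"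
    by (rule m.fe.L2_proj_spec[OF assms(2)])+
qed

lemma B_op_V: "v \<in> V J \<Longrightarrow> B_op \<Omega> \<T> J v \<in> V J"
  unfolding B_op_def using proj_spec(1)[OF _ top.fe.sq] nested by (intro top.fe.combination) blast

lemma ip_B_op:
  assumes v: "v \<in> V J" and w: "w \<in> V J"
  shows "ip (B_op \<Omega> \<T> J v) w = (\<Sum>l=1..J. (h l)\<^sup>2 * ip (proj l v) (proj l w))"
proof -
  note sv = top.fe.sq[OF v] and sw = top.fe.sq[OF w]
  have "ip (B_op \<Omega> \<T> J v) w = (\<Sum>l=1..J. (h l)\<^sup>2 * ip (proj l v) w)"
    unfolding B_op_def
    by (rule top.fe.ip_combination[OF _ w]) (use proj_spec(1)[OF _ sv] nested in blast)
  also have "\<dots> = (\<Sum>l=1..J. (h l)\<^sup>2 * ip (proj l v) (proj l w))"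
  proof (intro sum.cong refl)
    fix l assume l: "l \<in> {1..J}"
    have "ip (proj l v) w = ip w (proj l v)" by (rule L2_inner_commute)
    also have "\<dots> = ip (proj l w) (proj l v)" using proj_spec[OF l sw] proj_spec(1)[OF l sv] by simp
    also have "\<dots> = ip (proj l v) (proj l w)" by (rule L2_inner_commute)
    finally show "(h l)\<^sup>2 * ip (proj l v) w = (h l)\<^sup>2 * ip (proj l v) (proj l w)" by simp
  qed
  finally show ?thesis .
qed

lemma proj_top:
  assumes v: "v \<in> V J"
  shows "ip (proj J v) (proj J v) = ip v v"
proof -
  have J': "J \<in> {1..J}" using J by simp
  note p = proj_spec[OF J' top.fe.sq[OF v]]
  have "ip (proj J v) (proj J v) = ip v (proj J v)" by (rule p(2)[OF p(1)])
  also have "\<dots> = ip (proj J v) v" by (rule L2_inner_commute)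
  also have "\<dots> = ip v v" by (rule p(2)[OF v])
  finally show ?thesis .
qed

text \<open>The finest level alone suffices, as its projection preserves the norm on
  \<open>V J\<close>.\<close>

lemma B_op_coercive:
  assumes v: "v \<in> V J"
  shows "(h J)\<^sup>2 * ip v v \<le> ip (B_op \<Omega> \<T> J v) v"
proof -
  have "(h J)\<^sup>2 * ip (proj J v) (proj J v) \<le> (\<Sum>l=1..J. (h l)\<^sup>2 * ip (proj l v) (proj l v))"
    using J by (intro member_le_sum[where f = "\<lambda>l. (h l)\<^sup>2 * ip (proj l v) (proj l v)"]) (auto simp: L2_inner_nonneg)
  then show ?thesis by (simp add: ip_B_op[OF v v] proj_top[OF v])
qed

lemma B_op_bounded:
  assumes v: "v \<in> V J"
  shows "ip (B_op \<Omega> \<T> J v) v \<le> (\<Sum>l=1..J. (h l)\<^sup>2) * ip v v"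
  unfolding ip_B_op[OF v v] sum_distrib_right
  using mesh.proj_le[OF level top.fe.sq[OF v]] by (intro sum_mono mult_left_mono) auto

text \<open>The estimates on one level have constants independent of the level, so they add up with
  the weights \<open>(h l)\<^sup>2\<close>.\<close>

lemma B_op_Jac:
  assumes v: "v \<in> V J"
  shows "ip (B_op \<Omega> \<T> J v) v \<le> 2 * ip (B_Jac \<Omega> \<T> J v) v"
    "ip (B_Jac \<Omega> \<T> J v) v \<le> (real DIM('a) + 2) / 2 * ip (B_op \<Omega> \<T> J v) v"
proof -
  have b: "ip (proj l v) (proj l v) \<le> 2 * jacobi l v v"
    "jacobi l v v \<le> (real DIM('a) + 2) / 2 * ip (proj l v) (proj l v)" if l: "l \<in> {1..J}" for l
    using mesh.proj_jacobi_bounds[OF level[OF l] top.fe.sq[OF v]] unfolding jacobi_def by blast+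
  show "ip (B_op \<Omega> \<T> J v) v \<le> 2 * ip (B_Jac \<Omega> \<T> J v) v"
    unfolding ip_B_op[OF v v] ip_B_Jac[OF v v] sum_distrib_left mult.left_commute[of 2]
    using b(1) by (intro sum_mono mult_left_mono) auto
  show "ip (B_Jac \<Omega> \<T> J v) v \<le> (real DIM('a) + 2) / 2 * ip (B_op \<Omega> \<T> J v) v"
    unfolding ip_B_op[OF v v] ip_B_Jac[OF v v] sum_distrib_left mult.left_commute[of "(real DIM('a) + 2) / 2"]
    using b(2) by (intro sum_mono mult_left_mono) auto
qed

lemma spd_B_op: "top.fe.spd (B_op \<Omega> \<T> J)"
  unfolding top.fe.spd_def
proof (intro conjI ballI)
  show "ip (B_op \<Omega> \<T> J u) w = ip (B_op \<Omega> \<T> J w) u" if "u \<in> V J" "w \<in> V J" for u w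
    unfolding ip_B_op[OF that] ip_B_op[OF that(2,1)] by (intro sum.cong refl) (simp only: L2_inner_commute)
  show "\<exists>\<mu>>0. \<forall>u\<in>V J. \<mu> * ip u u \<le> ip (B_op \<Omega> \<T> J u) u"
    using B_op_coercive size_pos[of J] J by (intro exI[of _ "(h J)\<^sup>2"]) auto
qed (rule B_op_V)

lemma spd_B_Jac: "top.fe.spd (B_Jac \<Omega> \<T> J)"
  unfolding top.fe.spd_def
proof (intro conjI ballI)
  show "B_Jac \<Omega> \<T> J u \<in> V J" if "u \<in> V J" for u
    unfolding B_Jac_eq[OF that] by (rule nodal_combination)
  show "ip (B_Jac \<Omega> \<T> J u) w = ip (B_Jac \<Omega> \<T> J w) u" if "u \<in> V J" "w \<in> V J" for u w
    unfolding ip_B_Jac[OF that] ip_B_Jac[OF that(2,1)] jacobi_def by (simp only: mult.commute)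
  show "\<exists>\<mu>>0. \<forall>u\<in>V J. \<mu> * ip u u \<le> ip (B_Jac \<Omega> \<T> J u) u"
  proof (intro exI[of _ "(h J)\<^sup>2 / 2"] conjI ballI)
    show "0 < (h J)\<^sup>2 / 2" using size_pos[of J] J by simp
    show "(h J)\<^sup>2 / 2 * ip u u \<le> ip (B_Jac \<Omega> \<T> J u) u" if "u \<in> V J" for u
      using B_op_coercive[OF that] B_op_Jac(1)[OF that] by simp
  qed
qed

text \<open>The factor \<open>d + 2\<close> is the product of the constants \<open>2\<close> and
  \<open>(d + 2) / 2\<close> in \<open>B_op_Jac\<close>. The equality is
  \<open>cond_number_mono\<close> in both directions with constants \<open>c\<close> and
  \<open>1 / c\<close>, whose product is one.\<close>

lemma cond_numbers:
  assumes c: "\<And>l a. l \<in> {1..J} \<Longrightarrow> a \<in> IV l \<Longrightarrow> eta (\<T> l) a = c"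
    and ne: "nonzero_elements \<Omega> (V J) \<noteq> {}"
  defines "A \<equiv> stiffness_op \<Omega> (V J)"
  shows "cond_number \<Omega> (V J) A (B_Ric \<Omega> \<T> J) = cond_number \<Omega> (V J) A (B_Jac \<Omega> \<T> J)"
    "cond_number \<Omega> (V J) A (B_Jac \<Omega> \<T> J) \<le> (real DIM('a) + 2) * cond_number \<Omega> (V J) A (B_op \<Omega> \<T> J)"
proof -
  have Jl: "J \<in> {1..J}" using J by simp
  obtain v0 where v0: "v0 \<in> V J" "\<not> eq_ae \<Omega> v0 (\<lambda>x. 0)" using ne by (auto simp: nonzero_elements_def)
  \<comment> \<open>Without interior vertices the expansion of \<open>v0\<close> would be an empty
    sum. So \<open>c\<close> is a value of \<open>eta\<close> actually attained, hence
    positive.\<close>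
  have "IV J \<noteq> {}" using top.fe.expand[OF v0(1)] v0(2) by (auto simp: eq_ae_def)
  then obtain a where a: "a \<in> IV J" by blast
  have cpos: "c > 0" using eta_pos[OF Jl a] c[OF Jl a] by simp
  have Ric: "ip (B_Ric \<Omega> \<T> J u) w = c * ip (B_Jac \<Omega> \<T> J u) w" if "u \<in> V J" for u w
  proof -
    have "B_Ric \<Omega> \<T> J u = (\<lambda>x. c * B_Jac \<Omega> \<T> J u x)"
      by (rule B_Ric_eq_scaled_B_Jac[OF that]) (rule c)
    then show ?thesis by (simp only: L2_inner_mult_left)
  qed
  have spd_Ric: "top.fe.spd (B_Ric \<Omega> \<T> J)"
  proof -
    obtain \<mu> where \<mu>: "\<mu> > 0" "\<And>u. u \<in> V J \<Longrightarrow> \<mu> * ip u u \<le> ip (B_Jac \<Omega> \<T> J u) u"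
      using spd_B_Jac unfolding top.fe.spd_def by blast
    show ?thesis
      unfolding top.fe.spd_def
    proof (intro conjI ballI)
      show "B_Ric \<Omega> \<T> J u \<in> V J" if "u \<in> V J" for u
        unfolding B_Ric_eq by (rule nodal_combination)
      show "ip (B_Ric \<Omega> \<T> J u) w = ip (B_Ric \<Omega> \<T> J w) u" if "u \<in> V J" "w \<in> V J" for u w
        using spd_B_Jac that by (simp add: Ric top.fe.spd_def)
      show "\<exists>\<mu>>0. \<forall>u\<in>V J. \<mu> * ip u u \<le> ip (B_Ric \<Omega> \<T> J u) u"
        using \<mu> cpos by (intro exI[of _ "c * \<mu>"]) (auto simp: Ric mult.assoc)
    qed
  qed
  define C where "C = (\<Sum>l=1..J. (h l)\<^sup>2)"
  have Cpos: "C > 0" unfolding C_def using J size_pos by (intro sum_pos) force+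
  have Cop: "ip (B_op \<Omega> \<T> J u) u \<le> C * ip u u" if "u \<in> V J" for u
    unfolding C_def by (rule B_op_bounded[OF that])
  define k where "k = (real DIM('a) + 2) / 2"
  have kpos: "k > 0" by (simp add: k_def)
  have CJac: "ip (B_Jac \<Omega> \<T> J u) u \<le> (k * C) * ip u u" if "u \<in> V J" for u
    using order_trans[OF B_op_Jac(2)[OF that] mult_left_mono[OF Cop[OF that]], folded k_def] kpos
    by (simp add: mult.assoc)
  have CRic: "ip (B_Ric \<Omega> \<T> J u) u \<le> (c * (k * C)) * ip u u" if "u \<in> V J" for u
    using mult_left_mono[OF CJac[OF that] less_imp_le[OF cpos]] by (simp only: Ric[OF that] mult.assoc)
  obtain K where K: "\<And>v. v \<in> V J \<Longrightarrow> top.energy v v \<le> K * ip v v" using top.energy_bound by blast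
  have A: "ip (A v) v = top.energy v v" if "v \<in> V J" for v
    unfolding A_def by (rule top.stiffness_op_spec[OF that that])
  have A0: "0 \<le> ip (A v) v" if "v \<in> V J" for v
    unfolding A[OF that] by (rule L2_inner_nonneg)
  have AK: "ip (A v) v \<le> K * ip v v" if "v \<in> V J" for v
    unfolding A[OF that] by (rule K[OF that])
  have "cond_number \<Omega> (V J) A (B_Jac \<Omega> \<T> J) \<le> 2 * k * cond_number \<Omega> (V J) A (B_op \<Omega> \<T> J)"
    using B_op_Jac unfolding k_def[symmetric]
    by (intro top.fe.cond_number_mono[OF spd_B_Jac spd_B_op kpos _ _ _ Cpos Cop A0 AK ne]) auto
  then show "cond_number \<Omega> (V J) A (B_Jac \<Omega> \<T> J) \<le> (real DIM('a) + 2) * cond_number \<Omega> (V J) A (B_op \<Omega> \<T> J)"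
  proof -
    have "2 * k = real DIM('a) + 2" by (simp add: k_def)
    with \<open>cond_number \<Omega> (V J) A (B_Jac \<Omega> \<T> J) \<le> 2 * k * cond_number \<Omega> (V J) A (B_op \<Omega> \<T> J)\<close>
    show ?thesis by (simp only:)
  qed
  have "cond_number \<Omega> (V J) A (B_Ric \<Omega> \<T> J) \<le> 1 / c * c * cond_number \<Omega> (V J) A (B_Jac \<Omega> \<T> J)"
    by (rule top.fe.cond_number_mono[OF spd_Ric spd_B_Jac cpos _ _ _ _ CJac A0 AK ne])
       (use cpos kpos Cpos in \<open>auto simp: Ric\<close>)
  moreover have "cond_number \<Omega> (V J) A (B_Jac \<Omega> \<T> J) \<le> c * (1 / c) * cond_number \<Omega> (V J) A (B_Ric \<Omega> \<T> J)"
    by (rule top.fe.cond_number_mono[OF spd_B_Jac spd_Ric _ cpos _ _ _ CRic A0 AK ne])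
       (use cpos kpos Cpos in \<open>auto simp: Ric\<close>)
  ultimately show "cond_number \<Omega> (V J) A (B_Ric \<Omega> \<T> J) = cond_number \<Omega> (V J) A (B_Jac \<Omega> \<T> J)"
    using cpos by simp
qed

end

theorem proposition6p12:
  fixes \<Omega> :: "'a::euclidean_space set"
    and \<T> :: "nat \<Rightarrow> 'a set set"
    and J :: nat
    and \<gamma> c\<^sub>1 c\<^sub>2 \<rho> \<sigma> C0 :: real
  defines "V \<equiv> fe_space \<Omega> (\<T> J)"
  defines "A \<equiv> stiffness_op \<Omega> V"
  assumes "polyhedral_convex_domain \<Omega>"
    and "J \<ge> 1"
    and "\<And>l. l \<in> {1..J} \<Longrightarrow> triangulation_of \<Omega> (\<T> l)"
    and "\<And>l. l \<in> {2..J} \<Longrightarrow> refinement_of (\<T> l) (\<T> (l - 1))"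
    and "0 < \<gamma>" and "\<gamma> < 1" and "0 < c\<^sub>1" and "c\<^sub>1 \<le> c\<^sub>2"
    and "\<And>l. l \<in> {1..J} \<Longrightarrow>
           c\<^sub>1 * \<gamma> ^ (2 * l) \<le> mesh_size (\<T> l) \<and> mesh_size (\<T> l) \<le> c\<^sub>2 * \<gamma> ^ (2 * l)"
    and "\<rho> > 0" and "\<sigma> > 0" and "C0 > 0"
    and "condition_T \<Omega> (\<T> J) \<rho> \<sigma> C0"
  shows "(\<forall>v\<in>V.
           Min (eta_values \<Omega> \<T> J) * L2_inner \<Omega> (B_Jac \<Omega> \<T> J v) v
             \<le> L2_inner \<Omega> (B_Ric \<Omega> \<T> J v) v \<and>
           L2_inner \<Omega> (B_Ric \<Omega> \<T> J v) v
             \<le> Max (eta_values \<Omega> \<T> J) * L2_inner \<Omega> (B_Jac \<Omega> \<T> J v) v) \<and>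
         ((\<forall>l\<in>{1..J}. \<forall>a\<in>interior_vertices \<Omega> (\<T> l).
           \<forall>l'\<in>{1..J}. \<forall>a'\<in>interior_vertices \<Omega> (\<T> l'). eta (\<T> l) a = eta (\<T> l') a')
          \<longrightarrow> (\<exists>c. \<forall>v\<in>V. eq_ae \<Omega> (B_Ric \<Omega> \<T> J v) (\<lambda>x. c * B_Jac \<Omega> \<T> J v x)) \<and>
              (nonzero_elements \<Omega> V \<noteq> {} \<longrightarrow>
                 cond_number \<Omega> V A (B_Ric \<Omega> \<T> J) = cond_number \<Omega> V A (B_Jac \<Omega> \<T> J) \<and>
                 cond_number \<Omega> V A (B_Jac \<Omega> \<T> J)
                   \<le> (real DIM('a) + 2) * cond_number \<Omega> V A (B_op \<Omega> \<T> J)))"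
proof -
  interpret mesh_hierarchy \<Omega> \<T> J
  proof (rule mesh_hierarchy.intro)
    show "1 \<le> J" by fact
    show "mesh \<Omega> (\<T> l)" if "l \<in> {1..J}" for l
      using assms that by (intro mesh.intro) auto
    show "refinement_of (\<T> l) (\<T> (l - 1))" if "l \<in> {2..J}" for l
      using assms that by blast
    show "0 < mesh_size (\<T> l)" if "l \<in> {1..J}" for l
    proof -
      have "0 < c\<^sub>1 * \<gamma> ^ (2 * l)" using assms by simp
      also have "\<dots> \<le> mesh_size (\<T> l)" using assms that by blast
      finally show ?thesis .
    qed
  qed
  show ?thesis
    unfolding V_def A_def
  proof (intro conjI ballI impI)
    fix v assume v: "v \<in> fe_space \<Omega> (\<T> J)"
    show "Min (eta_values \<Omega> \<T> J) * L2_inner \<Omega> (B_Jac \<Omega> \<T> J v) v \<le> L2_inner \<Omega> (B_Ric \<Omega> \<T> J v) v"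
      "L2_inner \<Omega> (B_Ric \<Omega> \<T> J v) v \<le> Max (eta_values \<Omega> \<T> J) * L2_inner \<Omega> (B_Jac \<Omega> \<T> J v) v"
      by (rule Jac_Ric_bounds[OF v])+
  next
    assume const: "\<forall>l\<in>{1..J}. \<forall>a\<in>interior_vertices \<Omega> (\<T> l).
      \<forall>l'\<in>{1..J}. \<forall>a'\<in>interior_vertices \<Omega> (\<T> l'). eta (\<T> l) a = eta (\<T> l') a'"
    \<comment> \<open>Without interior vertices \<open>c\<close> is arbitrary, and the claim about
      it below is vacuous.\<close>
    define c where "c = (SOME c. c \<in> eta_values \<Omega> \<T> J)"
    have c: "eta (\<T> l) a = c" if "l \<in> {1..J}" "a \<in> interior_vertices \<Omega> (\<T> l)" for l a
    proof -
      have "\<exists>c. c \<in> eta_values \<Omega> \<T> J" using that unfolding eta_values_def by blast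
      then have "c \<in> eta_values \<Omega> \<T> J" unfolding c_def by (rule someI_ex)
      then obtain l' a' where "c = eta (\<T> l') a'" "l' \<in> {1..J}" "a' \<in> interior_vertices \<Omega> (\<T> l')"
        unfolding eta_values_def by blast
      then show ?thesis using const that by blast
    qed
    show "\<exists>c. \<forall>v\<in>fe_space \<Omega> (\<T> J). eq_ae \<Omega> (B_Ric \<Omega> \<T> J v) (\<lambda>x. c * B_Jac \<Omega> \<T> J v x)"
    proof (intro exI[of _ c] ballI)
      fix v assume "v \<in> fe_space \<Omega> (\<T> J)"
      then have "B_Ric \<Omega> \<T> J v = (\<lambda>x. c * B_Jac \<Omega> \<T> J v x)"
        by (rule B_Ric_eq_scaled_B_Jac) (rule c)
      then show "eq_ae \<Omega> (B_Ric \<Omega> \<T> J v) (\<lambda>x. c * B_Jac \<Omega> \<T> J v x)"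
        by (simp add: eq_ae_def)
    qed
    assume ne: "nonzero_elements \<Omega> (fe_space \<Omega> (\<T> J)) \<noteq> {}"
    show "cond_number \<Omega> (fe_space \<Omega> (\<T> J)) (stiffness_op \<Omega> (fe_space \<Omega> (\<T> J))) (B_Ric \<Omega> \<T> J) =
        cond_number \<Omega> (fe_space \<Omega> (\<T> J)) (stiffness_op \<Omega> (fe_space \<Omega> (\<T> J))) (B_Jac \<Omega> \<T> J)"
      by (rule cond_numbers(1)[OF _ ne]) (rule c)
    show "cond_number \<Omega> (fe_space \<Omega> (\<T> J)) (stiffness_op \<Omega> (fe_space \<Omega> (\<T> J))) (B_Jac \<Omega> \<T> J)
        \<le> (real DIM('a) + 2) * cond_number \<Omega> (fe_space \<Omega> (\<T> J)) (stiffness_op \<Omega> (fe_space \<Omega> (\<T> J))) (B_op \<Omega> \<T> J)"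
      by (rule cond_numbers(2)[OF _ ne]) (rule c)
  qed
qed

end
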